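(* Let $K\subset\{(x,y)\in\mathbb{R}^2: 0<x\le y\}$ be a compact set and let $E:=\{\xi\in\mathbb{R}^{2\times 2}: (\lambda_1(\xi),\lambda_2(\xi))\in K\}$. Let $\Omega\subset\mathbb{R}^2$ be a bounded open set and let $\varphi\in C^1_{piec}(\overline{\Omega},\mathbb{R}^2)$ be such that $D\varphi(x)\in E\cup \operatorname{int}E^{rc}$ for a.e. $x\in\Omega$. Then there exists $u\in\varphi+W^{1,\infty}_0(\Omega,\mathbb{R}^2)$ such that $Du\in E$ a.e. in $\Omega$.
   Context: For $\xi\in\mathbb{R}^{2\times2}$, $0\le\lambda_1(\xi)\le\lambda_2(\xi)$ denote the singular values of $\xi$, i.e. the eigenvalues of $\sqrt{\xi\xi^t}$. A function $f:\mathbb{R}^{N\times n}\to\mathbb{R}$ is rank one convex if $f(t\xi+(1-t)\eta)\le tf(\xi)+(1-t)f(\eta)$ for all $t\in[0,1]$ and all $\xi,\eta$ with $\operatorname{rank}(\xi-\eta)=1$. For a compact set $E\subset\mathbb{R}^{N\times n}$, $E^{rc}:=\{\xi: f(\xi)\le 0$ for every rank one convex $f:\mathbb{R}^{N\times n}\to\mathbb{R}$ with $f\le 0$ on $E\}$. $\varphi\in C^1_{piec}(\overline{\Omega},\mathbb{R}^2)$ means: $\varphi\in W^{1,\infty}(\Omega,\mathbb{R}^2)$ and there exist open sets $\omega_i\subset\Omega$ with $\varphi\in C^1(\overline{\omega_i},\mathbb{R}^2)$ and $\Omega\setminus\bigcup_i\omega_i$ of Lebesgue measure zero. *)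

theory Defs
  imports "HOL-Analysis.Analysis"
begin

(* Matrices xi :: real^2^2, xi $ i $ j = entry in row i, column j.
   For u : R^2 -> R^2, (Du x) $ i $ j = partial_j u_i (x). *)

(* Singular values (lambda1, lambda2), 0 <= lambda1 <= lambda2: the eigenvalues (with
   multiplicity) of sqrt(xi xi^t); equivalently lambda1^2, lambda2^2 are the roots, with
   multiplicity, of the characteristic polynomial of xi xi^t. *)
definition sing_vals :: "real^2^2 \<Rightarrow> real \<times> real" where
  "sing_vals xi = (THE (a, b). 0 \<le> a \<and> a \<le> b \<and>
      (\<forall>t::real. det (t *\<^sub>R mat 1 - xi ** transpose xi) = (t - a\<^sup>2) * (t - b\<^sup>2)))"

definition lambda1 :: "real^2^2 \<Rightarrow> real" where "lambda1 xi = fst (sing_vals xi)"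
definition lambda2 :: "real^2^2 \<Rightarrow> real" where "lambda2 xi = snd (sing_vals xi)"

definition rank_one_convex :: "(real^'n^'m \<Rightarrow> real) \<Rightarrow> bool" where
  "rank_one_convex f \<longleftrightarrow>
     (\<forall>t xi eta. 0 \<le> t \<and> t \<le> 1 \<and> rank (xi - eta) = 1 \<longrightarrow>
        f (t *\<^sub>R xi + (1 - t) *\<^sub>R eta) \<le> t * f xi + (1 - t) * f eta)"

definition rc_hull :: "(real^'n^'m) set \<Rightarrow> (real^'n^'m) set" where
  "rc_hull E = {xi. \<forall>f. rank_one_convex f \<and> (\<forall>eta\<in>E. f eta \<le> 0) \<longrightarrow> f xi \<le> 0}"

definition test_fun :: "(real^2) set \<Rightarrow> (real^2 \<Rightarrow> real) \<Rightarrow> (real^2 \<Rightarrow> real^2) \<Rightarrow> bool" where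
  "test_fun \<Omega> psi dpsi \<longleftrightarrow>
     (\<forall>x. (psi has_derivative (\<lambda>h. dpsi x \<bullet> h)) (at x)) \<and> continuous_on UNIV dpsi \<and>
     compact (closure {x. psi x \<noteq> 0}) \<and> closure {x. psi x \<noteq> 0} \<subseteq> \<Omega>"

definition test_fun_vec :: "(real^2) set \<Rightarrow> (real^2 \<Rightarrow> real^2) \<Rightarrow> (real^2 \<Rightarrow> real^2^2) \<Rightarrow> bool" where
  "test_fun_vec \<Omega> psi Dpsi \<longleftrightarrow> (\<forall>i. test_fun \<Omega> (\<lambda>x. psi x $ i) (\<lambda>x. Dpsi x $ i))"

definition locally_integrable_on :: "(real^2 \<Rightarrow> 'b::euclidean_space) \<Rightarrow> (real^2) set \<Rightarrow> bool" where
  "locally_integrable_on f \<Omega> \<longleftrightarrow> (\<forall>C. compact C \<and> C \<subseteq> \<Omega> \<longrightarrow> f absolutely_integrable_on C)"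

definition weak_deriv :: "(real^2) set \<Rightarrow> (real^2 \<Rightarrow> real^2) \<Rightarrow> (real^2 \<Rightarrow> real^2^2) \<Rightarrow> bool" where
  "weak_deriv \<Omega> u G \<longleftrightarrow> locally_integrable_on u \<Omega> \<and> locally_integrable_on G \<Omega> \<and>
     (\<forall>psi dpsi. test_fun \<Omega> psi dpsi \<longrightarrow>
        (\<forall>i j. integral \<Omega> (\<lambda>x. u x $ i * dpsi x $ j) = - integral \<Omega> (\<lambda>x. G x $ i $ j * psi x)))"

definition W1inf :: "(real^2) set \<Rightarrow> (real^2 \<Rightarrow> real^2) \<Rightarrow> bool" where
  "W1inf \<Omega> u \<longleftrightarrow> (\<exists>G C. weak_deriv \<Omega> u G \<and>
     (AE x in lebesgue. x \<in> \<Omega> \<longrightarrow> norm (u x) \<le> C \<and> norm (G x) \<le> C))"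

definition W11_0 :: "(real^2) set \<Rightarrow> (real^2 \<Rightarrow> real^2) \<Rightarrow> bool" where
  "W11_0 \<Omega> u \<longleftrightarrow> (\<exists>G. weak_deriv \<Omega> u G \<and> u absolutely_integrable_on \<Omega> \<and> G absolutely_integrable_on \<Omega> \<and>
     (\<exists>psi Dpsi. (\<forall>k::nat. test_fun_vec \<Omega> (psi k) (Dpsi k)) \<and>
        (\<lambda>k. integral \<Omega> (\<lambda>x. norm (psi k x - u x)) + integral \<Omega> (\<lambda>x. norm (Dpsi k x - G x)))
          \<longlonglongrightarrow> 0))"

definition W1inf_0 :: "(real^2) set \<Rightarrow> (real^2 \<Rightarrow> real^2) \<Rightarrow> bool" where
  "W1inf_0 \<Omega> u \<longleftrightarrow> W1inf \<Omega> u \<and> W11_0 \<Omega> u"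

definition C1_closure :: "(real^2) set \<Rightarrow> (real^2 \<Rightarrow> real^2) \<Rightarrow> bool" where
  "C1_closure w phi \<longleftrightarrow> continuous_on (closure w) phi \<and>
     (\<exists>D. continuous_on (closure w) D \<and> (\<forall>x\<in>w. (phi has_derivative (\<lambda>h. D x *v h)) (at x)))"

definition C1_piec :: "(real^2) set \<Rightarrow> (real^2 \<Rightarrow> real^2) \<Rightarrow> bool" where
  "C1_piec \<Omega> phi \<longleftrightarrow> W1inf \<Omega> phi \<and>
     (\<exists>W. countable W \<and> (\<forall>w\<in>W. open w \<and> w \<subseteq> \<Omega> \<and> C1_closure w phi) \<and>
          \<Omega> - \<Union>W \<in> null_sets lebesgue)"

end

(* Write xi v = z v + w (conj v) with complex numbers z, w; then lambda2 = |z| + |w|,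
   lambda1 = ||z| - |w|| and det = |z|^2 - |w|^2. For 0 <= theta <= b = max_K y the functions
   h_theta(x, y) = (y - theta) (x + theta), cut off at 0, are rank-one convex in xi, so the interior
   of the hull of E lies in the open set U of all xi such that h_theta(lambda1, lambda2) is below
   max_K h_theta for every theta in [0, b].

   Points of the closure of U outside E are not stable: near such a point every matrix of U is the
   midpoint of a rank-one segment in U of a length bounded from below. To a pair (x, y) belongs the
   line theta |-> x y + theta (y - x), and h_theta(x, y) is this line minus theta^2; if the line of a
   boundary point touches the upper envelope of the lines of K at theta0 without belonging to K,
   then its slope lies strictly between slopes of lines of K through the same point, and there is a
   rank-one direction along which the line pivots about theta0.

   On the open set where the derivative of phi lies in U, add compactly supported C^1 oscillations
   along these segments on disjoint small balls. On balls where all earlier gradients are nearly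
   constant the new oscillation is almost orthogonal to them in L^2; the L^2 norms being bounded, the
   gradients converge in L^2 and the segments still available shrink to points, which puts
   the limit gradient in E. *)
theory Submission
  imports Defs
begin

section \<open>Singular values and rank-one convexity\<close>

text \<open>Small oscillations make the maps converge uniformly, but their gradients in general only
  weakly, and a weak limit may leave \<open>E\<close>. Strong convergence is forced by making each
  increment nearly orthogonal to all earlier gradients, with errors \<open>(1/2) ^ k\<close>:
  boundedness of the energy then becomes a Cauchy property in L^2.

  The segments used at step k have half-length \<open>1 / sqrt (Suc k)\<close>, which balances two
  demands. Up to summable errors, step k adds to the energy a fixed multiple of
  \<open>1 / Suc k\<close> times the measure of the set where segments of this size exist. These
  products are therefore summable, and since the harmonic series diverges, the measures are small
  along a subsequence. As the lengths tend to 0, a point whose limit gradient lies outside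
  \<open>E\<close>, where segments of a fixed length persist, would belong to almost all sets of
  that subsequence; Borel-Cantelli confines such points to a null set.

  Each h_theta comes from two expressions: \<open>det\<close> plus
  \<open>2 * \<theta> * cmod w\<close> and \<open>- det\<close> plus
  \<open>2 * \<theta> * cmod z\<close>, both minus the square of \<theta>. This is the source of
  rank-one convexity, and it shows how to move z and w so that h_theta stays fixed for one chosen
  \<theta>.\<close>

definition conf_part :: "real^2^2 \<Rightarrow> complex" where
  "conf_part xi = Complex ((xi$1$1 + xi$2$2) / 2) ((xi$2$1 - xi$1$2) / 2)"

definition anti_part :: "real^2^2 \<Rightarrow> complex" where
  "anti_part xi = Complex ((xi$1$1 - xi$2$2) / 2) ((xi$2$1 + xi$1$2) / 2)"

definition of_parts :: "complex \<Rightarrow> complex \<Rightarrow> real^2^2" where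
  "of_parts z w = vector [vector [Re z + Re w, Im w - Im z], vector [Im z + Im w, Re z - Re w]]"

lemma parts_of_parts [simp]: "conf_part (of_parts z w) = z" "anti_part (of_parts z w) = w"
  by (auto simp: conf_part_def anti_part_def of_parts_def complex_eq_iff)

lemma parts_linear:
  "conf_part (x + y) = conf_part x + conf_part y" "conf_part (c *\<^sub>R x) = c *\<^sub>R conf_part x"
  "anti_part (x + y) = anti_part x + anti_part y" "anti_part (c *\<^sub>R x) = c *\<^sub>R anti_part x"
  "conf_part (x - y) = conf_part x - conf_part y" "anti_part (x - y) = anti_part x - anti_part y"
  by (auto simp: conf_part_def anti_part_def complex_eq_iff field_simps)

lemma continuous_on_parts [continuous_intros]:
  "continuous_on S f \<Longrightarrow> continuous_on S (\<lambda>x. conf_part (f x))"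
  "continuous_on S f \<Longrightarrow> continuous_on S (\<lambda>x. anti_part (f x))"
  unfolding conf_part_def anti_part_def Complex_eq
  by (auto intro!: continuous_intros)

lemma det_parts: "det xi = (cmod (conf_part xi))\<^sup>2 - (cmod (anti_part xi))\<^sup>2"
  unfolding cmod_power2 by (simp add: det_2 conf_part_def anti_part_def power2_eq_square field_simps)

lemma norm_parts: "(norm xi)\<^sup>2 = 2 * ((cmod (conf_part xi))\<^sup>2 + (cmod (anti_part xi))\<^sup>2)" for xi :: "real^2^2"
  unfolding cmod_power2
  by (simp add: norm_vec_def L2_set_def sum_2 conf_part_def anti_part_def power2_eq_square field_simps)

lemma char_poly_mult_transpose:
  fixes xi :: "real^2^2"
  shows "det (t *\<^sub>R mat 1 - xi ** transpose xi) = t\<^sup>2 - (norm xi)\<^sup>2 * t + (det xi)\<^sup>2"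
  by (simp add: det_2 matrix_matrix_mult_def transpose_def mat_def sum_2 norm_vec_def L2_set_def
      power2_eq_square algebra_simps)

text \<open>The roots are the squares of \<open>cmod z - cmod w\<close> and
  \<open>cmod z + cmod w\<close>, because their sum is the squared norm and their product the
  squared determinant. For uniqueness, evaluating the polynomial at 0 and 1 yields
  \<open>a * b\<close> and the sum of the squares, hence \<open>b + a\<close> and
  \<open>b - a\<close>.\<close>

lemma sing_vals_eq:
  "sing_vals xi = (\<bar>cmod (conf_part xi) - cmod (anti_part xi)\<bar>, cmod (conf_part xi) + cmod (anti_part xi))"
proof -
  define p q where "p = cmod (conf_part xi)" and "q = cmod (anti_part xi)"
  have pq: "p \<ge> 0" "q \<ge> 0" by (auto simp: p_def q_def)
  have char: "det (t *\<^sub>R mat 1 - xi ** transpose xi) = (t - (\<bar>p - q\<bar>)\<^sup>2) * (t - (p + q)\<^sup>2)" for t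
    unfolding char_poly_mult_transpose norm_parts det_parts[of xi] p_def[symmetric] q_def[symmetric] power2_abs
    by (simp add: power2_eq_square algebra_simps)
  show ?thesis unfolding sing_vals_def p_def[symmetric] q_def[symmetric]
  proof (rule the_equality, goal_cases)
    case 1
    then show ?case using pq char by auto
  next
    case (2 ab)
    obtain a b where ab: "ab = (a, b)" by force
    have h: "0 \<le> a" "a \<le> b" "\<And>t. (t - a\<^sup>2) * (t - b\<^sup>2) = (t - (\<bar>p - q\<bar>)\<^sup>2) * (t - (p + q)\<^sup>2)"
      using 2 char unfolding ab by auto
    have e0: "(a * b)\<^sup>2 = (\<bar>p - q\<bar> * (p + q))\<^sup>2" using h(3)[of 0] by (simp add: power_mult_distrib)
    have e1: "a * b = \<bar>p - q\<bar> * (p + q)"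
      using h(1,2) pq by (auto intro: power2_eq_imp_eq[OF e0])
    have e2: "a\<^sup>2 + b\<^sup>2 = (\<bar>p - q\<bar>)\<^sup>2 + (p + q)\<^sup>2"
      using h(3)[of 1] e0 unfolding power_mult_distrib by (simp add: algebra_simps del: power2_abs)
    have "(b + a)\<^sup>2 = (a\<^sup>2 + b\<^sup>2) + 2 * (a * b)" unfolding power2_sum by simp
    also have "\<dots> = (p + q + \<bar>p - q\<bar>)\<^sup>2" unfolding e1 e2 power2_sum by (simp only: ac_simps)
    finally have "(b + a)\<^sup>2 = (p + q + \<bar>p - q\<bar>)\<^sup>2" .
    then have s1: "b + a = p + q + \<bar>p - q\<bar>" using h(1,2) pq by (auto dest: power2_eq_imp_eq)
    have "(b - a)\<^sup>2 = (a\<^sup>2 + b\<^sup>2) - 2 * (a * b)" unfolding power2_diff by simp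
    also have "\<dots> = (p + q - \<bar>p - q\<bar>)\<^sup>2" unfolding e1 e2 power2_diff by (simp only: ac_simps)
    finally have "(b - a)\<^sup>2 = (p + q - \<bar>p - q\<bar>)\<^sup>2" .
    then have s2: "b - a = p + q - \<bar>p - q\<bar>" using h(1,2) pq by (auto dest: power2_eq_imp_eq)
    show ?case using s1 s2 unfolding ab by simp
  qed
qed

lemma lambda_eq:
  "lambda1 xi = \<bar>cmod (conf_part xi) - cmod (anti_part xi)\<bar>"
  "lambda2 xi = cmod (conf_part xi) + cmod (anti_part xi)"
  by (simp_all add: lambda1_def lambda2_def sing_vals_eq)

lemma continuous_on_lambda [continuous_intros]:
  "continuous_on S f \<Longrightarrow> continuous_on S (\<lambda>x. lambda1 (f x))"
  "continuous_on S f \<Longrightarrow> continuous_on S (\<lambda>x. lambda2 (f x))"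
  unfolding lambda_eq by (auto intro!: continuous_intros)

lemma lambda_nonneg: "0 \<le> lambda1 xi" "lambda1 xi \<le> lambda2 xi" "0 \<le> lambda2 xi"
  by (auto simp: lambda_eq abs_if)

lemma lambda_scaleR:
  assumes "c \<ge> 0"
  shows "lambda1 (c *\<^sub>R xi) = c * lambda1 xi" "lambda2 (c *\<^sub>R xi) = c * lambda2 xi"
  using assms unfolding lambda_eq parts_linear
  by (auto simp: algebra_simps abs_mult) (metis abs_mult abs_of_nonneg right_diff_distrib)

lemma norm_le_lambda2: "norm xi \<le> 2 * lambda2 xi"
proof -
  have "(norm xi)\<^sup>2 \<le> (2 * lambda2 xi)\<^sup>2"
    unfolding norm_parts lambda_eq by (simp add: power2_eq_square algebra_simps)
  then show ?thesis using lambda_nonneg(3)[of xi] by (auto intro: power2_le_imp_le)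
qed

section \<open>The functions h_theta and their rank-one convexity\<close>

definition hfun :: "real \<Rightarrow> real \<times> real \<Rightarrow> real" where
  "hfun \<theta> p = (snd p - \<theta>) * (fst p + \<theta>)"

lemma continuous_on_hfun [continuous_intros]:
  "continuous_on S f \<Longrightarrow> continuous_on S g \<Longrightarrow> continuous_on S (\<lambda>x. hfun (f x) (g x))"
  unfolding hfun_def by (auto intro!: continuous_intros)

text \<open>Both quadratic branches contain the factor \<open>p + q - \<theta>\<close>. Where it is
  nonnegative, the larger of the two remaining factors is
  \<open>\<bar>p - q\<bar> + \<theta>\<close>; where it is negative, all expressions are at most 0
  and the truncation hides them.\<close>

lemma hfun_max_eq:
  fixes p q :: real
  assumes "p \<ge> 0" "q \<ge> 0"
  shows "max 0 (hfun \<theta> (\<bar>p - q\<bar>, p + q)) = max (max (p\<^sup>2 - (q - \<theta>)\<^sup>2) (q\<^sup>2 - (p - \<theta>)\<^sup>2)) 0"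
proof -
  have e: "p\<^sup>2 - (q - \<theta>)\<^sup>2 = (p + q - \<theta>) * (p - q + \<theta>)" "q\<^sup>2 - (p - \<theta>)\<^sup>2 = (p + q - \<theta>) * (q - p + \<theta>)"
    by (simp_all add: power2_eq_square algebra_simps)
  show ?thesis
  proof (cases "p + q \<ge> \<theta>")
    case True
    have "max ((p + q - \<theta>) * (p - q + \<theta>)) ((p + q - \<theta>) * (q - p + \<theta>)) = (p + q - \<theta>) * max (p - q + \<theta>) (q - p + \<theta>)"
      using True by (simp add: max_mult_distrib_left)
    moreover have "max (p - q + \<theta>) (q - p + \<theta>) = \<bar>p - q\<bar> + \<theta>" by (simp add: max_def)
    ultimately show ?thesis unfolding e hfun_def by (simp add: max.commute)
  next
    case False
    then have "(p + q - \<theta>) * (p - q + \<theta>) \<le> 0" "(p + q - \<theta>) * (q - p + \<theta>) \<le> 0" "(p + q - \<theta>) * (\<bar>p - q\<bar> + \<theta>) \<le> 0"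
      using assms by (auto intro!: mult_nonpos_nonneg)
    then show ?thesis unfolding e hfun_def by (auto simp: max_def)
  qed
qed

lemma rank_1_det_0:
  fixes A :: "real^2^2" assumes "rank A = 1" shows "det A = 0"
proof (rule ccontr)
  assume "det A \<noteq> 0"
  then have "invertible A" by (simp add: invertible_det_nz)
  then have "rank A = 2"
    using full_rank_injective[of A] by (auto simp: inj_matrix_vector_mult)
  then show False using assms by simp
qed

lemma rank_one_convex_max:
  fixes f g :: "real^'n^'m \<Rightarrow> real"
  assumes "rank_one_convex f" "rank_one_convex g"
  shows "rank_one_convex (\<lambda>x. max (f x) (g x))"
  unfolding rank_one_convex_def
proof (intro allI impI)
  fix t :: real and xi eta :: "real^'n^'m"
  assume h: "0 \<le> t \<and> t \<le> 1 \<and> rank (xi - eta) = 1"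
  have "f (t *\<^sub>R xi + (1 - t) *\<^sub>R eta) \<le> t * f xi + (1 - t) * f eta"
       "g (t *\<^sub>R xi + (1 - t) *\<^sub>R eta) \<le> t * g xi + (1 - t) * g eta"
    using assms h unfolding rank_one_convex_def by blast+
  moreover have "t * f xi \<le> t * max (f xi) (g xi)" "t * g xi \<le> t * max (f xi) (g xi)"
    "(1 - t) * f eta \<le> (1 - t) * max (f eta) (g eta)" "(1 - t) * g eta \<le> (1 - t) * max (f eta) (g eta)"
    using h by (auto intro!: mult_left_mono)
  ultimately show "max (f (t *\<^sub>R xi + (1 - t) *\<^sub>R eta)) (g (t *\<^sub>R xi + (1 - t) *\<^sub>R eta))
      \<le> t * max (f xi) (g xi) + (1 - t) * max (f eta) (g eta)" by linarith
qed

lemma rank_one_convex_const: "rank_one_convex (\<lambda>_. c)"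
  unfolding rank_one_convex_def by (auto simp: algebra_simps)

text \<open>\<open>\<bar>z\<bar>\<^sup>2 - (\<bar>w\<bar> - \<theta>)\<^sup>2\<close> is \<open>det\<close>, affine on rank-one segments, plus a convex function of \<open>w\<close>.\<close>

lemma rank_one_convex_hfun_branch:
  assumes "\<theta> \<ge> 0" and d: "\<And>xi. s * det xi = (cmod (z xi))\<^sup>2 - (cmod (w xi))\<^sup>2"
    and lin: "\<And>x y. w (x + y) = w x + w y" "\<And>c x. w (c *\<^sub>R x) = c *\<^sub>R w x"
  shows "rank_one_convex (\<lambda>xi :: real^2^2. (cmod (z xi))\<^sup>2 - (cmod (w xi) - \<theta>)\<^sup>2)"
  unfolding rank_one_convex_def
proof (intro allI impI)
  fix t :: real and xi eta :: "real^2^2"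
  assume h: "0 \<le> t \<and> t \<le> 1 \<and> rank (xi - eta) = 1"
  have eq: "(cmod (z x))\<^sup>2 - (cmod (w x) - \<theta>)\<^sup>2 = s * det x + 2 * \<theta> * cmod (w x) - \<theta>\<^sup>2" for x
    unfolding d by (simp add: power2_eq_square algebra_simps)
  have "det (xi - eta) = 0" using h rank_1_det_0 by blast
  \<comment> \<open>\<open>det\<close> is a quadratic form, so its only deviation from being affine
    along the segment is a multiple of the determinant of the difference, which has rank
    one.\<close>
  moreover have "det (t *\<^sub>R xi + (1 - t) *\<^sub>R eta) = t * det xi + (1 - t) * det eta - t * (1 - t) * det (xi - eta)"
    by (simp add: det_2 algebra_simps)
  ultimately have dt: "det (t *\<^sub>R xi + (1 - t) *\<^sub>R eta) = t * det xi + (1 - t) * det eta" by simp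
  have "cmod (w (t *\<^sub>R xi + (1 - t) *\<^sub>R eta)) \<le> t * cmod (w xi) + (1 - t) * cmod (w eta)"
    unfolding lin by (rule order.trans[OF norm_triangle_ineq]) (use h in simp)
  then have "2 * \<theta> * cmod (w (t *\<^sub>R xi + (1 - t) *\<^sub>R eta)) \<le> 2 * \<theta> * (t * cmod (w xi) + (1 - t) * cmod (w eta))"
    using assms(1) by (intro mult_left_mono) auto
  then show "(cmod (z (t *\<^sub>R xi + (1 - t) *\<^sub>R eta)))\<^sup>2 - (cmod (w (t *\<^sub>R xi + (1 - t) *\<^sub>R eta)) - \<theta>)\<^sup>2
    \<le> t * ((cmod (z xi))\<^sup>2 - (cmod (w xi) - \<theta>)\<^sup>2) + (1 - t) * ((cmod (z eta))\<^sup>2 - (cmod (w eta) - \<theta>)\<^sup>2)"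
    unfolding eq dt by (simp add: algebra_simps)
qed

lemma rank_one_convex_hfun:
  assumes "\<theta> \<ge> 0"
  shows "rank_one_convex (\<lambda>xi :: real^2^2. max 0 (hfun \<theta> (lambda1 xi, lambda2 xi)))"
proof -
  have "rank_one_convex (\<lambda>xi :: real^2^2. (cmod (conf_part xi))\<^sup>2 - (cmod (anti_part xi) - \<theta>)\<^sup>2)"
    by (rule rank_one_convex_hfun_branch[where s = 1, OF assms]) (simp_all add: det_parts parts_linear)
  \<comment> \<open>Exchanging the two parts changes the sign of the determinant, hence
    \<open>s = -1\<close>.\<close>
  moreover have "rank_one_convex (\<lambda>xi :: real^2^2. (cmod (anti_part xi))\<^sup>2 - (cmod (conf_part xi) - \<theta>)\<^sup>2)"
    by (rule rank_one_convex_hfun_branch[where s = "-1", OF assms]) (simp_all add: det_parts parts_linear)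
  ultimately show ?thesis
    unfolding lambda_eq hfun_max_eq[OF norm_ge_zero norm_ge_zero]
    by (intro rank_one_convex_max[OF rank_one_convex_max rank_one_convex_const])
qed

text \<open>The square of \<theta> cancels, so comparing two pairs means comparing two affine
  functions of \<theta> with slopes \<open>snd - fst\<close>.\<close>

lemma hfun_diff:
  "hfun \<theta> k - hfun \<theta> p = fst k * snd k - fst p * snd p + \<theta> * ((snd k - fst k) - (snd p - fst p))"
  by (simp add: hfun_def algebra_simps)

lemma complex_polar: "\<exists>u::complex. cmod u = 1 \<and> v = cmod v * u" for v :: complex
proof (cases "v = 0")
  case False
  then show ?thesis by (intro exI[of _ "v / cmod v"]) (simp add: norm_divide)
qed (auto intro: exI[of _ 1])

text \<open>Expansion about a contact parameter \<open>\<theta>0\<close>; two pairs with equal value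
  at \<open>\<theta>0\<close> are then ordered by their slopes alone.\<close>

lemma hfun_change:
  "hfun \<theta> k = hfun \<theta>0 k + (\<theta> - \<theta>0) * (snd k - fst k) + \<theta>0\<^sup>2 - \<theta>\<^sup>2"
  by (simp add: hfun_def power2_eq_square algebra_simps)

text \<open>For a 2x2 matrix, vanishing determinant together with norm 1 means rank one. Here
  \<open>d\<close> is half the length of the segment centred at \<open>xi\<close>.\<close>

definition rank_one_segment :: "(real^2^2) set \<Rightarrow> real \<Rightarrow> real^2^2 \<Rightarrow> bool" where
  "rank_one_segment V d xi \<longleftrightarrow> (\<exists>\<eta>. det \<eta> = 0 \<and> norm \<eta> = 1 \<and> (\<forall>t. \<bar>t\<bar> \<le> d \<longrightarrow> xi + t *\<^sub>R \<eta> \<in> V))"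

section \<open>The open set \<open>U\<close> and the interior of the hull\<close>

locale isotropic =
  fixes K :: "(real \<times> real) set" and b :: real
  assumes compact_K: "compact K" and K_pos: "\<And>k. k \<in> K \<Longrightarrow> 0 < fst k \<and> fst k \<le> snd k"
    and K_le: "\<And>k. k \<in> K \<Longrightarrow> snd k \<le> b" and K_b: "\<exists>k\<in>K. snd k = b"
begin

text \<open>Membership in \<open>U\<close> depends only on the two moduli and is symmetric in them.
  Stating it for numbers allows the case \<open>cmod z < cmod w\<close> to be reduced to the
  opposite one.\<close>

definition adm :: "real \<Rightarrow> real \<Rightarrow> bool" where
  "adm p q \<longleftrightarrow> (\<forall>\<theta>\<in>{0..b}. \<exists>k\<in>K. hfun \<theta> (\<bar>p - q\<bar>, p + q) < hfun \<theta> k)"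

definition U :: "(real^2^2) set" where
  "U = {xi. adm (cmod (conf_part xi)) (cmod (anti_part xi))}"

definition E :: "(real^2^2) set" where
  "E = {xi. (lambda1 xi, lambda2 xi) \<in> K}"

lemma adm_commute: "adm p q \<longleftrightarrow> adm q p"
  by (simp add: adm_def abs_minus_commute add.commute)

lemma b_pos: "b > 0"
  using K_b K_pos by force

lemma U_eq: "U = {xi. \<forall>\<theta>\<in>{0..b}. \<exists>k\<in>K. hfun \<theta> (lambda1 xi, lambda2 xi) < hfun \<theta> k}"
  by (simp add: U_def adm_def lambda_eq)

lemma hfun_b_le:
  assumes "k \<in> K" shows "hfun b k \<le> 0"
  using K_le[OF assms] K_pos[OF assms] b_pos unfolding hfun_def
  by (auto intro!: mult_nonpos_nonneg)

text \<open>At the parameter \<open>b\<close> all of \<open>K\<close> has nonpositive value, whereas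
  \<open>p + q \<ge> b\<close> would give a nonnegative one.\<close>

lemma adm_sum_less:
  assumes "adm p q" shows "p + q < b"
proof (rule ccontr)
  assume "\<not> p + q < b"
  then have "hfun b (\<bar>p - q\<bar>, p + q) \<ge> 0" using b_pos unfolding hfun_def by auto
  moreover obtain k where k: "k \<in> K" "hfun b (\<bar>p - q\<bar>, p + q) < hfun b k"
    using assms b_pos unfolding adm_def by force
  ultimately show False using hfun_b_le[OF k(1)] by linarith
qed

lemma bounded_U: "bounded U"
proof (rule boundedI)
  fix xi assume "xi \<in> U"
  then have "lambda2 xi < b" unfolding U_def lambda_eq using adm_sum_less by auto
  then show "norm xi \<le> 2 * b" using norm_le_lambda2[of xi] by linarith
qed

text \<open>A parameter that violates the strict inequality ranges over a compact interval, so the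
  complement of \<open>U\<close> is the projection of a closed set along a compact factor.\<close>

lemma open_U: "open U"
proof -
  let ?T = "{(\<theta>, xi). \<theta> \<in> {0..b} \<and> (\<forall>k\<in>K. hfun \<theta> k \<le> hfun \<theta> (lambda1 xi, lambda2 xi))}"
  have eq: "?T = ({0..b} \<times> UNIV) \<inter> (\<Inter>k\<in>K. {x. hfun (fst x) k \<le> hfun (fst x) (lambda1 (snd x), lambda2 (snd x))})"
    by auto
  have "closed ?T"
    unfolding eq
    by (intro closed_Int closed_INT ballI closed_Times closed_Collect_le continuous_intros)
  then have "closed {xi. \<exists>\<theta>. \<theta> \<in> {0..b} \<and> (\<theta>, xi) \<in> ?T}"
    by (intro closed_compact_projection) auto
  moreover have "{xi. \<exists>\<theta>. \<theta> \<in> {0..b} \<and> (\<theta>, xi) \<in> ?T} = - U"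
    unfolding U_eq by (force simp: not_less)
  ultimately show ?thesis by (simp add: closed_def)
qed

lemma hfun_attains_max: "\<exists>k\<in>K. \<forall>k'\<in>K. hfun \<theta> k' \<le> hfun \<theta> k"
proof -
  have "continuous_on K (\<lambda>k. hfun \<theta> k)" by (intro continuous_intros)
  then show ?thesis using continuous_attains_sup[OF compact_K] K_b by blast
qed

lemma closure_U:
  assumes "xi \<in> closure U" "\<theta> \<in> {0..b}"
  shows "\<exists>k\<in>K. hfun \<theta> (lambda1 xi, lambda2 xi) \<le> hfun \<theta> k"
proof -
  obtain k where k: "k \<in> K" "\<And>k'. k' \<in> K \<Longrightarrow> hfun \<theta> k' \<le> hfun \<theta> k"
    using hfun_attains_max by blast
  have "U \<subseteq> {xi. hfun \<theta> (lambda1 xi, lambda2 xi) \<le> hfun \<theta> k}"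
    unfolding U_eq using assms(2) k by force
  moreover have "closed {xi. hfun \<theta> (lambda1 xi, lambda2 xi) \<le> hfun \<theta> k}"
    by (intro closed_Collect_le continuous_intros)
  ultimately show ?thesis using closure_minimal k(1) assms(1) by blast
qed

text \<open>The hull itself yields only non-strict inequalities. An interior point may be stretched
  by a factor \<open>c > 1\<close> without leaving the hull, and stretching strictly increases
  h_theta, which makes the inequality at the original point strict.\<close>

lemma interior_rc_hull: "interior (rc_hull E) \<subseteq> U"
proof
  fix xi assume xi: "xi \<in> interior (rc_hull E)"
  show "xi \<in> U"
  proof (rule ccontr)
    assume "xi \<notin> U"
    then obtain \<theta> where th: "\<theta> \<in> {0..b}" and le: "\<And>k. k \<in> K \<Longrightarrow> hfun \<theta> k \<le> hfun \<theta> (lambda1 xi, lambda2 xi)"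
      unfolding U_eq by force
    let ?x = "lambda1 xi" and ?y = "lambda2 xi"
    have xy: "0 \<le> ?x" "?x \<le> ?y" using lambda_nonneg by auto
    obtain kb where kb: "kb \<in> K" "snd kb = b" using K_b by auto
    then have kbp: "fst kb > 0" using K_pos by auto
    have h0: "0 \<le> hfun \<theta> (?x, ?y)"
      using le[OF kb(1)] kb(2) kbp th by (auto simp: hfun_def intro: order.trans[rotated])
    \<comment> \<open>If the smaller singular value and \<theta> were both 0, the value at
      \<open>xi\<close> would be 0, although \<open>hfun 0\<close> is positive at
      \<open>kb\<close>.\<close>
    have x\<theta>: "?x + \<theta> > 0"
    proof (rule ccontr)
      assume "\<not> ?thesis"
      then have "?x = 0" "\<theta> = 0" using xy th by auto
      then have "hfun 0 kb \<le> 0" using le[OF kb(1)] by (simp add: hfun_def)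
      then show False using kb kbp b_pos by (simp add: hfun_def mult_le_0_iff)
    qed
    have y\<theta>: "?y \<ge> \<theta>" using h0 x\<theta> by (auto simp: hfun_def zero_le_mult_iff)
    have y0: "?y > 0" using x\<theta> y\<theta> xy th by auto
    obtain e where e: "e > 0" "ball xi e \<subseteq> rc_hull E" using xi mem_interior by blast
    \<comment> \<open>The displacement \<open>(c - 1) * norm xi\<close> is then less than
      \<open>e\<close>; the summand 1 keeps the denominator positive.\<close>
    define c where "c = 1 + e / (2 * (norm xi + 1))"
    have c1: "c > 1" using e by (simp add: c_def add_nonneg_pos)
    have "norm (xi - c *\<^sub>R xi) = (c - 1) * norm xi"
    proof -
      have "xi - c *\<^sub>R xi = (1 - c) *\<^sub>R xi" by (simp add: algebra_simps)
      then show ?thesis using c1 by simp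
    qed
    also have "\<dots> = e * (norm xi / (2 * (norm xi + 1)))" by (simp add: c_def)
    also have "\<dots> < e * 1"
    proof (intro mult_strict_left_mono e(1))
      have "0 < norm xi + 1" using norm_ge_zero[of xi] by linarith
      then show "norm xi / (2 * (norm xi + 1)) < 1" by (subst pos_divide_less_eq) auto
    qed
    finally have "c *\<^sub>R xi \<in> rc_hull E" using e(2) by (simp add: dist_norm subset_iff)
    moreover
    obtain k where k: "k \<in> K" "\<And>k'. k' \<in> K \<Longrightarrow> hfun \<theta> k' \<le> hfun \<theta> k"
      using hfun_attains_max by blast
    have hk: "hfun \<theta> k \<ge> 0" using k(2)[OF kb(1)] kb(2) kbp th by (auto simp: hfun_def intro: order.trans[rotated])
    let ?f = "\<lambda>xi::real^2^2. max 0 (hfun \<theta> (lambda1 xi, lambda2 xi)) - hfun \<theta> k"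
    have "rank_one_convex ?f"
      using rank_one_convex_hfun[of \<theta>] th unfolding rank_one_convex_def
      by (simp add: algebra_simps)
    moreover have "\<forall>eta\<in>E. ?f eta \<le> 0"
      using k(2) hk by (auto simp: E_def)
    ultimately have "?f (c *\<^sub>R xi) \<le> 0" unfolding rc_hull_def by blast
    then have "hfun \<theta> (c * ?x, c * ?y) \<le> hfun \<theta> k"
      using c1 by (simp add: lambda_scaleR)
    moreover have "hfun \<theta> (?x, ?y) < hfun \<theta> (c * ?x, c * ?y)"
    proof -
      have "?y < c * ?y" using y0 c1 by simp
      moreover have "?x \<le> c * ?x" using xy c1 by (simp add: mult_le_cancel_right1)
      ultimately show ?thesis unfolding hfun_def fst_conv snd_conv
        using x\<theta> y\<theta> by (intro mult_less_le_imp_less) auto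
    qed
    ultimately show False using le[OF k(1)] by linarith
  qed
qed

text \<open>Points of \<open>K\<close> that are at least as high as \<open>p\<close> at parameters
  tending to \<open>\<theta>0\<close> from one side accumulate, by compactness, at a point
  \<open>l\<close> of \<open>K\<close> whose line passes through the contact point. Its slope cannot
  be on the wrong side of the slope of \<open>p\<close>, the side being recorded by the sign of
  \<sigma>. Equal slopes would mean equal lines, and a line determines its pair, contrary to
  \<open>p \<notin> K\<close>.\<close>

lemma contact_slope:
  assumes "0 \<le> fst p" "fst p \<le> snd p" "p \<notin> K"
    and le: "\<And>\<theta>. \<theta> \<in> {0..b} \<Longrightarrow> \<exists>k\<in>K. hfun \<theta> p \<le> hfun \<theta> k"
    and contact: "\<And>k. k \<in> K \<Longrightarrow> hfun \<theta>0 k \<le> hfun \<theta>0 p"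
    and seq: "\<And>n. \<theta> n \<in> {0..b}" "\<theta> \<longlonglongrightarrow> \<theta>0" "\<And>n::nat. \<sigma> * (\<theta> n - \<theta>0) > 0"
  shows "\<exists>k\<in>K. hfun \<theta>0 k = hfun \<theta>0 p \<and> \<sigma> * ((snd k - fst k) - (snd p - fst p)) > 0"
proof -
  have "\<forall>n. \<exists>k\<in>K. hfun (\<theta> n) p \<le> hfun (\<theta> n) k" using le seq(1) by blast
  then obtain k where k: "\<And>n. k n \<in> K" "\<And>n. hfun (\<theta> n) p \<le> hfun (\<theta> n) (k n)" by metis
  obtain l r where l: "l \<in> K" "strict_mono r" "(k \<circ> r) \<longlonglongrightarrow> l"
    using compact_K k(1) unfolding compact_def by blast
  note tr = LIMSEQ_subseq_LIMSEQ[OF seq(2) l(2)]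
  have lim: "(\<lambda>n. k (r n)) \<longlonglongrightarrow> l" "(\<lambda>n. \<theta> (r n)) \<longlonglongrightarrow> \<theta>0" using l(3) tr by (auto simp: o_def)
  have "(\<lambda>n. hfun (\<theta> (r n)) p) \<longlonglongrightarrow> hfun \<theta>0 p" "(\<lambda>n. hfun (\<theta> (r n)) (k (r n))) \<longlonglongrightarrow> hfun \<theta>0 l"
    unfolding hfun_def by (auto intro!: tendsto_intros lim)
  then have "hfun \<theta>0 p \<le> hfun \<theta>0 l" using k(2) by (intro LIMSEQ_le) auto
  then have eq: "hfun \<theta>0 l = hfun \<theta>0 p" using contact[OF l(1)] by simp
  have "\<sigma> * ((snd (k n) - fst (k n)) - (snd p - fst p)) \<ge> 0" for n
  proof -
    let ?d = "(snd (k n) - fst (k n)) - (snd p - fst p)"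
    have "(\<theta> n - \<theta>0) * ?d \<ge> 0"
      using hfun_diff[of "\<theta> n" "k n" p] hfun_diff[of "\<theta>0" "k n" p] k(2)[of n] contact[OF k(1)[of n]]
      by (simp add: left_diff_distrib)
    with seq(3)[of n] show ?thesis
      by (auto simp: zero_le_mult_iff zero_less_mult_iff)
  qed
  then have ge: "\<sigma> * ((snd l - fst l) - (snd p - fst p)) \<ge> 0"
    by (intro LIMSEQ_le_const[of "\<lambda>n. \<sigma> * ((snd (k (r n)) - fst (k (r n))) - (snd p - fst p))"])
       (auto intro!: tendsto_intros lim)
  have "\<sigma> * ((snd l - fst l) - (snd p - fst p)) \<noteq> 0"
  proof
    assume "\<sigma> * ((snd l - fst l) - (snd p - fst p)) = 0"
    moreover have "\<sigma> \<noteq> 0" using seq(3)[of 0] by auto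
    ultimately have s: "snd l - fst l = snd p - fst p" by simp
    then have "fst l * snd l = fst p * snd p" using hfun_diff[of \<theta>0 l p] eq by simp
    moreover have sl: "snd l = fst l + (snd p - fst p)" using s by simp
    \<comment> \<open>With equal differences the equality of the products factors like this; the
      second factor is positive because the first coordinates of \<open>K\<close> are.\<close>
    ultimately have "(fst l - fst p) * (fst l + snd p) = 0"
      unfolding sl by (simp add: algebra_simps)
    moreover have "fst l + snd p > 0" using K_pos[OF l(1)] assms(1,2) by linarith
    ultimately have "fst l = fst p" by simp
    then have "l = p" using s by (simp add: prod_eq_iff)
    then show False using l(1) assms(3) by simp
  qed
  then have "\<sigma> * ((snd l - fst l) - (snd p - fst p)) > 0" using ge by linarith
  then show ?thesis using l(1) eq by blast
qed

text \<open>Along \<open>t \<mapsto> (z + t \<zeta>, w + t \<omega>)\<close> the function \<open>\<bar>z\<bar>\<^sup>2 - (\<bar>w\<bar> - \<theta>)\<^sup>2\<close> is constant.\<close>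

lemma pivot_direction:
  fixes z w :: complex
  assumes "cmod w \<le> cmod z" "0 \<le> \<theta>" "\<theta> \<le> cmod z + cmod w"
  shows "\<exists>(\<zeta>::complex) (\<omega>::complex). cmod \<zeta> = 1 \<and> cmod \<omega> = 1 \<and> (\<forall>t::real. cmod (w + t * \<omega>) = \<bar>cmod w + t\<bar>) \<and>
      (\<forall>t::real. (cmod (z + t * \<zeta>))\<^sup>2 = (cmod z)\<^sup>2 + 2 * t * (cmod w - \<theta>) + t\<^sup>2)"
proof -
  obtain \<omega> :: complex where \<omega>: "cmod \<omega> = 1" "w = cmod w * \<omega>" using complex_polar by blast
  obtain u :: complex where u: "cmod u = 1" "z = cmod z * u" using complex_polar by blast
  have w: "cmod (w + t * \<omega>) = \<bar>cmod w + t\<bar>" for t :: real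
  proof -
    have "w + t * \<omega> = of_real (cmod w + t) * \<omega>" by (subst \<omega>(2)) (simp add: algebra_simps)
    then show ?thesis using \<omega>(1) by (simp add: norm_mult del: of_real_add)
  qed
  \<comment> \<open>The cosine of the angle between \<zeta> and \<open>z\<close>, chosen so that the
    linear term of the squared modulus is \<open>2 * t * (cmod w - \<theta>)\<close>. The bounds on
    \<theta> give \<open>\<bar>c\<bar> \<le> 1\<close>; if \<open>z = 0\<close>, they force
    \<open>w = 0\<close> and \<open>\<theta> = 0\<close>, and the value 0 is consistent.\<close>
  define c where "c = (if z = 0 then 0 else (cmod w - \<theta>) / cmod z)"
  have zc: "cmod z * c = cmod w - \<theta>" using assms by (auto simp: c_def)
  have "\<bar>c\<bar> \<le> 1" using assms by (auto simp: c_def abs_le_iff pos_divide_le_eq pos_le_divide_eq minus_divide_left)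
  then have c2: "c\<^sup>2 \<le> 1" by (simp add: abs_square_le_1)
  define \<zeta> where "\<zeta> = u * Complex c (sqrt (1 - c\<^sup>2))"
  have "cmod (Complex c (sqrt (1 - c\<^sup>2))) = 1" using c2 by (simp add: cmod_def)
  then have \<zeta>: "cmod \<zeta> = 1" using u(1) by (simp add: \<zeta>_def norm_mult)
  have "(cmod (z + t * \<zeta>))\<^sup>2 = (cmod z)\<^sup>2 + 2 * t * (cmod w - \<theta>) + t\<^sup>2" for t :: real
  proof -
    have "z + t * \<zeta> = u * (cmod z + t * Complex c (sqrt (1 - c\<^sup>2)))"
      by (subst u(2)) (simp add: \<zeta>_def algebra_simps)
    then have "cmod (z + t * \<zeta>) = cmod (cmod z + t * Complex c (sqrt (1 - c\<^sup>2)))"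
      using u(1) by (simp add: norm_mult)
    then have "(cmod (z + t * \<zeta>))\<^sup>2 = (cmod z + t * c)\<^sup>2 + t\<^sup>2 * (sqrt (1 - c\<^sup>2))\<^sup>2"
      by (simp add: cmod_power2 power_mult_distrib)
    also have "\<dots> = (cmod z)\<^sup>2 + 2 * t * (cmod z * c) + t\<^sup>2"
      using c2 by (simp add: power2_eq_square algebra_simps)
    finally show ?thesis unfolding zc .
  qed
  with w \<zeta> \<omega>(1) show ?thesis by blast
qed

text \<open>The motion for contact at the parameter \<open>b\<close>: the larger singular value,
  which is the sum of the moduli, stays fixed, and only their difference changes.\<close>

lemma opposite_direction:
  fixes z w :: complex
  assumes "d \<le> cmod z" "d \<le> cmod w"
  shows "\<exists>(\<zeta>::complex) (\<omega>::complex). cmod \<zeta> = 1 \<and> cmod \<omega> = 1 \<and>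
    (\<forall>t::real. \<bar>t\<bar> \<le> d \<longrightarrow> cmod (z + t * \<zeta>) = cmod z - t \<and> cmod (w + t * \<omega>) = cmod w + t)"
proof -
  obtain \<omega> :: complex where \<omega>: "cmod \<omega> = 1" "w = cmod w * \<omega>" using complex_polar by blast
  obtain u :: complex where u: "cmod u = 1" "z = cmod z * u" using complex_polar by blast
  have "cmod (z + t * (- u)) = cmod z - t \<and> cmod (w + t * \<omega>) = cmod w + t" if "\<bar>t\<bar> \<le> d" for t :: real
  proof -
    have "w + t * \<omega> = of_real (cmod w + t) * \<omega>" by (subst \<omega>(2)) (simp add: algebra_simps)
    then have "cmod (w + t * \<omega>) = \<bar>cmod w + t\<bar>" using \<omega>(1) by (simp add: norm_mult del: of_real_add)
    moreover have "z + t * (- u) = of_real (cmod z - t) * u" by (subst u(2)) (simp add: algebra_simps)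
    then have "cmod (z + t * (- u)) = \<bar>cmod z - t\<bar>" using u(1) by (simp add: norm_mult del: of_real_diff)
    ultimately show ?thesis using that assms by auto
  qed
  then show ?thesis using \<omega>(1) u(1) by (intro exI[of _ "- u"] exI[of _ \<omega>]) auto
qed

section \<open>Rank-one segments near points of contact\<close>

definition splits :: "real \<Rightarrow> complex \<Rightarrow> complex \<Rightarrow> bool" where
  "splits d z w \<longleftrightarrow> (\<exists>(\<zeta>::complex) (\<omega>::complex). cmod \<zeta> = 1 \<and> cmod \<omega> = 1 \<and>
     (\<forall>t::real. \<bar>t\<bar> \<le> d \<longrightarrow> adm (cmod (z + t * \<zeta>)) (cmod (w + t * \<omega>))))"

lemma splits_commute: "splits d z w \<longleftrightarrow> splits d w z"
  unfolding splits_def by (subst adm_commute) blast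

lemma hfun_norms:
  "hfun \<theta> (\<bar>p - q\<bar>, p + q) = p\<^sup>2 - q\<^sup>2 + 2 * \<theta> * q - \<theta>\<^sup>2" if "q \<le> p"
  using that by (simp add: hfun_def power2_eq_square algebra_simps)

text \<open>Moving the moduli in opposite senses keeps their sum below \<open>b = snd k\<close> and,
  for small \<open>d\<close>, their difference below \<open>fst k\<close>. The single point
  \<open>k\<close> therefore dominates for every \<theta>.\<close>

lemma splits_near_max:
  assumes le: "q0 \<le> p0" "0 < q0" "p0 + q0 = b" and k: "k \<in> K" "snd k = b" "p0 - q0 < fst k"
  shows "\<exists>d>0. \<forall>z w. \<bar>cmod z - p0\<bar> < d \<and> \<bar>cmod w - q0\<bar> < d \<and> adm (cmod z) (cmod w) \<longrightarrow> splits d z w"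
proof -
  \<comment> \<open>The difference of the moduli varies by less than \<open>4 * d\<close>: at most
    \<open>d\<close> from each modulus and \<open>2 * d\<close> from \<open>t\<close>. The bound
    \<open>q0 / 2\<close> keeps both moduli at least \<open>d\<close>.\<close>
  define d where "d = min (q0 / 2) ((fst k - (p0 - q0)) / 8)"
  have d: "d > 0" "2 * d \<le> q0" "8 * d \<le> fst k - (p0 - q0)" using le k by (auto simp: d_def min_def)
  show ?thesis
  proof (intro exI[of _ d] conjI d(1) allI impI)
    fix z w assume h: "\<bar>cmod z - p0\<bar> < d \<and> \<bar>cmod w - q0\<bar> < d \<and> adm (cmod z) (cmod w)"
    have zw: "d \<le> cmod z" "d \<le> cmod w" using h d le by auto
    obtain \<zeta> \<omega> :: complex where dir: "cmod \<zeta> = 1" "cmod \<omega> = 1"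
      "\<And>t::real. \<bar>t\<bar> \<le> d \<Longrightarrow> cmod (z + t * \<zeta>) = cmod z - t \<and> cmod (w + t * \<omega>) = cmod w + t"
      using opposite_direction[OF zw] by blast
    have "adm (cmod (z + t * \<zeta>)) (cmod (w + t * \<omega>))" if t: "\<bar>t\<bar> \<le> d" for t :: real
      unfolding adm_def
    proof (intro ballI bexI[OF _ k(1)])
      fix \<theta> assume \<theta>: "\<theta> \<in> {0..b}"
      let ?x = "\<bar>(cmod z - t) - (cmod w + t)\<bar>" and ?y = "cmod z + cmod w"
      have y: "?y < b" using adm_sum_less h by blast
      have x: "?x < fst k" using h d t le by auto
      have "(?y - \<theta>) * (?x + \<theta>) < (b - \<theta>) * (fst k + \<theta>)"
      proof (cases "?y \<ge> \<theta>")
        case True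
        have "(?y - \<theta>) * (?x + \<theta>) \<le> (?y - \<theta>) * (fst k + \<theta>)"
          using True x by (intro mult_left_mono) auto
        also have "\<dots> < (b - \<theta>) * (fst k + \<theta>)"
          using y x \<theta> by (intro mult_strict_right_mono) auto
        finally show ?thesis .
      next
        case False
        show ?thesis
        proof (cases "\<theta> = b")
          case True
          then show ?thesis using False b_pos by (auto intro!: mult_neg_pos)
        next
          case 2: False
          have "(?y - \<theta>) * (?x + \<theta>) \<le> 0" using False \<theta> by (intro mult_nonpos_nonneg) auto
          moreover have "(b - \<theta>) * (fst k + \<theta>) > 0" using 2 x \<theta> by (intro mult_pos_pos) auto
          ultimately show ?thesis by linarith
        qed
      qed
      then show "hfun \<theta> (\<bar>cmod (z + t * \<zeta>) - cmod (w + t * \<omega>)\<bar>, cmod (z + t * \<zeta>) + cmod (w + t * \<omega>)) < hfun \<theta> k"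
        using dir(3)[OF t] k(2) by (simp add: hfun_def)
    qed
    then show "splits d z w" unfolding splits_def using dir by blast
  qed
qed

text \<open>Along the pivot direction the value at \<open>\<theta>0\<close> remains what it was,
  below \<open>h0\<close>, and only the slope \<open>2 * Q\<close> varies. Since the slope stays
  between those of \<open>km\<close> and \<open>kp\<close>, the point \<open>kp\<close> wins for
  parameters from \<open>\<theta>0\<close> on and \<open>km\<close> for smaller ones.\<close>

lemma splits_near_pivot:
  assumes le: "q0 < p0" "0 \<le> q0" "0 \<le> \<theta>0" "\<theta>0 \<le> b" "\<theta>0 < p0 + q0"
    and contact: "\<And>k. k \<in> K \<Longrightarrow> hfun \<theta>0 k \<le> h0"
    and kp: "kp \<in> K" "hfun \<theta>0 kp = h0" "2 * q0 < snd kp - fst kp"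
    and km: "\<theta>0 > 0 \<Longrightarrow> km \<in> K \<and> hfun \<theta>0 km = h0 \<and> snd km - fst km < 2 * q0"
  shows "\<exists>d>0. \<forall>z w. \<bar>cmod z - p0\<bar> < d \<and> \<bar>cmod w - q0\<bar> < d \<and> adm (cmod z) (cmod w) \<longrightarrow> splits d z w"
proof -
  \<comment> \<open>For \<open>\<theta>0 = 0\<close> there are no smaller parameters, so
    \<open>km\<close> is absent and any positive default serves.\<close>
  define g where "g = (if \<theta>0 > 0 then 2 * q0 - (snd km - fst km) else 1)"
  have g: "g > 0" using km by (auto simp: g_def)
  define d where "d = min (min (p0 - q0) (snd kp - fst kp - 2 * q0)) (min g (p0 + q0 - \<theta>0)) / 8"
  have d: "d > 0" "8 * d \<le> p0 - q0" "8 * d \<le> snd kp - fst kp - 2 * q0" "8 * d \<le> g" "8 * d \<le> p0 + q0 - \<theta>0"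
    using le kp g by (auto simp: d_def min_def)
  show ?thesis
  proof (intro exI[of _ d] conjI d(1) allI impI)
    fix z w assume h: "\<bar>cmod z - p0\<bar> < d \<and> \<bar>cmod w - q0\<bar> < d \<and> adm (cmod z) (cmod w)"
    define p q where "p = cmod z" and "q = cmod w"
    have pq: "\<bar>p - p0\<bar> < d" "\<bar>q - q0\<bar> < d" "adm p q" "0 \<le> q" using h by (auto simp: p_def q_def)
    have "cmod w \<le> cmod z" "\<theta>0 \<le> cmod z + cmod w" using h d by auto
    then obtain \<zeta> \<omega> :: complex where dir: "cmod \<zeta> = 1" "cmod \<omega> = 1" "\<And>t::real. cmod (w + t * \<omega>) = \<bar>q + t\<bar>"
      "\<And>t::real. (cmod (z + t * \<zeta>))\<^sup>2 = p\<^sup>2 + 2 * t * (q - \<theta>0) + t\<^sup>2"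
      using pivot_direction[of w z \<theta>0] le unfolding p_def q_def by blast
    obtain k' where k': "k' \<in> K" "hfun \<theta>0 (\<bar>p - q\<bar>, p + q) < hfun \<theta>0 k'"
      using pq(3) le unfolding adm_def by (metis atLeastAtMost_iff)
    then have below: "p\<^sup>2 - q\<^sup>2 + 2 * \<theta>0 * q - \<theta>0\<^sup>2 < h0"
      using contact[OF k'(1)] hfun_norms[of q p \<theta>0] pq d by auto
    have "adm (cmod (z + t * \<zeta>)) (cmod (w + t * \<omega>))" if t: "\<bar>t\<bar> \<le> d" for t :: real
      unfolding adm_def
    proof
      fix \<theta> assume \<theta>: "\<theta> \<in> {0..b}"
      define P Q where "P = cmod (z + t * \<zeta>)" and "Q = cmod (w + t * \<omega>)"
      have Q: "Q = \<bar>q + t\<bar>" using dir(3) by (simp add: Q_def)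
      have "cmod z - cmod (t * \<zeta>) \<le> cmod (z + t * \<zeta>)" by (rule norm_diff_ineq)
      then have "P \<ge> p - d" using t dir(1) unfolding P_def p_def by (simp add: norm_mult)
      then have QP: "Q \<le> P" using Q pq d t by auto
      \<comment> \<open>The modulus is \<open>\<bar>q + t\<bar>\<close>, and \<open>q\<close> may be
        0. For \<open>\<theta>0 > 0\<close> the nonnegative slope of \<open>km\<close> lies below
        \<open>2 * q0\<close>, which keeps \<open>q + t\<close> nonnegative; for
        \<open>\<theta>0 = 0\<close> both sides vanish.\<close>
      have Qt: "\<theta>0 * Q = \<theta>0 * (q + t)"
      proof (cases "\<theta>0 > 0")
        case True
        have "fst km \<le> snd km" using K_pos km[OF True] by blast
        then have "q + t \<ge> 0" using d(4) True pq t unfolding g_def by auto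
        then show ?thesis using Q by simp
      qed (use le in auto)
      have "P\<^sup>2 = p\<^sup>2 + 2 * t * (q - \<theta>0) + t\<^sup>2" using dir(4) by (simp add: P_def)
      moreover have "Q\<^sup>2 = (q + t)\<^sup>2" using Q by simp
      ultimately have "P\<^sup>2 - Q\<^sup>2 = p\<^sup>2 - q\<^sup>2 - 2 * t * \<theta>0"
        by (simp add: power2_eq_square algebra_simps)
      then have "hfun \<theta> (\<bar>P - Q\<bar>, P + Q) = p\<^sup>2 - q\<^sup>2 - 2 * t * \<theta>0 + 2 * \<theta> * Q - \<theta>\<^sup>2"
        using hfun_norms[OF QP] by simp
      also have "\<dots> = (p\<^sup>2 - q\<^sup>2 + 2 * \<theta>0 * q - \<theta>0\<^sup>2) + (\<theta> - \<theta>0) * (2 * Q) + \<theta>0\<^sup>2 - \<theta>\<^sup>2"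
        using Qt by (simp add: algebra_simps)
      finally have hfun_t: "hfun \<theta> (\<bar>P - Q\<bar>, P + Q) < h0 + (\<theta> - \<theta>0) * (2 * Q) + \<theta>0\<^sup>2 - \<theta>\<^sup>2"
        using below by simp
      show "\<exists>k\<in>K. hfun \<theta> (\<bar>P - Q\<bar>, P + Q) < hfun \<theta> k"
      proof (cases "\<theta> \<ge> \<theta>0")
        case True
        have "2 * Q \<le> snd kp - fst kp" using Q pq(1,2) d(1,3) t le(2) by linarith
        then have "(\<theta> - \<theta>0) * (2 * Q) \<le> (\<theta> - \<theta>0) * (snd kp - fst kp)"
          using True by (intro mult_left_mono) auto
        then show ?thesis using hfun_t kp(1,2) hfun_change[of \<theta> kp \<theta>0] by (intro bexI[of _ kp]) auto
      next
        case False
        then have pos: "\<theta>0 > 0" using \<theta> by auto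
        have "8 * d \<le> 2 * q0 - (snd km - fst km)" using d(4) pos by (simp add: g_def)
        then have "snd km - fst km \<le> 2 * Q" using Q pq(1,2) d(1) t by linarith
        then have "(\<theta> - \<theta>0) * (2 * Q) \<le> (\<theta> - \<theta>0) * (snd km - fst km)"
          using False by (intro mult_left_mono_neg) auto
        then show ?thesis using hfun_t km[OF pos] hfun_change[of \<theta> km \<theta>0] by (intro bexI[of _ km]) auto
      qed
    qed
    then show "splits d z w" unfolding splits_def using dir by blast
  qed
qed

lemma splits_imp_segment:
  assumes "splits d (conf_part xi) (anti_part xi)"
  shows "rank_one_segment U d xi"
proof -
  obtain \<zeta> \<omega> :: complex where dir: "cmod \<zeta> = 1" "cmod \<omega> = 1"
    "\<And>t::real. \<bar>t\<bar> \<le> d \<Longrightarrow> adm (cmod (conf_part xi + t * \<zeta>)) (cmod (anti_part xi + t * \<omega>))"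
    using assms unfolding splits_def by blast
  \<comment> \<open>Two parts of modulus 1 give determinant 0 and norm 2, hence the factor 1/2. The
    parameter then only runs up to \<open>d / 2\<close> in \<open>splits\<close>.\<close>
  let ?\<eta> = "(1/2) *\<^sub>R of_parts \<zeta> \<omega>"
  have "(norm ?\<eta>)\<^sup>2 = 1" unfolding norm_parts parts_linear by (simp add: dir(1,2) norm_mult power_divide)
  then have "norm ?\<eta> = 1" by (simp add: power2_eq_1_iff) (use norm_ge_zero[of "of_parts \<zeta> \<omega>"] in linarith)
  moreover have "det ?\<eta> = 0" unfolding det_parts parts_linear by (simp add: dir(1,2))
  moreover have "xi + t *\<^sub>R ?\<eta> \<in> U" if "\<bar>t\<bar> \<le> d" for t
    using dir(3)[of "t / 2"] that unfolding U_def mem_Collect_eq parts_linear parts_of_parts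
    by (simp add: scaleR_conv_of_real)
  ultimately show ?thesis unfolding rank_one_segment_def by blast
qed

lemma splits_near_contact:
  assumes "0 \<le> q0" "q0 \<le> p0" and nK: "(p0 - q0, p0 + q0) \<notin> K"
    and le: "\<And>\<theta>. \<theta> \<in> {0..b} \<Longrightarrow> \<exists>k\<in>K. hfun \<theta> (p0 - q0, p0 + q0) \<le> hfun \<theta> k"
    and \<theta>0: "\<theta>0 \<in> {0..b}"
    and contact: "\<And>k. k \<in> K \<Longrightarrow> hfun \<theta>0 k \<le> hfun \<theta>0 (p0 - q0, p0 + q0)"
  shows "\<exists>d>0. \<forall>z w. \<bar>cmod z - p0\<bar> < d \<and> \<bar>cmod w - q0\<bar> < d \<and> adm (cmod z) (cmod w) \<longrightarrow> splits d z w"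
proof -
  let ?p = "(p0 - q0, p0 + q0)"
  \<comment> \<open>The sign of \<open>c\<close> selects the side from which
    \<open>\<theta>0\<close> is approached inside \<open>{0..b}\<close>, along
    \<open>\<theta>0 + c / Suc n\<close>.\<close>
  have slope: "\<exists>k\<in>K. hfun \<theta>0 k = hfun \<theta>0 ?p \<and> \<sigma> * ((snd k - fst k) - 2 * q0) > 0"
    if c: "c \<noteq> 0" "\<sigma> * c > 0" "\<theta>0 + c \<in> {0..b}" for \<sigma> c
  proof -
    have seq: "\<theta>0 + c * (1 / Suc n) \<in> {0..b}" "\<sigma> * (\<theta>0 + c * (1 / Suc n) - \<theta>0) > 0" for n
    proof -
      let ?t = "1 / real (Suc n)"
      have "(1 - ?t) *\<^sub>R \<theta>0 + ?t *\<^sub>R (\<theta>0 + c) \<in> {0..b}"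
        using \<theta>0 c by (intro convexD[OF convex_real_interval(5)]) auto
      moreover have "(1 - ?t) *\<^sub>R \<theta>0 + ?t *\<^sub>R (\<theta>0 + c) = \<theta>0 + c * ?t"
        by (simp add: left_diff_distrib distrib_left)
      ultimately show "\<theta>0 + c * ?t \<in> {0..b}" by simp
      have "\<sigma> * c * ?t > 0" using mult_pos_pos[OF c(2), of ?t] by simp
      then show "\<sigma> * (\<theta>0 + c * ?t - \<theta>0) > 0" by simp
    qed
    have "(\<lambda>n. \<theta>0 + c * (1 / Suc n)) \<longlonglongrightarrow> \<theta>0 + c * 0"
      by (intro tendsto_intros LIMSEQ_Suc[OF lim_1_over_n])
    then have "(\<lambda>n. \<theta>0 + c * (1 / Suc n)) \<longlonglongrightarrow> \<theta>0" by simp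
    from contact_slope[of ?p \<theta>0 "\<lambda>n. \<theta>0 + c * (1 / Suc n)" \<sigma>, OF _ _ nK le contact seq(1) this seq(2)]
    show ?thesis using assms(1,2) by (simp add: algebra_simps)
  qed
  obtain kb where kb: "kb \<in> K" "snd kb = b" using K_b by auto
  have kbp: "0 < fst kb" "fst kb \<le> b" using K_pos[OF kb(1)] kb(2) by auto
  show ?thesis
  proof (cases "\<theta>0 = b")
    case True
    \<comment> \<open>All values at \<open>b\<close> on \<open>K\<close> are nonpositive and
      \<open>kb\<close> attains 0, so contact there means \<open>p0 + q0 = b\<close>. Only the left
      side of \<open>b\<close> is available; it supplies a point of \<open>K\<close> with the same
      second and a larger first coordinate.\<close>
    have "hfun b ?p \<ge> 0" using contact[OF kb(1)] True kb by (simp add: hfun_def)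
    moreover have "hfun b ?p \<le> 0" using le[of b] hfun_b_le b_pos by force
    ultimately have "hfun b ?p = 0" by simp
    then have yb: "p0 + q0 = b" using b_pos assms(1,2) by (simp add: hfun_def)
    obtain k where k: "k \<in> K" "hfun \<theta>0 k = hfun \<theta>0 ?p" "(-1) * ((snd k - fst k) - 2 * q0) > 0"
      using slope[of "-b" "-1"] True b_pos by auto
    then have "(snd k - b) * (fst k + b) = 0" using True \<open>hfun b ?p = 0\<close> by (simp add: hfun_def)
    then have kb: "snd k = b" using K_pos[OF k(1)] b_pos by auto
    show ?thesis
      using splits_near_max[OF assms(2) _ yb k(1) kb] k(3) kb yb K_pos[OF k(1)] by auto
  next
    case False
    then have \<theta>0b: "\<theta>0 < b" using \<theta>0 by auto
    obtain kp where kp: "kp \<in> K" "hfun \<theta>0 kp = hfun \<theta>0 ?p" "1 * ((snd kp - fst kp) - 2 * q0) > 0"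
      using slope[of "b - \<theta>0" 1] \<theta>0b \<theta>0 by auto
    have km: "\<theta>0 > 0 \<Longrightarrow> \<exists>km. km \<in> K \<and> hfun \<theta>0 km = hfun \<theta>0 ?p \<and> snd km - fst km < 2 * q0"
      using slope[of "-\<theta>0" "-1"] \<theta>0 by force
    then obtain km where km: "\<theta>0 > 0 \<Longrightarrow> km \<in> K \<and> hfun \<theta>0 km = hfun \<theta>0 ?p \<and> snd km - fst km < 2 * q0"
      by blast
    have "hfun \<theta>0 ?p > 0"
    proof -
      have "hfun \<theta>0 kb > 0" using \<theta>0b \<theta>0 kb kbp by (simp add: hfun_def)
      then show ?thesis using contact[OF kb(1)] by linarith
    qed
    then have y: "\<theta>0 < p0 + q0" using assms(1,2) \<theta>0 by (auto simp: hfun_def zero_less_mult_iff)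
    \<comment> \<open>Otherwise the product of the singular values is 0, and \<open>kp\<close>, with
      positive product and larger slope, would lie strictly above the contact value.\<close>
    have "p0 \<noteq> q0"
    proof
      assume eq: "p0 = q0"
      have "hfun \<theta>0 kp - hfun \<theta>0 ?p = fst kp * snd kp + \<theta>0 * ((snd kp - fst kp) - 2 * q0)"
        unfolding hfun_diff using eq by (simp add: algebra_simps)
      moreover have "fst kp * snd kp > 0" using K_pos[OF kp(1)] by auto
      moreover have "\<theta>0 * ((snd kp - fst kp) - 2 * q0) \<ge> 0" using kp(3) \<theta>0 by auto
      ultimately show False using kp(2) by linarith
    qed
    then show ?thesis
      using splits_near_pivot[OF _ assms(1) _ _ y contact kp(1,2) _ km] assms(2) \<theta>0 kp(3) by auto
  qed
qed

text \<open>One \<open>d\<close> must serve all \<open>eta\<close> near \<open>xi\<close>, because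
  the iterates lie in \<open>U\<close> and merely approach \<open>xi\<close>. Inside
  \<open>U\<close> any fixed rank-one direction works by openness; on the boundary a violated
  inequality provides the contact parameter, and exchanging the two parts gives
  \<open>cmod (anti_part xi) \<le> cmod (conf_part xi)\<close>.\<close>

lemma nonstable:
  assumes "xi \<in> closure U" "xi \<notin> E"
  shows "\<exists>d>0. \<forall>eta\<in>U. norm (eta - xi) < d \<longrightarrow> rank_one_segment U d eta"
proof (cases "xi \<in> U")
  case True
  then obtain e where e: "e > 0" "ball xi e \<subseteq> U" using open_U openE by blast
  let ?\<eta> = "(1/2) *\<^sub>R of_parts 1 1"
  have "(norm ?\<eta>)\<^sup>2 = 1" unfolding norm_parts parts_linear by (simp add: power_divide)
  then have \<eta>: "norm ?\<eta> = 1" by (simp add: power2_eq_1_iff) (use norm_ge_zero[of "of_parts 1 1"] in linarith)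
  have d: "det ?\<eta> = 0" unfolding det_parts parts_linear by simp
  have "rank_one_segment U (e / 3) eta" if "norm (eta - xi) < e / 3" for eta
  proof -
    have "eta + t *\<^sub>R ?\<eta> \<in> U" if "\<bar>t\<bar> \<le> e / 3" for t
    proof -
      have "norm ((eta - xi) + t *\<^sub>R ?\<eta>) < e"
        using norm_triangle_ineq[of "eta - xi" "t *\<^sub>R ?\<eta>"] \<open>norm (eta - xi) < e / 3\<close> that \<eta> e(1)
        unfolding norm_scaleR[of t] by simp
      then have "eta + t *\<^sub>R ?\<eta> \<in> ball xi e"
        by (simp add: dist_norm norm_minus_commute[of xi] algebra_simps)
      then show ?thesis using e(2) by blast
    qed
    then show ?thesis using \<eta> d unfolding rank_one_segment_def by blast
  qed
  then show ?thesis using e(1) by (intro exI[of _ "e / 3"]) auto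
next
  case False
  let ?p = "cmod (conf_part xi)" and ?q = "cmod (anti_part xi)"
  obtain \<theta>0 where \<theta>0: "\<theta>0 \<in> {0..b}" "\<And>k. k \<in> K \<Longrightarrow> hfun \<theta>0 k \<le> hfun \<theta>0 (\<bar>?p - ?q\<bar>, ?p + ?q)"
    using False unfolding U_def adm_def by force
  have le: "\<exists>k\<in>K. hfun \<theta> (\<bar>?p - ?q\<bar>, ?p + ?q) \<le> hfun \<theta> k" if "\<theta> \<in> {0..b}" for \<theta>
    using closure_U[OF assms(1) that] by (simp add: lambda_eq)
  have nK: "(\<bar>?p - ?q\<bar>, ?p + ?q) \<notin> K" using assms(2) by (simp add: E_def lambda_eq)
  have "\<exists>d>0. \<forall>z w. \<bar>cmod z - ?p\<bar> < d \<and> \<bar>cmod w - ?q\<bar> < d \<and> adm (cmod z) (cmod w) \<longrightarrow> splits d z w"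
  proof (cases "?q \<le> ?p")
    case True
    then have "\<bar>?p - ?q\<bar> = ?p - ?q" by simp
    then show ?thesis using splits_near_contact[OF _ True, of \<theta>0] \<theta>0 le nK by simp
  next
    case False
    then have "\<bar>?p - ?q\<bar> = ?q - ?p" "?p + ?q = ?q + ?p" by simp_all
    then have "\<exists>d>0. \<forall>z w. \<bar>cmod z - ?q\<bar> < d \<and> \<bar>cmod w - ?p\<bar> < d \<and> adm (cmod z) (cmod w) \<longrightarrow> splits d z w"
      using splits_near_contact[of ?p ?q \<theta>0] \<theta>0 le nK False by (simp add: add.commute)
    then show ?thesis using adm_commute splits_commute by blast
  qed
  then obtain d where d: "d > 0"
    "\<And>z w. \<bar>cmod z - ?p\<bar> < d \<Longrightarrow> \<bar>cmod w - ?q\<bar> < d \<Longrightarrow> adm (cmod z) (cmod w) \<Longrightarrow> splits d z w"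
    by blast
  have "rank_one_segment U d eta" if eta: "eta \<in> U" "norm (eta - xi) < d" for eta
  proof (intro splits_imp_segment d(2))
    have sq: "(cmod (conf_part (eta - xi)))\<^sup>2 \<le> (norm (eta - xi))\<^sup>2" "(cmod (anti_part (eta - xi)))\<^sup>2 \<le> (norm (eta - xi))\<^sup>2"
      unfolding norm_parts by (simp_all add: distrib_left)
    then have "cmod (conf_part (eta - xi)) \<le> norm (eta - xi)" "cmod (anti_part (eta - xi)) \<le> norm (eta - xi)"
      by (auto intro: power2_le_imp_le)
    then show "\<bar>cmod (conf_part eta) - ?p\<bar> < d" "\<bar>cmod (anti_part eta) - ?q\<bar> < d"
      using norm_triangle_ineq3[of "conf_part eta" "conf_part xi"] norm_triangle_ineq3[of "anti_part eta" "anti_part xi"] eta(2)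
      unfolding parts_linear by linarith+
    show "adm (cmod (conf_part eta)) (cmod (anti_part eta))" using eta(1) by (simp add: U_def)
  qed
  then show ?thesis using d(1) by blast
qed

end

section \<open>Functions of class \<open>C\<^sup>1\<close> with compact support\<close>

definition C1_grad :: "('a::euclidean_space \<Rightarrow> real) \<Rightarrow> ('a \<Rightarrow> 'a) \<Rightarrow> bool" where
  "C1_grad f df \<longleftrightarrow> (\<forall>x. (f has_derivative (\<lambda>h. df x \<bullet> h)) (at x)) \<and> continuous_on UNIV df"

lemma test_fun_iff:
  "test_fun \<Omega> psi dpsi \<longleftrightarrow>
     C1_grad psi dpsi \<and> compact (closure {x. psi x \<noteq> 0}) \<and> closure {x. psi x \<noteq> 0} \<subseteq> \<Omega>"
  by (auto simp: test_fun_def C1_grad_def)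

lemma C1_gradD:
  assumes "C1_grad f df"
  shows "(f has_derivative (\<lambda>h. df x \<bullet> h)) (at x)" "continuous_on S df" "continuous_on S f"
proof -
  show h: "(f has_derivative (\<lambda>h. df x \<bullet> h)) (at x)" for x using assms by (simp add: C1_grad_def)
  show "continuous_on S df" using assms by (auto simp: C1_grad_def intro: continuous_on_subset)
  show "continuous_on S f"
    using h by (meson has_derivative_continuous continuous_at_imp_continuous_on)
qed

lemma C1_grad_const: "C1_grad (\<lambda>_. c) (\<lambda>_. 0)"
  by (simp add: C1_grad_def)

lemma C1_grad_inner: "C1_grad (\<lambda>x. n \<bullet> x) (\<lambda>_. n)"
  by (auto simp: C1_grad_def intro!: derivative_eq_intros)

lemma C1_grad_add:
  "C1_grad f df \<Longrightarrow> C1_grad g dg \<Longrightarrow> C1_grad (\<lambda>x. f x + g x) (\<lambda>x. df x + dg x)"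
  unfolding C1_grad_def
  by (auto intro!: derivative_eq_intros continuous_intros simp: inner_add_left)

lemma C1_grad_mult:
  "C1_grad f df \<Longrightarrow> C1_grad g dg \<Longrightarrow> C1_grad (\<lambda>x. f x * g x) (\<lambda>x. f x *\<^sub>R dg x + g x *\<^sub>R df x)"
  using C1_gradD(3)[of f df UNIV] C1_gradD(3)[of g dg UNIV]
  unfolding C1_grad_def
  by (auto intro!: derivative_eq_intros continuous_intros simp: inner_add_left)

lemma C1_grad_cmult: "C1_grad f df \<Longrightarrow> C1_grad (\<lambda>x. c * f x) (\<lambda>x. c *\<^sub>R df x)"
  using C1_grad_mult[OF C1_grad_const, of f df c] by simp

lemma C1_grad_dist_square: "C1_grad (\<lambda>x. (norm (x - c))\<^sup>2) (\<lambda>x. 2 *\<^sub>R (x - c))"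
  unfolding C1_grad_def power2_norm_eq_inner
  by (auto intro!: derivative_eq_intros continuous_intros simp: inner_commute algebra_simps)

lemma C1_grad_compose:
  assumes "C1_grad f df" "\<And>x. (\<phi> has_real_derivative \<phi>' (f x)) (at (f x))" "continuous_on (range f) \<phi>'"
  shows "C1_grad (\<lambda>x. \<phi> (f x)) (\<lambda>x. \<phi>' (f x) *\<^sub>R df x)"
  unfolding C1_grad_def
proof (intro conjI allI)
  fix x
  have "((\<phi> \<circ> f) has_derivative ((*) (\<phi>' (f x)) \<circ> (\<lambda>h. df x \<bullet> h))) (at x)"
    using assms(2)[of x] C1_gradD(1)[OF assms(1), of x]
    by (intro diff_chain_at) (auto simp: has_field_derivative_def)
  then show "((\<lambda>x. \<phi> (f x)) has_derivative (\<lambda>h. (\<phi>' (f x) *\<^sub>R df x) \<bullet> h)) (at x)"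
    by (simp add: o_def)
  show "continuous_on UNIV (\<lambda>x. \<phi>' (f x) *\<^sub>R df x)"
    using C1_gradD(2,3)[OF assms(1), of UNIV]
    by (auto intro!: continuous_intros continuous_on_compose2[OF assms(3)])
qed

text \<open>The source of compact supports below: test functions are only required to be of class
  C^1, and the square of the positive part is, since its difference quotient at 0 is bounded by
  \<open>\<bar>h\<bar>\<close>.\<close>

lemma has_derivative_max_square:
  "((\<lambda>s. (max 0 s)\<^sup>2) has_real_derivative 2 * max 0 s) (at s)" for s :: real
proof -
  consider "s > 0" | "s < 0" | "s = 0" by linarith
  then show ?thesis
  proof cases
    case 1
    have "((\<lambda>s. s\<^sup>2) has_real_derivative 2 * max 0 s) (at s)"
      using 1 by (auto intro!: derivative_eq_intros)
    then show ?thesis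
      by (rule has_field_derivative_transform_within_open[of _ _ _ "{0<..}"]) (use 1 in auto)
  next
    case 2
    have "((\<lambda>s. 0) has_real_derivative 2 * max 0 s) (at s)" using 2 by simp
    then show ?thesis
      by (rule has_field_derivative_transform_within_open[of _ _ _ "{..<0}"]) (use 2 in auto)
  next
    case 3
    have "((\<lambda>h. (max 0 h)\<^sup>2 / h) \<longlongrightarrow> 0) (at (0::real))"
    proof (rule Lim_null_comparison)
      show "eventually (\<lambda>h. norm ((max 0 h)\<^sup>2 / h) \<le> \<bar>h\<bar>) (at (0::real))"
        by (intro always_eventually allI) (auto simp: max_def power2_eq_square)
      show "((\<lambda>h. \<bar>h\<bar>) \<longlongrightarrow> 0) (at (0::real))" using tendsto_rabs_zero[OF tendsto_ident_at] by simp
    qed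
    then show ?thesis using 3 by (simp add: has_field_derivative_iff)
  qed
qed

lemma C1_grad_max_square:
  assumes "C1_grad f df"
  shows "C1_grad (\<lambda>x. (max 0 (f x))\<^sup>2) (\<lambda>x. (2 * max 0 (f x)) *\<^sub>R df x)"
proof (rule C1_grad_compose[of f df "\<lambda>s. (max 0 s)\<^sup>2" "\<lambda>s. 2 * max 0 s"])
  show "continuous_on (range f) (\<lambda>s. 2 * max 0 s)"
    by (intro continuous_on_mult continuous_on_max continuous_on_const continuous_on_id)
  show "C1_grad f df" by (rule assms)
  show "((\<lambda>s. (max 0 s)\<^sup>2) has_real_derivative 2 * max 0 (f x)) (at (f x))" for x
    by (rule has_derivative_max_square)
qed

lemma C1_grad_zero_outside:
  assumes "C1_grad f df" "x \<notin> closure {x. f x \<noteq> 0}"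
  shows "f x = 0" "df x = 0"
proof -
  have z: "f y = 0" if "y \<in> - closure {x. f x \<noteq> 0}" for y
    using that closure_subset[of "{x. f x \<noteq> 0}"] by blast
  show "f x = 0" by (rule z) (use assms(2) in blast)
  have "eventually (\<lambda>y. y \<in> - closure {x. f x \<noteq> 0}) (nhds x)"
    using assms(2) by (intro eventually_nhds_in_open) auto
  then have "eventually (\<lambda>y. f y = 0) (nhds x)"
    by (rule eventually_mono) (rule z)
  then obtain S where S: "open S" "x \<in> S" "\<And>y. y \<in> S \<Longrightarrow> f y = 0"
    unfolding eventually_nhds by blast
  have "(f has_derivative (\<lambda>h. 0)) (at x)"
    by (rule has_derivative_transform_within_open[OF _ S(1,2), of "\<lambda>_. 0"]) (auto simp: S(3))
  then have "(\<lambda>h. df x \<bullet> h) = (\<lambda>h. 0)"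
    using has_derivative_unique C1_gradD(1)[OF assms(1)] by blast
  then show "df x = 0" by (metis inner_eq_zero_iff)
qed

section \<open>Integration by parts with compact supports\<close>

lemma continuous_compact_support_integrable:
  fixes f :: "'a::euclidean_space \<Rightarrow> 'b::euclidean_space"
  assumes "continuous_on UNIV f" "compact C" "\<And>x. x \<notin> C \<Longrightarrow> f x = 0"
  shows "integrable lborel f" "f absolutely_integrable_on UNIV" "\<exists>B. \<forall>x. norm (f x) \<le> B"
proof -
  have "(\<lambda>x. indicator C x *\<^sub>R f x) = f" using assms(3) by (auto simp: indicator_def)
  then show i: "integrable lborel f"
    using borel_integrable_compact[OF assms(2) continuous_on_subset[OF assms(1)]] by auto
  then show "f absolutely_integrable_on UNIV"
    unfolding set_integrable_def by (simp add: integrable_completion borel_measurable_integrable)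
  have "bounded (f ` C)"
    using assms(1,2) by (meson compact_continuous_image compact_imp_bounded continuous_on_subset subset_UNIV)
  then obtain B where "\<And>x. x \<in> C \<Longrightarrow> norm (f x) \<le> B" unfolding bounded_iff by auto
  then have "norm (f x) \<le> max 0 B" for x
    using assms(3)[of x] by (cases "x \<in> C") (auto simp: le_max_iff_disj)
  then show "\<exists>B. \<forall>x. norm (f x) \<le> B" by blast
qed

text \<open>By translation invariance every difference quotient in direction \<open>e\<close> has
  integral 0. For steps at most 1 the quotients are bounded by a Lipschitz constant times
  \<open>norm e\<close> and vanish outside one fixed ball, so dominated convergence carries this
  over to the derivative.\<close>

lemma integral_C1_grad_0:
  fixes f :: "'a::euclidean_space \<Rightarrow> real"
  assumes f: "C1_grad f df" and C: "compact C" "closure {x. f x \<noteq> 0} \<subseteq> C"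
  shows "integral UNIV (\<lambda>x. df x \<bullet> e) = 0"
proof -
  have z: "f x = 0" "df x = 0" if "x \<notin> C" for x
    using that C C1_grad_zero_outside[OF f, of x] by blast+
  note fi = continuous_compact_support_integrable[OF C1_gradD(3)[OF f] C(1) z(1)]
  note dfi = continuous_compact_support_integrable[OF C1_gradD(2)[OF f] C(1) z(2)]
  obtain B where B: "\<And>x. norm (df x) \<le> B" using dfi(3) by blast
  have fm[measurable]: "f \<in> borel_measurable borel"
    by (rule borel_measurable_continuous_onI[OF C1_gradD(3)[OF f]])
  have dfm[measurable]: "df \<in> borel_measurable borel"
    by (rule borel_measurable_continuous_onI[OF C1_gradD(2)[OF f]])
  from B have B0: "B \<ge> 0" using norm_ge_zero order.trans by blast
  obtain R where "\<forall>x\<in>C. norm x \<le> R"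
    using compact_imp_bounded[OF C(1)] unfolding bounded_iff by blast
  then have R: "C \<subseteq> cball 0 R" by auto
  have lip: "\<bar>f y - f x\<bar> \<le> B * norm (y - x)" for x y
  proof -
    have "norm (f y - f x) \<le> B * norm (y - x)"
    proof (rule differentiable_bound[of UNIV f "\<lambda>x h. df x \<bullet> h"])
      show "onorm (\<lambda>h. df x \<bullet> h) \<le> B" for x
      proof (rule onorm_le)
        show "norm (df x \<bullet> h) \<le> B * norm h" for h
          using Cauchy_Schwarz_ineq2[of "df x" h] mult_right_mono[OF B[of x] norm_ge_zero[of h]] by simp
      qed
    qed (auto intro: C1_gradD(1)[OF f])
    then show ?thesis by simp
  qed
  define t :: "nat \<Rightarrow> real" where "t n = 1 / Suc n" for n
  have t: "t n > 0" "t n \<le> 1" for n by (auto simp: t_def)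
  have t0: "t \<longlonglongrightarrow> 0" unfolding t_def using LIMSEQ_Suc[OF lim_1_over_n] by simp
  define q where "q n x = (f (t n *\<^sub>R e + x) - f x) / t n" for n x
  have shift: "integrable lborel (\<lambda>x. f (c + x))" "(LINT x|lborel. f (c + x)) = (LINT x|lborel. f x)" for c
  proof -
    have "integrable (distr lborel borel ((+) c)) f" using fi(1) by (simp add: lborel_distr_plus)
    then show "integrable lborel (\<lambda>x. f (c + x))" by (subst (asm) integrable_distr_eq) auto
    have "(LINT x|distr lborel borel ((+) c). f x) = (LINT x|lborel. f (c + x))"
      by (intro integral_distr) auto
    then show "(LINT x|lborel. f (c + x)) = (LINT x|lborel. f x)" by (simp add: lborel_distr_plus)
  qed
  have q0: "(LINT x|lborel. q n x) = 0" for n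
    unfolding q_def using shift fi(1) by (simp add: Bochner_Integration.integral_diff)
  have "(\<lambda>n. LINT x|lborel. q n x) \<longlonglongrightarrow> (LINT x|lborel. df x \<bullet> e)"
  proof (rule integral_dominated_convergence)
    show "(\<lambda>x. df x \<bullet> e) \<in> borel_measurable lborel" by measurable
    show "q n \<in> borel_measurable lborel" for n
      unfolding q_def by measurable
    show "integrable lborel (\<lambda>x. (B * norm e) * indicator (cball (0::'a) (R + norm e)) x :: real)"
      using emeasure_bounded_finite[OF bounded_cball[of "0::'a" "R + norm e"]]
      by (intro integrable_mult_right integrable_real_indicator) auto
    show "AE x in lborel. (\<lambda>n. q n x) \<longlonglongrightarrow> df x \<bullet> e"
    proof (intro AE_I2)
      fix x
      have "((\<lambda>s::real. x + s *\<^sub>R e) has_derivative (\<lambda>s. s *\<^sub>R e)) (at 0)"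
        by (auto intro!: derivative_eq_intros)
      moreover have "(f has_derivative (\<lambda>h. df x \<bullet> h)) (at (x + 0 *\<^sub>R e))"
        using C1_gradD(1)[OF f, of x] by simp
      ultimately have "((f \<circ> (\<lambda>s. x + s *\<^sub>R e)) has_derivative ((\<lambda>h. df x \<bullet> h) \<circ> (\<lambda>s. s *\<^sub>R e))) (at 0)"
        by (rule diff_chain_at)
      then have "((\<lambda>s. f (x + s *\<^sub>R e)) has_real_derivative (df x \<bullet> e)) (at 0)"
        by (simp add: o_def has_field_derivative_def mult_commute_abs)
      then have "((\<lambda>s. (f (x + s *\<^sub>R e) - f x) / s) \<longlongrightarrow> df x \<bullet> e) (at 0)"
        by (simp add: has_field_derivative_iff)
      then have "(\<lambda>n. (f (x + t n *\<^sub>R e) - f x) / t n) \<longlonglongrightarrow> df x \<bullet> e"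
        using t0 t(1) unfolding LIMSEQ_SEQ_conv[symmetric] by (metis less_irrefl)
      then show "(\<lambda>n. q n x) \<longlonglongrightarrow> df x \<bullet> e" by (simp add: q_def add.commute)
    qed
    show "AE x in lborel. norm (q n x) \<le> (B * norm e) * indicator (cball (0::'a) (R + norm e)) x" for n
    proof (intro AE_I2)
      fix x
      show "norm (q n x) \<le> (B * norm e) * indicator (cball (0::'a) (R + norm e)) x"
      proof (cases "x \<in> cball 0 (R + norm e)")
        case True
        have "\<bar>f (t n *\<^sub>R e + x) - f x\<bar> \<le> t n * (B * norm e)"
          using lip[of "t n *\<^sub>R e + x" x] t(1)[of n] by (simp add: mult.left_commute)
        then show ?thesis using True t(1)[of n] by (simp add: q_def pos_divide_le_eq mult.commute)
      next
        case False
        have "norm (t n *\<^sub>R e) \<le> norm e" using t[of n] by (simp add: mult_left_le_one_le)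
        then have "norm (t n *\<^sub>R e + x) > R" using False norm_triangle_ineq2[of x "- (t n *\<^sub>R e)"] by (simp add: add.commute)
        moreover have "norm x > R" using False norm_ge_zero[of e] unfolding mem_cball_0 by linarith
        ultimately have "f (t n *\<^sub>R e + x) = 0" "f x = 0" using R z(1) by (force simp: subset_iff)+
        then show ?thesis using False by (simp add: q_def)
      qed
    qed
  qed
  then have "(LINT x|lborel. df x \<bullet> e) = 0" unfolding q0 using LIMSEQ_unique tendsto_const by blast
  moreover have "integrable lborel (\<lambda>x. df x \<bullet> e)" using dfi(1) by auto
  ultimately show ?thesis using integral_lborel by metis
qed

lemma continuous_on_extend_zero:
  fixes h :: "'a::t2_space \<Rightarrow> 'b::real_normed_vector"
  assumes "open w" "compact C" "C \<subseteq> w" "continuous_on w h" "\<And>x. x \<in> w - C \<Longrightarrow> h x = 0"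
  shows "continuous_on UNIV (\<lambda>x. if x \<in> w then h x else 0)"
proof -
  have "continuous_on (w \<union> - C) (\<lambda>x. if x \<in> w then h x else 0)"
  proof (rule continuous_on_open_Un)
    show "continuous_on w (\<lambda>x. if x \<in> w then h x else 0)"
      using assms(4) by (rule continuous_on_eq) auto
    show "continuous_on (- C) (\<lambda>x. if x \<in> w then h x else 0)"
      using assms(5) by (intro continuous_on_eq[OF continuous_on_const[of _ 0]]) auto
    show "open (- C)" using assms(2) by (simp add: compact_imp_closed open_Compl)
  qed (use assms in auto)
  moreover have "w \<union> - C = UNIV" using assms(3) by auto
  ultimately show ?thesis by simp
qed

lemma absolutely_integrable_on_compact_support:
  fixes h :: "'a::euclidean_space \<Rightarrow> 'b::euclidean_space"
  assumes "open w" "compact C" "C \<subseteq> w" "continuous_on w h" "\<And>x. x \<in> w - C \<Longrightarrow> h x = 0"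
  shows "h absolutely_integrable_on w"
proof -
  have "(\<lambda>x. if x \<in> w then h x else 0) absolutely_integrable_on UNIV"
    by (rule continuous_compact_support_integrable(2)[OF continuous_on_extend_zero[OF assms] assms(2)])
       (use assms(5) in auto)
  then show ?thesis using absolutely_integrable_restrict_UNIV by blast
qed

text \<open>\<open>f\<close> is controlled only on \<open>w\<close>, but the product with
  \<open>psi\<close>, extended by 0, is C^1 on the whole plane because the support of
  \<open>psi\<close> is a compact subset of \<open>w\<close>.\<close>

lemma integration_by_parts_C1:
  fixes f :: "real^2 \<Rightarrow> real"
  assumes w: "open w" and f: "\<And>x. x \<in> w \<Longrightarrow> (f has_derivative (\<lambda>h. df x \<bullet> h)) (at x)" "continuous_on w df"
    and psi: "test_fun w psi dpsi"
  shows "integral w (\<lambda>x. f x * (dpsi x \<bullet> e)) = - integral w (\<lambda>x. (df x \<bullet> e) * psi x)"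
    and "(\<lambda>x. f x * (dpsi x \<bullet> e)) absolutely_integrable_on w"
    and "(\<lambda>x. (df x \<bullet> e) * psi x) absolutely_integrable_on w"
proof -
  define C where "C = closure {x. psi x \<noteq> 0}"
  have C: "compact C" "C \<subseteq> w" and psi': "C1_grad psi dpsi" using psi by (auto simp: test_fun_iff C_def)
  have z: "psi x = 0" "dpsi x = 0" if "x \<notin> C" for x
    using that C1_grad_zero_outside[OF psi', of x] unfolding C_def by blast+
  have cf: "continuous_on w f"
    using f(1) by (meson has_derivative_continuous continuous_at_imp_continuous_on)
  note cpsi = C1_gradD(2,3)[OF psi', of w]
  define P where "P x = (if x \<in> w then f x * psi x else 0)" for x
  define G where "G x = (if x \<in> w then f x *\<^sub>R dpsi x + psi x *\<^sub>R df x else 0)" for x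
  have P: "C1_grad P G"
    unfolding C1_grad_def
  proof (intro conjI allI)
    show "continuous_on UNIV G" unfolding G_def
      by (rule continuous_on_extend_zero[OF w C]) (auto intro!: continuous_intros cf cpsi f(2) simp: z)
    fix x
    show "(P has_derivative (\<lambda>h. G x \<bullet> h)) (at x)"
    proof (cases "x \<in> w")
      case True
      have "((\<lambda>x. f x * psi x) has_derivative (\<lambda>h. G x \<bullet> h)) (at x)"
        using True unfolding G_def
        by (auto intro!: derivative_eq_intros f(1) C1_gradD(1)[OF psi'] simp: inner_add_left)
      then show ?thesis
        by (rule has_derivative_transform_within_open[OF _ w True]) (auto simp: P_def)
    next
      case False
      then have "x \<in> - C" using C by auto
      have "(P has_derivative (\<lambda>h. 0)) (at x)"
        by (rule has_derivative_transform_within_open[OF _ _ \<open>x \<in> - C\<close>, of "\<lambda>_. 0"])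
           (use C z in \<open>auto simp: P_def compact_imp_closed open_Compl\<close>)
      then show ?thesis using False by (simp add: G_def)
    qed
  qed
  have "closure {x. P x \<noteq> 0} \<subseteq> C"
    unfolding C_def by (intro closure_mono) (auto simp: P_def)
  then have "integral UNIV (\<lambda>x. G x \<bullet> e) = 0" by (rule integral_C1_grad_0[OF P C(1)])
  moreover have "(\<lambda>x. G x \<bullet> e) = (\<lambda>x. if x \<in> w then f x * (dpsi x \<bullet> e) + (df x \<bullet> e) * psi x else 0)"
    by (auto simp: G_def inner_add_left)
  ultimately have s: "integral w (\<lambda>x. f x * (dpsi x \<bullet> e) + (df x \<bullet> e) * psi x) = 0"
    by (simp add: Henstock_Kurzweil_Integration.integral_restrict_UNIV)
  show i1: "(\<lambda>x. f x * (dpsi x \<bullet> e)) absolutely_integrable_on w"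
    by (rule absolutely_integrable_on_compact_support[OF w C]) (auto intro!: continuous_intros cf cpsi simp: z)
  show i2: "(\<lambda>x. (df x \<bullet> e) * psi x) absolutely_integrable_on w"
    by (rule absolutely_integrable_on_compact_support[OF w C]) (auto intro!: continuous_intros f(2) cpsi simp: z)
  show "integral w (\<lambda>x. f x * (dpsi x \<bullet> e)) = - integral w (\<lambda>x. (df x \<bullet> e) * psi x)"
    using s i1 i2 by (simp add: Henstock_Kurzweil_Integration.integral_add set_lebesgue_integral_eq_integral(1) eq_neg_iff_add_eq_0)
qed

section \<open>The fundamental lemma of the calculus of variations\<close>

lemma test_fun_ratio:
  assumes "test_fun w Q dQ" "\<And>x. Q x \<ge> 0" "\<epsilon> > 0"
  shows "test_fun w (\<lambda>x. Q x / (Q x + \<epsilon>)) (\<lambda>x. (\<epsilon> / (Q x + \<epsilon>)\<^sup>2) *\<^sub>R dQ x)"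
proof -
  have pos: "Q x + \<epsilon> > 0" for x using assms(2)[of x] assms(3) by linarith
  then have ne: "Q x + \<epsilon> \<noteq> 0" for x by (metis less_irrefl)
  have "{x. Q x / (Q x + \<epsilon>) \<noteq> 0} = {x. Q x \<noteq> 0}" using ne by auto
  moreover have "C1_grad (\<lambda>x. Q x / (Q x + \<epsilon>)) (\<lambda>x. (\<epsilon> / (Q x + \<epsilon>)\<^sup>2) *\<^sub>R dQ x)"
  proof (rule C1_grad_compose[of Q dQ "\<lambda>s. s / (s + \<epsilon>)" "\<lambda>s. \<epsilon> / (s + \<epsilon>)\<^sup>2"])
    show "C1_grad Q dQ" using assms(1) by (simp add: test_fun_iff)
    show "((\<lambda>s. s / (s + \<epsilon>)) has_real_derivative \<epsilon> / (Q x + \<epsilon>)\<^sup>2) (at (Q x))" for x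
      using ne[of x] by (auto intro!: derivative_eq_intros simp: power2_eq_square)
    show "continuous_on (range Q) (\<lambda>s. \<epsilon> / (s + \<epsilon>)\<^sup>2)"
      using ne by (intro continuous_intros) auto
  qed
  ultimately show ?thesis using assms(1) by (simp add: test_fun_iff)
qed

lemma box_test_fun:
  fixes a b :: "real^2"
  assumes "cbox a b \<subseteq> w"
  shows "\<exists>Q dQ. test_fun w Q dQ \<and> (\<forall>x. Q x \<ge> 0) \<and> {x. Q x \<noteq> 0} = box a b"
proof (cases "box a b = {}")
  case True
  then show ?thesis
    by (intro exI[of _ "\<lambda>_. 0"]) (auto simp: test_fun_iff C1_grad_const)
next
  case False
  then have ab: "a $ i < b $ i" for i by (simp add: interval_eq_empty_cart not_le)
  define p where "p i x = (x $ i - a $ i) * (b $ i - x $ i)" for i and x :: "real^2"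
  have "\<exists>dp. C1_grad (p i) dp" for i
  proof -
    have lin: "C1_grad (\<lambda>x. c * x $ i + d) (\<lambda>x. c *\<^sub>R axis i 1 + 0)" for c d
      using C1_grad_add[OF C1_grad_cmult[OF C1_grad_inner[of "axis i 1 :: real^2"]] C1_grad_const[of d], of c]
      by (simp add: inner_axis' inner_real_def)
    show ?thesis unfolding p_def
      using C1_grad_mult[OF lin[of 1 "- a $ i"] lin[of "-1" "b $ i"]] by (auto simp: algebra_simps)
  qed
  then obtain dp where dp: "\<And>i. C1_grad (p i) (dp i)" by metis
  define Q where "Q x = (max 0 (p 1 x))\<^sup>2 * (max 0 (p 2 x))\<^sup>2" for x
  obtain dQ where dQ: "C1_grad Q dQ"
    unfolding Q_def using C1_grad_mult[OF C1_grad_max_square[OF dp] C1_grad_max_square[OF dp]] by blast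
  have p: "p i x > 0 \<longleftrightarrow> a $ i < x $ i \<and> x $ i < b $ i" for i x
    unfolding p_def using ab[of i] by (auto simp: zero_less_mult_iff)
  have max0: "max 0 s \<noteq> 0 \<longleftrightarrow> s > 0" for s :: real by linarith
  have Q0: "Q x \<noteq> 0 \<longleftrightarrow> max 0 (p 1 x) \<noteq> 0 \<and> max 0 (p 2 x) \<noteq> 0" for x
    unfolding Q_def power2_eq_square mult_eq_0_iff by blast
  then have s: "{x. Q x \<noteq> 0} = box a b"
    unfolding Q0 max0 p by (auto simp: mem_box_cart forall_2)
  then have "closure {x. Q x \<noteq> 0} = cbox a b" using False by (simp add: closure_box)
  then have "test_fun w Q dQ" using dQ assms by (simp add: test_fun_iff compact_cbox)
  moreover have "Q x \<ge> 0" for x by (simp add: Q_def)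
  ultimately show ?thesis using s by blast
qed

text \<open>If \<open>Q\<close> is a test function that is positive exactly on the box, the
  quotients \<open>Q / (Q + 1 / Suc n)\<close> are test functions with values in [0, 1] that
  converge to the indicator of the box, so \<open>\<bar>g\<bar>\<close> dominates.\<close>

lemma integral_box_0:
  fixes g :: "real^2 \<Rightarrow> real"
  assumes w: "cbox a b \<subseteq> w" and g: "g absolutely_integrable_on cbox a b"
    and test: "\<And>psi dpsi. test_fun w psi dpsi \<Longrightarrow> integral w (\<lambda>x. g x * psi x) = 0"
  shows "integral (box a b) g = 0"
proof -
  obtain Q dQ where Q: "test_fun w Q dQ" "\<And>x. Q x \<ge> 0" "{x. Q x \<noteq> 0} = box a b"
    using box_test_fun[OF w] by blast
  define r where "r n x = Q x / (Q x + 1 / Suc n)" for n x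
  have r: "test_fun w (r n) (\<lambda>x. ((1 / Suc n) / (Q x + 1 / Suc n)\<^sup>2) *\<^sub>R dQ x)" for n
    unfolding r_def using Q by (intro test_fun_ratio) auto
  have r01: "0 \<le> r n x" "r n x \<le> 1" for n x
    using Q(2)[of x] by (auto simp: r_def divide_le_eq add_nonneg_pos)
  have rbox: "r n x = 0" if "x \<notin> box a b" for n x
    using that Q(3) by (auto simp: r_def)
  have gb: "g absolutely_integrable_on box a b"
    using g absolutely_integrable_on_open_interval by blast
  have cr: "continuous_on UNIV (r n)" for n using r[of n] C1_gradD(3) by (auto simp: test_fun_iff)
  have meas: "r n \<in> borel_measurable (lebesgue_on (box a b))" for n
    by (intro continuous_imp_measurable_on_sets_lebesgue continuous_on_subset[OF cr]) auto
  have gi: "(\<lambda>x. r n x * g x) absolutely_integrable_on box a b" for n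
  proof (rule absolutely_integrable_bounded_measurable_product[OF bilinear_times meas _ _ gb])
    show "bounded (r n ` box a b)" using r01[of n] by (intro boundedI[of _ 1]) auto
  qed auto
  have zero: "integral (box a b) (\<lambda>x. r n x * g x) = 0" for n
  proof -
    have "integral (box a b) (\<lambda>x. r n x * g x) = integral w (\<lambda>x. r n x * g x)"
      using w box_subset_cbox[of a b] rbox
      by (intro integral_spike_set; intro negligible_subset[OF negligible_empty]) auto
    also have "\<dots> = 0" using test[OF r[of n]] by (simp add: mult.commute)
    finally show ?thesis .
  qed
  have "(\<lambda>n. integral (box a b) (\<lambda>x. r n x * g x)) \<longlonglongrightarrow> integral (box a b) g"
  proof (rule dominated_convergence(2))
    show "(\<lambda>x. r n x * g x) integrable_on box a b" for n
      using gi set_lebesgue_integral_eq_integral(1) by blast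
    show "(\<lambda>x. \<bar>g x\<bar>) integrable_on box a b"
      using gb by (simp add: absolutely_integrable_on_def)
    show "norm (r n x * g x) \<le> \<bar>g x\<bar>" for n x
      using r01[of n x] by (simp add: abs_mult mult_left_le_one_le)
    fix x assume "x \<in> box a b"
    then have Qx: "Q x > 0" using Q(2)[of x] Q(3) by (auto simp: less_le)
    have "(\<lambda>n. Q x / (Q x + 1 / Suc n)) \<longlonglongrightarrow> Q x / (Q x + 0)"
      using Qx by (intro tendsto_intros LIMSEQ_Suc[OF lim_1_over_n]) auto
    then have "(\<lambda>n. r n x) \<longlonglongrightarrow> 1" using Qx by (simp add: r_def)
    from tendsto_mult_right[OF this, of "g x"] show "(\<lambda>n. r n x * g x) \<longlonglongrightarrow> g x" by simp
  qed
  then show ?thesis unfolding zero using LIMSEQ_unique tendsto_const by blast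
qed

text \<open>Boxes form an intersection-stable generator of the Borel sets, and an increasing
  sequence of boxes handles the whole space, as the complement step requires. Hence the integral
  vanishes over every Borel set, in particular where \<open>h\<close> is positive and where it is
  negative.\<close>

lemma AE_0_if_integral_box_0:
  fixes h :: "'a::euclidean_space \<Rightarrow> real"
  assumes h: "integrable lborel h" and box: "\<And>a b. (LINT x:box a b|lborel. h x) = 0"
  shows "AE x in lborel. h x = 0"
proof -
  have si: "set_integrable lborel A h" if "A \<in> sets borel" for A
    using that h integrable_mult_indicator[of A lborel h] by (auto simp: set_integrable_def)
  have UN: "(LINT x:UNIV|lborel. h x) = 0"
  proof -
    let ?B = "\<lambda>n::nat. box (- real n *\<^sub>R One) (real n *\<^sub>R One) :: 'a set"
    have U: "(\<Union>n. ?B n) = UNIV" using UN_box_eq_UNIV by simp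
    have "(\<lambda>n. LINT x:?B n|lborel. h x) \<longlonglongrightarrow> (LINT x:(\<Union>n. ?B n)|lborel. h x)"
    proof (rule set_integral_cont_up)
      show "incseq ?B"
        unfolding incseq_def by (intro allI impI subset_box_imp) auto
      show "set_integrable lborel (\<Union>n. ?B n) h" unfolding U by (rule si) simp
    qed auto
    then show ?thesis unfolding box U using LIMSEQ_unique tendsto_const by blast
  qed
  have all: "(LINT x:A|lborel. h x) = 0" if "A \<in> sets borel" for A
  proof -
    let ?G = "range (\<lambda>(a, b). box a b :: 'a set)"
    have "Int_stable ?G" by (auto simp: Int_stable_def box_Int_box)
    moreover have "?G \<subseteq> Pow UNIV" by auto
    moreover have "A \<in> sigma_sets UNIV ?G" using that by (simp add: borel_eq_box)
    ultimately show ?thesis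
    proof (induction rule: sigma_sets_induct_disjoint)
      case (basic A)
      then show ?case using box by auto
    next
      case empty
      show ?case by (simp add: set_lebesgue_integral_def)
    next
      case (compl A)
      then have A: "A \<in> sets borel" by (simp add: borel_eq_box)
      have "(LINT x:A \<union> (UNIV - A)|lborel. h x) = (LINT x:A|lborel. h x) + (LINT x:UNIV - A|lborel. h x)"
        using A by (intro set_integral_Un si) auto
      then show ?case using compl UN by simp
    next
      case (union A)
      then have A: "A i \<in> sets borel" for i by (auto simp: borel_eq_box)
      have "(LINT x:(\<Union>i. A i)|lborel. h x) = (\<Sum>i. (LINT x:A i|lborel. h x))"
        using A union(1) by (intro lebesgue_integral_countable_add si) (auto simp: disjoint_family_on_def)
      then show ?case using union by simp
    qed
  qed
  have hm[measurable]: "h \<in> borel_measurable borel" using h by auto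
  have "AE x in lborel. \<not> h x > 0 \<and> \<not> h x < 0"
  proof (rule AE_conjI)
    let ?P = "{x. h x > 0}" and ?N = "{x. h x < 0}"
    have m: "?P \<in> sets borel" "?N \<in> sets borel" by measurable
    have "AE x in lborel. indicator ?P x *\<^sub>R h x = 0"
      using all[OF m(1)] si[OF m(1)] unfolding set_lebesgue_integral_def set_integrable_def
      by (subst integral_nonneg_eq_0_iff_AE[symmetric]) (auto simp: indicator_def)
    then show "AE x in lborel. \<not> h x > 0" by eventually_elim auto
    have "AE x in lborel. - (indicator ?N x *\<^sub>R h x) = 0"
      using all[OF m(2)] si[OF m(2)] unfolding set_lebesgue_integral_def set_integrable_def
      by (subst integral_nonneg_eq_0_iff_AE[symmetric]) (auto simp: indicator_def)
    then show "AE x in lborel. \<not> h x < 0" by eventually_elim auto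
  qed
  then show ?thesis by eventually_elim auto
qed

section \<open>Weak derivatives\<close>

text \<open>The generator argument concerns Borel functions, so \<open>g\<close>, cut off outside
  the open box, is replaced by a Borel function \<open>h'\<close> equal to it almost everywhere; the
  boundary of the box is a null set.\<close>

lemma AE_0_on_cbox:
  fixes g :: "'a::euclidean_space \<Rightarrow> real"
  assumes g: "g absolutely_integrable_on cbox a b"
    and zero: "\<And>c d. cbox c d \<subseteq> cbox a b \<Longrightarrow> integral (box c d) g = 0"
  shows "AE x in lebesgue. x \<in> cbox a b \<longrightarrow> g x = 0"
proof -
  define h where "h x = (if x \<in> box a b then g x else 0)" for x
  have "h absolutely_integrable_on UNIV"
    unfolding h_def absolutely_integrable_restrict_UNIV
    using g absolutely_integrable_on_open_interval by blast
  then have h: "integrable lebesgue h" by (simp add: set_integrable_def)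
  then obtain h' where h'[measurable]: "h' \<in> borel_measurable lborel" and eq: "AE x in lborel. h x = h' x"
    using completion_ex_borel_measurable_real by blast
  have eq': "AE x in lebesgue. h x = h' x" using eq by (rule AE_completion)
  have h'm: "h' \<in> borel_measurable lebesgue" using h' by (rule measurable_completion)
  have "integrable lebesgue h'"
    using h integrable_cong_AE[OF _ h'm eq'] by blast
  then have i: "integrable lborel h'" using h' integrable_completion by blast
  have "AE x in lborel. h' x = 0"
  proof (rule AE_0_if_integral_box_0[OF i])
    fix c d
    have si: "set_integrable lebesgue (box c d) h"
      using integrable_mult_indicator[OF _ h, of "box c d"] by (simp add: set_integrable_def)
    have "(LINT x:box c d|lborel. h' x) = (LINT x|lebesgue. indicator (box c d) x *\<^sub>R h' x)"
      unfolding set_lebesgue_integral_def by (intro integral_completion[symmetric]) measurable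
    also have "\<dots> = (LINT x|lebesgue. indicator (box c d) x *\<^sub>R h x)"
    proof (rule integral_cong_AE)
      have m: "indicator (box c d) \<in> borel_measurable (lebesgue :: 'a measure)"
        by (intro borel_measurable_indicator) simp
      show "(\<lambda>x. indicator (box c d) x *\<^sub>R h' x) \<in> borel_measurable lebesgue"
        using m h'm by (intro borel_measurable_scaleR)
      show "(\<lambda>x. indicator (box c d) x *\<^sub>R h x) \<in> borel_measurable lebesgue"
        using m borel_measurable_integrable[OF h] by (intro borel_measurable_scaleR)
      show "AE x in lebesgue. indicator (box c d) x *\<^sub>R h' x = indicator (box c d) x *\<^sub>R h x"
        using eq' by eventually_elim simp
    qed
    also have "\<dots> = integral (box c d) h"
      using set_lebesgue_integral_eq_integral(2)[OF si] by (simp add: set_lebesgue_integral_def)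
    also have "\<dots> = integral (box c d \<inter> box a b) g"
      unfolding h_def by (simp add: integral_restrict_Int Int_commute)
    also have "\<dots> = 0"
    proof -
      obtain l u where lu: "box c d \<inter> box a b = box l u" "cbox c d \<inter> cbox a b = cbox l u"
        unfolding box_Int_box Int_interval by blast
      then have "cbox l u \<subseteq> cbox a b" by blast
      then show ?thesis using zero lu by simp
    qed
    finally show "(LINT x:box c d|lborel. h' x) = 0" .
  qed
  then have "AE x in lebesgue. h' x = 0" by (rule AE_completion)
  moreover have "AE x in lebesgue. x \<notin> cbox a b - box a b"
    by (intro AE_completion AE_not_in null_sets_cbox_Diff_box)
  ultimately show ?thesis
    using eq' by eventually_elim (auto simp: h_def split: if_splits)
qed

lemma fundamental_lemma_of_calculus_of_variations:
  fixes g :: "real^2 \<Rightarrow> real"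
  assumes w: "open w" and g: "\<And>C. compact C \<Longrightarrow> C \<subseteq> w \<Longrightarrow> g absolutely_integrable_on C"
    and test: "\<And>psi dpsi. test_fun w psi dpsi \<Longrightarrow> integral w (\<lambda>x. g x * psi x) = 0"
  shows "AE x in lebesgue. x \<in> w \<longrightarrow> g x = 0"
proof -
  obtain D where D: "countable D" "D \<subseteq> Pow w" "\<And>X. X \<in> D \<Longrightarrow> \<exists>a b. X = cbox a b" "\<Union>D = w"
    using open_countable_Union_open_cbox[OF w] by metis
  have "AE x in lebesgue. \<forall>X\<in>D. x \<in> X \<longrightarrow> g x = 0"
  proof (rule AE_ball_countable'[OF _ D(1)])
    fix X assume X: "X \<in> D"
    then obtain a b where ab: "X = cbox a b" using D(3) by blast
    then have sub: "cbox a b \<subseteq> w" using D(2) X by blast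
    have "integral (box c d) g = 0" if "cbox c d \<subseteq> cbox a b" for c d
      using that sub by (intro integral_box_0[OF _ g test]) (auto simp: compact_cbox)
    then show "AE x in lebesgue. x \<in> X \<longrightarrow> g x = 0"
      unfolding ab using AE_0_on_cbox[OF g[OF compact_cbox sub]] by blast
  qed
  then show ?thesis by eventually_elim (use D(4) in blast)
qed

lemma test_fun_mono: "test_fun w psi dpsi \<Longrightarrow> w \<subseteq> \<Omega> \<Longrightarrow> test_fun \<Omega> psi dpsi"
  unfolding test_fun_def by blast

lemma test_fun_zero_outside:
  assumes "test_fun w psi dpsi" "x \<notin> w" shows "psi x = 0" "dpsi x = 0"
  using assms C1_grad_zero_outside[of psi dpsi x] unfolding test_fun_iff by blast+

lemma test_fun_mult_integrable:
  fixes g :: "real^2 \<Rightarrow> real"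
  assumes psi: "test_fun w psi dpsi"
    and g: "\<And>C. compact C \<Longrightarrow> C \<subseteq> w \<Longrightarrow> g absolutely_integrable_on C"
  shows "(\<lambda>x. g x * psi x) absolutely_integrable_on w" "(\<lambda>x. g x * dpsi x $ j) absolutely_integrable_on w"
proof -
  define C where "C = closure {x. psi x \<noteq> 0}"
  have C: "compact C" "C \<subseteq> w" and psi': "C1_grad psi dpsi" using psi by (auto simp: test_fun_iff C_def)
  have gen: "(\<lambda>x. g x * q x) absolutely_integrable_on w"
    if q: "continuous_on C q" "\<And>x. x \<notin> C \<Longrightarrow> q x = 0" for q
  proof -
    have "(\<lambda>x. q x * g x) absolutely_integrable_on C"
    proof (rule absolutely_integrable_bounded_measurable_product[OF bilinear_times _ _ _ g[OF C]])
      show "C \<in> sets lebesgue" using C(1) by (simp add: lmeasurable_compact fmeasurableD)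
      then show "q \<in> borel_measurable (lebesgue_on C)" by (intro continuous_imp_measurable_on_sets_lebesgue q)
      show "bounded (q ` C)" by (intro compact_imp_bounded compact_continuous_image q C)
    qed
    then have "(\<lambda>x. if x \<in> C then g x * q x else 0) absolutely_integrable_on UNIV"
      unfolding absolutely_integrable_restrict_UNIV by (simp add: mult.commute)
    moreover have "(\<lambda>x. if x \<in> C then g x * q x else 0) = (\<lambda>x. if x \<in> w then g x * q x else 0)"
    proof
      fix x show "(if x \<in> C then g x * q x else 0) = (if x \<in> w then g x * q x else 0)"
        using C(2) q(2)[of x] by auto
    qed
    ultimately show ?thesis using absolutely_integrable_restrict_UNIV[of w "\<lambda>x. g x * q x"] by simp
  qed
  have z: "psi x = 0" "dpsi x $ j = 0" if "x \<notin> C" for x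
    using that C1_grad_zero_outside[OF psi', of x] unfolding C_def by auto
  show "(\<lambda>x. g x * psi x) absolutely_integrable_on w"
    by (rule gen) (rule C1_gradD(3)[OF psi'], rule z)
  show "(\<lambda>x. g x * dpsi x $ j) absolutely_integrable_on w"
    by (rule gen) (intro continuous_intros C1_gradD(2)[OF psi'], rule z)
qed

lemma locally_integrable_component:
  fixes u :: "real^2 \<Rightarrow> real^2"
  assumes "locally_integrable_on u \<Omega>" "compact C" "C \<subseteq> \<Omega>"
  shows "(\<lambda>x. u x $ i) absolutely_integrable_on C"
proof -
  have "u absolutely_integrable_on C" using assms by (simp add: locally_integrable_on_def)
  from absolutely_integrable_component[OF this, of "axis i 1"] show ?thesis by (simp add: inner_axis)
qed

lemma locally_integrable_component2:
  fixes G :: "real^2 \<Rightarrow> real^2^2"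
  assumes "locally_integrable_on G \<Omega>" "compact C" "C \<subseteq> \<Omega>"
  shows "(\<lambda>x. G x $ i $ j) absolutely_integrable_on C"
proof -
  have "G absolutely_integrable_on C" using assms by (simp add: locally_integrable_on_def)
  from absolutely_integrable_component[OF this, of "axis i (axis j 1)"] show ?thesis
    by (simp add: inner_axis)
qed

lemma has_derivative_row:
  fixes phi :: "real^2 \<Rightarrow> real^2"
  assumes "(phi has_derivative (\<lambda>h. A *v h)) (at x)"
  shows "((\<lambda>y. phi y $ i) has_derivative (\<lambda>h. A $ i \<bullet> h)) (at x)"
proof -
  have "((\<lambda>y. phi y $ i) has_derivative (\<lambda>h. (A *v h) $ i)) (at x)"
    using assms by (rule bounded_linear.has_derivative[OF bounded_linear_vec_nth])
  then show ?thesis by (simp add: matrix_vector_mul_component)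
qed

text \<open>The gradient condition on the given map concerns a weak derivative, whereas the
  perturbation needs a continuous one. Both obey the same integration by parts against test
  functions supported in \<open>w\<close>, so every entry of the difference integrates to 0 against
  them.\<close>

lemma weak_deriv_eq_derivative:
  assumes wd: "weak_deriv \<Omega> phi G" and w: "open w" "w \<subseteq> \<Omega>"
    and D: "\<And>x. x \<in> w \<Longrightarrow> (phi has_derivative (\<lambda>h. D x *v h)) (at x)" "continuous_on w D"
  shows "AE x in lebesgue. x \<in> w \<longrightarrow> G x = D x"
proof -
  have "AE x in lebesgue. x \<in> w \<longrightarrow> G x $ i $ j - D x $ i $ j = 0" for i j
  proof (rule fundamental_lemma_of_calculus_of_variations[OF w(1)])
    have cD: "continuous_on w (\<lambda>x. D x $ i)" by (intro continuous_intros D(2))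
    have Gi: "(\<lambda>x. G x $ i $ j) absolutely_integrable_on C" if "compact C" "C \<subseteq> w" for C
      using wd that w(2) unfolding weak_deriv_def by (intro locally_integrable_component2[of G \<Omega>]) auto
    show "(\<lambda>x. G x $ i $ j - D x $ i $ j) absolutely_integrable_on C" if C: "compact C" "C \<subseteq> w" for C
    proof -
      have "continuous_on C (\<lambda>x. D x $ i $ j)"
        by (intro continuous_intros continuous_on_subset[OF D(2) C(2)])
      note i = borel_integrable_compact[OF C(1) this]
      have "(\<lambda>x. D x $ i $ j) absolutely_integrable_on C"
        unfolding set_integrable_def using integrable_completion[OF borel_measurable_integrable[OF i]] i by blast
      then show ?thesis using Gi[OF C] by (intro set_integral_diff(1)) auto
    qed
    fix psi dpsi assume psi: "test_fun w psi dpsi"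
    have psi\<Omega>: "test_fun \<Omega> psi dpsi" using test_fun_mono[OF psi w(2)] .
    have ext: "integral \<Omega> f = integral w f" if "\<And>x. x \<notin> w \<Longrightarrow> f x = 0" for f :: "real^2 \<Rightarrow> real"
    proof -
      have "(\<lambda>x. if x \<in> \<Omega> then f x else 0) = (\<lambda>x. if x \<in> w then f x else 0)"
        using that w(2) by (auto simp: fun_eq_iff)
      then show ?thesis
        using Henstock_Kurzweil_Integration.integral_restrict_UNIV[of \<Omega> f]
          Henstock_Kurzweil_Integration.integral_restrict_UNIV[of w f] by simp
    qed
    have "integral w (\<lambda>x. phi x $ i * dpsi x $ j) = integral \<Omega> (\<lambda>x. phi x $ i * dpsi x $ j)"
      by (rule ext[symmetric]) (simp add: test_fun_zero_outside[OF psi])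
    also have "\<dots> = - integral \<Omega> (\<lambda>x. G x $ i $ j * psi x)"
      using wd psi\<Omega> unfolding weak_deriv_def by blast
    also have "integral \<Omega> (\<lambda>x. G x $ i $ j * psi x) = integral w (\<lambda>x. G x $ i $ j * psi x)"
      by (rule ext) (simp add: test_fun_zero_outside[OF psi])
    finally have 1: "integral w (\<lambda>x. phi x $ i * dpsi x $ j) = - integral w (\<lambda>x. G x $ i $ j * psi x)" .
    note ibp = integration_by_parts_C1[OF w(1) has_derivative_row[OF D(1)] cD psi, of "axis j 1"]
    have 2: "integral w (\<lambda>x. phi x $ i * dpsi x $ j) = - integral w (\<lambda>x. D x $ i $ j * psi x)"
      using ibp(1) by (simp add: inner_axis)
    have iG: "(\<lambda>x. G x $ i $ j * psi x) absolutely_integrable_on w"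
      by (rule test_fun_mult_integrable(1)[OF psi Gi])
    have iD: "(\<lambda>x. D x $ i $ j * psi x) absolutely_integrable_on w"
      using ibp(3) by (simp add: inner_axis)
    show "integral w (\<lambda>x. (G x $ i $ j - D x $ i $ j) * psi x) = 0"
      unfolding left_diff_distrib
      using 1 2 iG iD by (simp add: Henstock_Kurzweil_Integration.integral_diff set_lebesgue_integral_eq_integral(1))
  qed
  then have "AE x in lebesgue. \<forall>i\<in>UNIV. \<forall>j\<in>UNIV. x \<in> w \<longrightarrow> G x $ i $ j - D x $ i $ j = 0"
    by (intro AE_finite_allI) auto
  then show ?thesis by eventually_elim (auto simp: vec_eq_iff)
qed

lemma weak_deriv_add:
  assumes "weak_deriv \<Omega> u G" "weak_deriv \<Omega> v H"
  shows "weak_deriv \<Omega> (\<lambda>x. u x + v x) (\<lambda>x. G x + H x)"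
  unfolding weak_deriv_def
proof (intro conjI allI impI)
  have l: "locally_integrable_on u \<Omega>" "locally_integrable_on G \<Omega>" "locally_integrable_on v \<Omega>" "locally_integrable_on H \<Omega>"
    using assms by (auto simp: weak_deriv_def)
  show "locally_integrable_on (\<lambda>x. u x + v x) \<Omega>" "locally_integrable_on (\<lambda>x. G x + H x) \<Omega>"
    using l unfolding locally_integrable_on_def by (auto intro: set_integral_add(1))
  fix psi dpsi i j assume psi: "test_fun \<Omega> psi dpsi"
  note i = test_fun_mult_integrable[OF psi locally_integrable_component[OF l(1)]]
    test_fun_mult_integrable[OF psi locally_integrable_component[OF l(3)]]
    test_fun_mult_integrable[OF psi locally_integrable_component2[OF l(2)]]
    test_fun_mult_integrable[OF psi locally_integrable_component2[OF l(4)]]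
  have e: "integral \<Omega> (\<lambda>x. u x $ i * dpsi x $ j) = - integral \<Omega> (\<lambda>x. G x $ i $ j * psi x)"
     "integral \<Omega> (\<lambda>x. v x $ i * dpsi x $ j) = - integral \<Omega> (\<lambda>x. H x $ i $ j * psi x)"
    using assms psi by (auto simp: weak_deriv_def)
  have "integral \<Omega> (\<lambda>x. (u x + v x) $ i * dpsi x $ j)
      = integral \<Omega> (\<lambda>x. u x $ i * dpsi x $ j) + integral \<Omega> (\<lambda>x. v x $ i * dpsi x $ j)"
    unfolding vector_add_component distrib_right
    by (intro Henstock_Kurzweil_Integration.integral_add set_lebesgue_integral_eq_integral(1) i)
  moreover have "integral \<Omega> (\<lambda>x. (G x + H x) $ i $ j * psi x)
      = integral \<Omega> (\<lambda>x. G x $ i $ j * psi x) + integral \<Omega> (\<lambda>x. H x $ i $ j * psi x)"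
    unfolding vector_add_component distrib_right
    by (intro Henstock_Kurzweil_Integration.integral_add set_lebesgue_integral_eq_integral(1) i)
  ultimately show "integral \<Omega> (\<lambda>x. (u x + v x) $ i * dpsi x $ j) = - integral \<Omega> (\<lambda>x. (G x + H x) $ i $ j * psi x)"
    using e by simp
qed

section \<open>Limits of test maps\<close>

lemma integral_bounded_convergence:
  fixes f :: "nat \<Rightarrow> 'a::euclidean_space \<Rightarrow> 'b::euclidean_space"
  assumes S: "S \<in> lmeasurable"
    and f: "\<And>k. f k \<in> borel_measurable lebesgue" and g: "g \<in> borel_measurable lebesgue"
    and bound: "\<And>k x. norm (f k x) \<le> B" and lim: "AE x in lebesgue. (\<lambda>k. f k x) \<longlonglongrightarrow> g x"
  shows "g absolutely_integrable_on S" "(\<lambda>k. integral S (f k)) \<longlonglongrightarrow> integral S g"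
proof -
  interpret finite_measure "lebesgue_on S" by (rule finite_measure_lebesgue_on[OF S])
  have Ss: "S \<in> sets lebesgue" using S by (rule fmeasurableD)
  have fm: "f k \<in> borel_measurable (lebesgue_on S)" for k using f by (rule measurable_restrict_space1)
  have gm: "g \<in> borel_measurable (lebesgue_on S)" using g by (rule measurable_restrict_space1)
  have lim': "AE x in lebesgue_on S. (\<lambda>k. f k x) \<longlonglongrightarrow> g x"
    using lim Ss by (auto simp: AE_restrict_space_iff elim: eventually_mono)
  have bd: "AE x in lebesgue_on S. norm (f k x) \<le> B" for k using bound by simp
  have fi: "integrable (lebesgue_on S) (f k)" for k
    by (rule integrable_dominated_convergence2[OF gm fm integrable_const lim' bd])
  have gi: "integrable (lebesgue_on S) g"
    by (rule integrable_dominated_convergence[OF gm fm integrable_const lim' bd])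
  then show "g absolutely_integrable_on S"
    using Ss unfolding set_integrable_def by (subst (asm) integrable_restrict_space) auto
  show "(\<lambda>k. integral S (f k)) \<longlonglongrightarrow> integral S g"
    using integral_dominated_convergence[OF gm fm integrable_const lim' bd] lebesgue_integral_eq_integral[OF fi Ss] lebesgue_integral_eq_integral[OF gi Ss] by simp
qed

lemma continuous_measurable_lebesgue:
  fixes f :: "'a::euclidean_space \<Rightarrow> 'b::euclidean_space"
  shows "continuous_on UNIV f \<Longrightarrow> f \<in> borel_measurable lebesgue"
  by (intro measurable_completion) (auto intro: borel_measurable_continuous_onI)

lemma test_fun_vec_continuous:
  assumes "test_fun_vec w u V"
  shows "continuous_on S u" "continuous_on S V"
proof -
  have "continuous_on S (\<lambda>x. u x $ i)" "continuous_on S (\<lambda>x. V x $ i)" for i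
    using assms C1_gradD(2,3) unfolding test_fun_vec_def test_fun_iff by blast+
  then have "continuous_on S (\<lambda>x. \<chi> i. u x $ i)" "continuous_on S (\<lambda>x. \<chi> i. V x $ i)"
    by (simp_all only: continuous_on_vec_lambda)
  then show "continuous_on S u" "continuous_on S V" by simp_all
qed

text \<open>The sequence serves twice: its integration by parts passes to the limit and identifies
  \<open>V\<close> as weak derivative, and it is itself the approximating sequence demanded by
  \<open>W11_0\<close>.\<close>

lemma W1inf_0_limit:
  fixes u :: "nat \<Rightarrow> real^2 \<Rightarrow> real^2" and U :: "nat \<Rightarrow> real^2 \<Rightarrow> real^2^2"
  assumes \<Omega>: "open \<Omega>" "bounded \<Omega>"
    and tf: "\<And>k. test_fun_vec \<Omega> (u k) (U k)"
    and bound: "\<And>k x. norm (u k x) \<le> C" "\<And>k x. norm (U k x) \<le> C"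
    and lim: "\<And>x. (\<lambda>k. u k x) \<longlonglongrightarrow> v x" "AE x in lebesgue. (\<lambda>k. U k x) \<longlonglongrightarrow> V x"
    and V: "V \<in> borel_measurable lebesgue"
  shows "weak_deriv \<Omega> v V" "W1inf_0 \<Omega> v"
proof -
  have \<Omega>m: "\<Omega> \<in> lmeasurable" using \<Omega> by (intro bounded_set_imp_lmeasurable) auto
  have um: "u k \<in> borel_measurable lebesgue" and Um: "U k \<in> borel_measurable lebesgue" for k
    using test_fun_vec_continuous[OF tf] by (auto intro: continuous_measurable_lebesgue)
  have vm: "v \<in> borel_measurable lebesgue"
    using lim(1) by (intro borel_measurable_LIMSEQ_metric[OF um]) auto
  have limu: "AE x in lebesgue. (\<lambda>k. u k x) \<longlonglongrightarrow> v x" using lim(1) by simp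
  have vi: "v absolutely_integrable_on S" if "S \<in> lmeasurable" for S
    by (rule integral_bounded_convergence(1)[OF that um vm bound(1) limu])
  have Vi: "V absolutely_integrable_on S" if "S \<in> lmeasurable" for S
    by (rule integral_bounded_convergence(1)[OF that Um V bound(2) lim(2)])
  have vC: "norm (v x) \<le> C" for x
    using LIMSEQ_le_const2[OF tendsto_norm[OF lim(1)]] bound(1) by blast
  have VC: "AE x in lebesgue. norm (V x) \<le> C"
    using lim(2)
  proof eventually_elim
    case (elim x)
    then show ?case using LIMSEQ_le_const2[OF tendsto_norm[OF elim]] bound(2) by blast
  qed
  show wd: "weak_deriv \<Omega> v V"
    unfolding weak_deriv_def
  proof (intro conjI allI impI)
    show "locally_integrable_on v \<Omega>" "locally_integrable_on V \<Omega>"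
      using vi Vi lmeasurable_compact unfolding locally_integrable_on_def by blast+
    fix psi dpsi i j assume psi: "test_fun \<Omega> psi dpsi"
    have g: "C1_grad psi dpsi" and C: "compact (closure {x. psi x \<noteq> 0})" using psi by (auto simp: test_fun_iff)
    obtain B1 where B1: "\<And>x. norm (psi x) \<le> B1"
      using continuous_compact_support_integrable(3)[OF C1_gradD(3)[OF g] C] C1_grad_zero_outside(1)[OF g] by blast
    obtain B2 where B2: "\<And>x. norm (dpsi x) \<le> B2"
      using continuous_compact_support_integrable(3)[OF C1_gradD(2)[OF g] C] C1_grad_zero_outside(2)[OF g] by blast
    have pm: "psi \<in> borel_measurable lebesgue" "(\<lambda>x. dpsi x $ j) \<in> borel_measurable lebesgue"
      by (intro continuous_measurable_lebesgue continuous_intros C1_gradD[OF g])+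
    have C0: "C \<ge> 0" using bound(1) norm_ge_zero order.trans by blast
    have comp: "(\<lambda>x. f x $ i) \<in> borel_measurable lebesgue" if "f \<in> borel_measurable lebesgue" for f :: "real^2 \<Rightarrow> 'z::euclidean_space^2" and i
      using that by (rule borel_measurable_continuous_on[rotated]) (intro continuous_intros)
    have "(\<lambda>k. integral \<Omega> (\<lambda>x. u k x $ i * dpsi x $ j)) \<longlonglongrightarrow> integral \<Omega> (\<lambda>x. v x $ i * dpsi x $ j)"
    proof (rule integral_bounded_convergence(2)[OF \<Omega>m])
      show "(\<lambda>x. u k x $ i * dpsi x $ j) \<in> borel_measurable lebesgue" for k
        by (intro borel_measurable_times comp um pm)
      show "(\<lambda>x. v x $ i * dpsi x $ j) \<in> borel_measurable lebesgue"
        by (intro borel_measurable_times comp vm pm)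
      show "norm (u k x $ i * dpsi x $ j) \<le> C * B2" for k x
        using order.trans[OF component_le_norm_cart bound(1)] order.trans[OF component_le_norm_cart B2] C0
        unfolding real_norm_def abs_mult by (intro mult_mono) auto
      show "AE x in lebesgue. (\<lambda>k. u k x $ i * dpsi x $ j) \<longlonglongrightarrow> v x $ i * dpsi x $ j"
        using limu by eventually_elim (intro tendsto_intros)
    qed
    moreover have "(\<lambda>k. integral \<Omega> (\<lambda>x. U k x $ i $ j * psi x)) \<longlonglongrightarrow> integral \<Omega> (\<lambda>x. V x $ i $ j * psi x)"
    proof (rule integral_bounded_convergence(2)[OF \<Omega>m])
      show "(\<lambda>x. U k x $ i $ j * psi x) \<in> borel_measurable lebesgue" for k
        by (intro borel_measurable_times comp Um pm)
      show "(\<lambda>x. V x $ i $ j * psi x) \<in> borel_measurable lebesgue"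
        by (intro borel_measurable_times comp V pm)
      show "norm (U k x $ i $ j * psi x) \<le> C * B1" for k x
      proof -
        have "\<bar>U k x $ i $ j\<bar> \<le> C"
          using component_le_norm_cart[of "U k x $ i" j] Finite_Cartesian_Product.norm_nth_le[of "U k x" i] bound(2)[of k x] by linarith
        then show ?thesis using B1[of x] C0 unfolding real_norm_def abs_mult by (intro mult_mono) auto
      qed
      show "AE x in lebesgue. (\<lambda>k. U k x $ i $ j * psi x) \<longlonglongrightarrow> V x $ i $ j * psi x"
        using lim(2) by eventually_elim (intro tendsto_intros)
    qed
    moreover have "integral \<Omega> (\<lambda>x. u k x $ i * dpsi x $ j) = - integral \<Omega> (\<lambda>x. U k x $ i $ j * psi x)" for k
    proof -
      have gk: "C1_grad (\<lambda>x. u k x $ i) (\<lambda>x. U k x $ i)" using tf[of k] by (simp add: test_fun_vec_def test_fun_iff)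
      show ?thesis
        using integration_by_parts_C1(1)[OF \<Omega>(1) C1_gradD(1)[OF gk] C1_gradD(2)[OF gk] psi, of "axis j 1"]
        by (simp add: inner_axis)
    qed
    ultimately have "(\<lambda>k. - integral \<Omega> (\<lambda>x. U k x $ i $ j * psi x)) \<longlonglongrightarrow> integral \<Omega> (\<lambda>x. v x $ i * dpsi x $ j)"
      "(\<lambda>k. - integral \<Omega> (\<lambda>x. U k x $ i $ j * psi x)) \<longlonglongrightarrow> - integral \<Omega> (\<lambda>x. V x $ i $ j * psi x)"
      by (auto intro: tendsto_minus)
    then show "integral \<Omega> (\<lambda>x. v x $ i * dpsi x $ j) = - integral \<Omega> (\<lambda>x. V x $ i $ j * psi x)"
      by (rule LIMSEQ_unique)
  qed
  have "(\<lambda>k. integral \<Omega> (\<lambda>x. norm (u k x - v x))) \<longlonglongrightarrow> integral \<Omega> (\<lambda>x. 0 :: real)"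
  proof (rule integral_bounded_convergence(2)[OF \<Omega>m])
    show "(\<lambda>x. norm (u k x - v x)) \<in> borel_measurable lebesgue" for k
      by (intro measurable_compose[OF _ borel_measurable_norm] borel_measurable_diff um vm)
    show "norm (norm (u k x - v x)) \<le> C + C" for k x
      using norm_triangle_ineq4[of "u k x" "v x"] bound(1)[of k x] vC[of x] by simp
    show "AE x in lebesgue. (\<lambda>k. norm (u k x - v x)) \<longlonglongrightarrow> 0"
      using limu by eventually_elim (simp add: tendsto_norm_zero_iff LIM_zero_iff)
  qed simp
  \<comment> \<open>\<open>V\<close> is bounded by \<open>C\<close> only almost everywhere, while
    the convergence lemma takes a bound valid at every point; truncating at \<open>2 * C\<close>
    changes the integrand only on a null set.\<close>
  moreover have "(\<lambda>k. integral \<Omega> (\<lambda>x. min (norm (U k x - V x)) (2 * C))) \<longlonglongrightarrow> integral \<Omega> (\<lambda>x. 0 :: real)"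
  proof (rule integral_bounded_convergence(2)[OF \<Omega>m])
    show "(\<lambda>x. min (norm (U k x - V x)) (2 * C)) \<in> borel_measurable lebesgue" for k
      by (intro borel_measurable_min measurable_compose[OF _ borel_measurable_norm] borel_measurable_diff Um V borel_measurable_const)
    show "norm (min (norm (U k x - V x)) (2 * C)) \<le> 2 * C" for k x
      using order.trans[OF norm_ge_zero bound(2)[of k x]] by simp
    show "AE x in lebesgue. (\<lambda>k. min (norm (U k x - V x)) (2 * C)) \<longlonglongrightarrow> 0"
      using lim(2)
    proof eventually_elim
      case (elim x)
      then have "(\<lambda>k. norm (U k x - V x)) \<longlonglongrightarrow> 0" by (simp add: tendsto_norm_zero_iff LIM_zero_iff)
      from tendsto_min[OF this tendsto_const[of "2 * C"]] show ?case
        using order.trans[OF norm_ge_zero bound(2)[of 0 x]] by simp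
    qed
  qed simp
  moreover have "integral \<Omega> (\<lambda>x. min (norm (U k x - V x)) (2 * C)) = integral \<Omega> (\<lambda>x. norm (U k x - V x))" for k
  proof -
    have "AE x in lebesgue. min (norm (U k x - V x)) (2 * C) = norm (U k x - V x)"
      using VC
    proof eventually_elim
      case (elim x)
      then show ?case using norm_triangle_ineq4[of "U k x" "V x"] bound(2)[of k x] by simp
    qed
    then have "negligible {x. min (norm (U k x - V x)) (2 * C) \<noteq> norm (U k x - V x)}"
      by (simp add: AE_iff_null_sets eventually_ae_filter negligible_iff_null_sets) (meson null_sets_completion_subset)
    then show ?thesis by (rule integral_spike) auto
  qed
  ultimately have "(\<lambda>k. integral \<Omega> (\<lambda>x. norm (u k x - v x)) + integral \<Omega> (\<lambda>x. norm (U k x - V x))) \<longlonglongrightarrow> 0 + 0"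
    by (intro tendsto_add) simp_all
  then have "W11_0 \<Omega> v" unfolding W11_0_def using wd vi[OF \<Omega>m] Vi[OF \<Omega>m] tf by auto
  moreover have "W1inf \<Omega> v"
    unfolding W1inf_def using wd VC vC by (intro exI[of _ V] exI[of _ C] conjI) (auto elim: eventually_mono)
  ultimately show "W1inf_0 \<Omega> v" by (simp add: W1inf_0_def)
qed

section \<open>Perturbation along rank-one segments\<close>

definition outer :: "real^2 \<Rightarrow> real^2 \<Rightarrow> real^2^2" where
  "outer a b = (\<chi> i j. a $ i * b $ j)"

lemma outer_linear:
  "outer a (b + c) = outer a b + outer a c" "outer a (t *\<^sub>R b) = t *\<^sub>R outer a b"
  by (simp_all add: outer_def vec_eq_iff algebra_simps)

lemma outer_row: "outer a b $ i = a $ i *\<^sub>R b"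
  by (simp add: outer_def vec_eq_iff)

lemma norm_outer: "norm (outer a b) = norm a * norm b"
proof -
  have "norm (outer a b $ i) = \<bar>a $ i\<bar> * norm b" for i by (simp add: outer_row)
  then have "norm (outer a b) = L2_set (\<lambda>i. \<bar>a $ i\<bar> * norm b) UNIV" unfolding norm_vec_def[of "outer a b"] by simp
  also have "\<dots> = L2_set (\<lambda>i. \<bar>a $ i\<bar>) UNIV * norm b" by (simp add: L2_set_left_distrib)
  also have "L2_set (\<lambda>i. \<bar>a $ i\<bar>) UNIV = norm a" by (simp add: norm_vec_def)
  finally show ?thesis .
qed

lemma continuous_on_outer: "continuous_on S f \<Longrightarrow> continuous_on S (\<lambda>x. outer a (f x))"
  unfolding outer_def by (intro continuous_intros)

lemma rank_one_matrix:
  fixes \<eta> :: "real^2^2"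
  assumes "det \<eta> = 0" "norm \<eta> = 1"
  obtains a n where "norm a = 1" "norm n = 1" "\<eta> = outer a n"
proof -
  have "\<exists>a n. \<eta> = outer a n"
  proof (cases "\<eta> $ 1 = 0")
    case True
    then have "\<eta> = outer (axis 2 1) (\<eta> $ 2)"
      by (auto simp: outer_def vec_eq_iff forall_2 axis_def)
    then show ?thesis by blast
  next
    case False
    have d: "\<eta> $ 1 $ 1 * \<eta> $ 2 $ 2 = \<eta> $ 1 $ 2 * \<eta> $ 2 $ 1" using assms(1) by (simp add: det_2)
    from False consider "\<eta> $ 1 $ 1 \<noteq> 0" | "\<eta> $ 1 $ 2 \<noteq> 0" by (auto simp: vec_eq_iff forall_2)
    then obtain c where c: "\<eta> $ 2 $ 1 = c * \<eta> $ 1 $ 1" "\<eta> $ 2 $ 2 = c * \<eta> $ 1 $ 2"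
    proof cases
      case 1
      then show ?thesis using d that[of "\<eta> $ 2 $ 1 / \<eta> $ 1 $ 1"] by (simp add: field_simps)
    next
      case 2
      then show ?thesis using d that[of "\<eta> $ 2 $ 2 / \<eta> $ 1 $ 2"] by (simp add: field_simps)
    qed
    have "\<eta> = outer (vector [1, c]) (\<eta> $ 1)"
      using c by (auto simp: outer_def vec_eq_iff forall_2)
    then show ?thesis by blast
  qed
  then obtain a n where an: "\<eta> = outer a n" by blast
  then have nn: "norm a * norm n = 1" using assms(2) norm_outer by metis
  then have "norm a \<noteq> 0" "norm n \<noteq> 0" by auto
  moreover have "\<eta> = outer ((1 / norm a) *\<^sub>R a) ((1 / norm n) *\<^sub>R n)"
    using nn unfolding an by (simp add: outer_def vec_eq_iff)
  ultimately show ?thesis by (intro that[of "(1 / norm a) *\<^sub>R a" "(1 / norm n) *\<^sub>R n"]) auto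
qed

lemma continuous_absolutely_integrable_on:
  fixes f :: "'a::euclidean_space \<Rightarrow> 'b::euclidean_space"
  assumes "continuous_on UNIV f" "bounded S" "S \<in> sets lebesgue"
  shows "f absolutely_integrable_on S"
proof -
  have C: "compact (closure S)" using assms(2) by simp
  then have "bounded (f ` closure S)"
    by (intro compact_imp_bounded compact_continuous_image continuous_on_subset[OF assms(1)] C subset_UNIV)
  then obtain B where "\<forall>x\<in>closure S. norm (f x) \<le> B" unfolding bounded_iff by auto
  then have B: "\<And>x. x \<in> S \<Longrightarrow> norm (f x) \<le> B" using closure_subset by blast
  show ?thesis
  proof (rule measurable_bounded_by_integrable_imp_absolutely_integrable[OF _ assms(3) _ B])
    show "f \<in> borel_measurable (lebesgue_on S)"
      by (intro continuous_imp_measurable_on_sets_lebesgue continuous_on_subset[OF assms(1)] assms(3) subset_UNIV)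
    have "S \<in> lmeasurable" using assms(2,3) bounded_set_imp_lmeasurable by blast
    then show "(\<lambda>x. B) integrable_on S" by (rule integrable_on_const)
  qed
qed

section \<open>One oscillation on a ball\<close>

definition cutoff :: "real^2 \<Rightarrow> real \<Rightarrow> real^2 \<Rightarrow> real" where
  "cutoff c \<rho> x = (max 0 (1 - (norm (x - c))\<^sup>2 / \<rho>\<^sup>2))\<^sup>2"

lemma cutoff_bounds: "0 \<le> cutoff c \<rho> x" "cutoff c \<rho> x \<le> 1"
  by (auto simp: cutoff_def intro!: power_le_one)

lemma cutoff_outside: "\<rho> > 0 \<Longrightarrow> x \<notin> ball c \<rho> \<Longrightarrow> cutoff c \<rho> x = 0"
proof -
  assume r: "\<rho> > 0" "x \<notin> ball c \<rho>"
  then have "\<rho> \<le> norm (x - c)" by (simp add: dist_norm norm_minus_commute)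
  then have "\<rho>\<^sup>2 \<le> (norm (x - c))\<^sup>2" using r(1) by (intro power_mono) auto
  then have "1 \<le> (norm (x - c))\<^sup>2 / \<rho>\<^sup>2" using r(1) by (simp add: le_divide_eq)
  then show ?thesis by (simp add: cutoff_def)
qed

lemma cutoff_inside:
  assumes "\<rho> > 0" "x \<in> ball c (\<rho> / 2)" shows "9 / 16 \<le> cutoff c \<rho> x"
proof -
  have "norm (x - c) \<le> \<rho> / 2" using assms(2) by (simp add: dist_norm norm_minus_commute)
  then have "(norm (x - c))\<^sup>2 \<le> (\<rho> / 2)\<^sup>2" by (intro power_mono) auto
  then have "(norm (x - c))\<^sup>2 / \<rho>\<^sup>2 \<le> 1 / 4" using assms(1) by (simp add: divide_le_eq power_divide)
  then have "3 / 4 \<le> max 0 (1 - (norm (x - c))\<^sup>2 / \<rho>\<^sup>2)" by linarith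
  then have "(3 / 4)\<^sup>2 \<le> cutoff c \<rho> x" unfolding cutoff_def by (rule power_mono) simp
  then show ?thesis by (simp add: power_divide)
qed

lemma C1_grad_cutoff: "\<exists>g. C1_grad (cutoff c \<rho>) g"
proof -
  have "C1_grad (\<lambda>x. 1 + (- 1 / \<rho>\<^sup>2) * (norm (x - c))\<^sup>2) (\<lambda>x. 0 + (- 1 / \<rho>\<^sup>2) *\<^sub>R (2 *\<^sub>R (x - c)))"
    by (intro C1_grad_add C1_grad_const C1_grad_cmult C1_grad_dist_square)
  from C1_grad_max_square[OF this] show ?thesis unfolding cutoff_def by auto
qed

text \<open>The phases \<open>0\<close> and \<open>pi / 2\<close> of the oscillation together have energy at least
  \<open>\<delta>\<^sup>2 cutoff\<^sup>2\<close> pointwise, so one of them carries half of it; no averaging is needed.\<close>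

lemma oscillation_on_ball:
  fixes a n c :: "real^2"
  assumes \<rho>: "\<rho> > 0" and an: "norm a = 1" "norm n = 1" and \<delta>: "\<delta> > 0" and \<epsilon>: "\<epsilon> > 0"
  obtains psi Psi where
    "\<And>w. cball c \<rho> \<subseteq> w \<Longrightarrow> test_fun_vec w psi Psi"
    "\<And>x. x \<notin> ball c \<rho> \<Longrightarrow> psi x = 0" "\<And>x. x \<notin> ball c \<rho> \<Longrightarrow> Psi x = 0"
    "\<And>x. norm (psi x) \<le> \<epsilon>"
    "\<And>x. \<exists>t. \<bar>t\<bar> \<le> \<delta> \<and> norm (Psi x - t *\<^sub>R outer a n) \<le> \<epsilon>"
    "continuous_on UNIV Psi"
    "integral (ball c \<rho>) (\<lambda>x. (norm (Psi x))\<^sup>2) \<ge> \<delta>\<^sup>2 / 32 * measure lebesgue (ball c \<rho>)"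
proof -
  obtain g where g: "C1_grad (cutoff c \<rho>) g" using C1_grad_cutoff by blast
  have supp: "closure {x. cutoff c \<rho> x \<noteq> 0} \<subseteq> cball c \<rho>"
    using cutoff_outside[OF \<rho>] ball_subset_cball by (intro closure_minimal) blast+
  \<comment> \<open>Outside the open ball, its boundary included, the cut-off attains its minimum 0,
    so its gradient vanishes.\<close>
  have g0: "g x = 0" if "x \<notin> ball c \<rho>" for x
  proof -
    have "cutoff c \<rho> x = 0" using cutoff_outside[OF \<rho> that] .
    moreover have "\<And>y. cutoff c \<rho> x \<le> cutoff c \<rho> y" using calculation cutoff_bounds(1) by simp
    ultimately have "(\<lambda>h. g x \<bullet> h) = (\<lambda>h. 0)"
      by (intro differential_zero_maxmin[of x UNIV "cutoff c \<rho>"] C1_gradD(1)[OF g]) auto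
    then show ?thesis by (metis inner_eq_zero_iff)
  qed
  obtain L where L: "\<And>x. norm (g x) \<le> L"
    using continuous_compact_support_integrable(3)[OF C1_gradD(2)[OF g] compact_cball[of c \<rho>]] g0 ball_subset_cball by blast
  have L0: "L \<ge> 0" using L[of c] norm_ge_zero order.trans by blast
  \<comment> \<open>The frequency makes the amplitude \<open>\<delta> / N\<close> equal to
    \<open>\<epsilon> / (L + 1)\<close>, which is at most \<epsilon> by itself and also after
    multiplication by the bound \<open>L\<close> for the gradient of the cut-off. The derivative
    along \<open>n\<close> keeps size \<delta>.\<close>
  define N where "N = \<delta> * (L + 1) / \<epsilon>"
  have N: "N > 0" using \<delta> \<epsilon> L0 by (simp add: N_def)
  have \<delta>N: "\<delta> / N = \<epsilon> / (L + 1)" using \<delta> \<epsilon> L0 by (simp add: N_def)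
  have small: "\<delta> / N \<le> \<epsilon>" "\<delta> / N * L \<le> \<epsilon>" unfolding \<delta>N using \<epsilon> L0 by (auto simp: divide_le_eq mult_left_mono algebra_simps)
  have \<delta>N0: "\<delta> / N > 0" using \<delta> N by simp
  define th where "th p x = N * (n \<bullet> x) + p" for p x
  define s where "s p x = \<delta> / N * sin (th p x) * cutoff c \<rho> x" for p x
  define ds where "ds p x = (\<delta> / N * sin (th p x)) *\<^sub>R g x + cutoff c \<rho> x *\<^sub>R ((\<delta> * cos (th p x)) *\<^sub>R n)" for p x
  have C1s: "C1_grad (s p) (ds p)" for p
  proof -
    have "C1_grad (\<lambda>x. \<delta> / N * sin (N * (n \<bullet> x) + p)) (\<lambda>x. (\<delta> * cos (N * (n \<bullet> x) + p)) *\<^sub>R n)"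
    proof (rule C1_grad_compose[of "\<lambda>x. n \<bullet> x" "\<lambda>_. n" "\<lambda>r. \<delta> / N * sin (N * r + p)" "\<lambda>r. \<delta> * cos (N * r + p)"])
      show "C1_grad (\<lambda>x. n \<bullet> x) (\<lambda>_. n)" by (rule C1_grad_inner)
      show "((\<lambda>r. \<delta> / N * sin (N * r + p)) has_real_derivative \<delta> * cos (N * (n \<bullet> x) + p)) (at (n \<bullet> x))" for x
        using N by (auto intro!: derivative_eq_intros)
      show "continuous_on (range ((\<bullet>) n)) (\<lambda>r. \<delta> * cos (N * r + p))"
        by (intro continuous_intros)
    qed
    from C1_grad_mult[OF this g] show ?thesis unfolding s_def ds_def th_def .
  qed
  have zero: "s p x = 0" "ds p x = 0" if "x \<notin> ball c \<rho>" for p x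
    using cutoff_outside[OF \<rho> that] g0[OF that] by (simp_all add: s_def ds_def)
  let ?I = "\<lambda>p. integral (ball c \<rho>) (\<lambda>x. (norm (ds p x))\<^sup>2)"
  have int_ds: "(\<lambda>x. (norm (ds p x))\<^sup>2) integrable_on ball c \<rho>" for p
    by (intro set_lebesgue_integral_eq_integral(1) continuous_absolutely_integrable_on continuous_intros C1_gradD(2)[OF C1s]) auto
  \<comment> \<open>A shift by \<open>pi / 2\<close> turns (sin, cos) into (cos, - sin): the mixed
    terms of the two squares cancel and the remaining ones add up to full squares.\<close>
  have sum: "(norm (ds 0 x))\<^sup>2 + (norm (ds (pi / 2) x))\<^sup>2 \<ge> \<delta>\<^sup>2 * (cutoff c \<rho> x)\<^sup>2" for x
  proof -
    let ?A = "cutoff c \<rho> x * \<delta>" and ?B = "\<delta> / N" and ?t = "th 0 x"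
    have nn: "n \<bullet> n = 1" using an(2) by (simp add: norm_eq_1)
    have e: "th (pi / 2) x = ?t + pi / 2" by (simp add: th_def)
    have sc: "sin (th (pi / 2) x) = cos ?t" "cos (th (pi / 2) x) = - sin ?t"
      unfolding e by (simp_all add: sin_add cos_add)
    have 1: "(norm (ds 0 x))\<^sup>2 = (?B * sin ?t)\<^sup>2 * (g x \<bullet> g x) + 2 * (?B * sin ?t) * (?A * cos ?t) * (g x \<bullet> n) + (?A * cos ?t)\<^sup>2"
      unfolding power2_norm_eq_inner ds_def using nn
      by (simp add: inner_add_left inner_add_right inner_commute[of n "g x"] power2_eq_square algebra_simps)
    have 2: "(norm (ds (pi / 2) x))\<^sup>2 = (?B * cos ?t)\<^sup>2 * (g x \<bullet> g x) - 2 * (?B * sin ?t) * (?A * cos ?t) * (g x \<bullet> n) + (?A * sin ?t)\<^sup>2"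
      unfolding power2_norm_eq_inner ds_def sc using nn
      by (simp add: inner_add_left inner_add_right inner_commute[of n "g x"] power2_eq_square algebra_simps)
    have "(norm (ds 0 x))\<^sup>2 + (norm (ds (pi / 2) x))\<^sup>2
        = ?B\<^sup>2 * (g x \<bullet> g x) * ((sin ?t)\<^sup>2 + (cos ?t)\<^sup>2) + ?A\<^sup>2 * ((sin ?t)\<^sup>2 + (cos ?t)\<^sup>2)"
      unfolding 1 2 power_mult_distrib by (simp only: algebra_simps)
    also have "\<dots> = ?B\<^sup>2 * (g x \<bullet> g x) + ?A\<^sup>2" by simp
    also have "\<dots> \<ge> ?A\<^sup>2" by simp
    finally show ?thesis by (simp add: power_mult_distrib mult.commute)
  qed
  \<comment> \<open>On the ball of half the radius the cut-off is at least 9/16, and in the plane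
    this ball has a quarter of the area; 81/256 divided by 4 exceeds 1/16.\<close>
  have "?I 0 + ?I (pi / 2) \<ge> \<delta>\<^sup>2 / 16 * measure lebesgue (ball c \<rho>)"
  proof -
    have half: "measure lebesgue (ball c (\<rho> / 2)) = measure lebesgue (ball c \<rho>) / 4"
      using \<rho> by (simp add: content_ball power_divide)
    have "\<delta>\<^sup>2 / 16 * measure lebesgue (ball c \<rho>) \<le> \<delta>\<^sup>2 * (81 / 256) * measure lebesgue (ball c (\<rho> / 2))"
      unfolding half using mult_nonneg_nonneg[of "\<delta>\<^sup>2" "measure lebesgue (ball c \<rho>)"] by (simp add: field_simps)
    also have "\<dots> = integral (ball c (\<rho> / 2)) (\<lambda>x. \<delta>\<^sup>2 * (81 / 256))"
      using integral_mult_right[of "ball c (\<rho> / 2)" "\<delta>\<^sup>2 * (81 / 256)" "\<lambda>x. 1"]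
      by (simp only: lmeasure_integral[OF lmeasurable_ball] mult_1_right)
    also have "\<dots> \<le> integral (ball c (\<rho> / 2)) (\<lambda>x. (norm (ds 0 x))\<^sup>2 + (norm (ds (pi / 2) x))\<^sup>2)"
    proof (rule integral_le)
      show "(\<lambda>x. \<delta>\<^sup>2 * (81 / 256)) integrable_on ball c (\<rho> / 2)" by (intro integrable_on_const) simp
      show "(\<lambda>x. (norm (ds 0 x))\<^sup>2 + (norm (ds (pi / 2) x))\<^sup>2) integrable_on ball c (\<rho> / 2)"
        by (intro set_lebesgue_integral_eq_integral(1) continuous_absolutely_integrable_on continuous_intros C1_gradD(2)[OF C1s]) auto
      fix x assume "x \<in> ball c (\<rho> / 2)"
      then have "(9 / 16)\<^sup>2 \<le> (cutoff c \<rho> x)\<^sup>2" using cutoff_inside[OF \<rho>] by (intro power_mono) auto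
      then have "\<delta>\<^sup>2 * (81 / 256) \<le> \<delta>\<^sup>2 * (cutoff c \<rho> x)\<^sup>2" by (intro mult_left_mono) (simp_all add: power_divide)
      then show "\<delta>\<^sup>2 * (81 / 256) \<le> (norm (ds 0 x))\<^sup>2 + (norm (ds (pi / 2) x))\<^sup>2" using sum[of x] by linarith
    qed
    also have "\<dots> \<le> integral (ball c \<rho>) (\<lambda>x. (norm (ds 0 x))\<^sup>2 + (norm (ds (pi / 2) x))\<^sup>2)"
    proof (rule integral_subset_le)
      show "ball c (\<rho> / 2) \<subseteq> ball c \<rho>" using \<rho> by auto
      show "\<forall>x\<in>ball c \<rho>. 0 \<le> (norm (ds 0 x))\<^sup>2 + (norm (ds (pi / 2) x))\<^sup>2" by simp
    qed (intro set_lebesgue_integral_eq_integral(1) continuous_absolutely_integrable_on continuous_intros C1_gradD(2)[OF C1s]; simp)+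
    also have "\<dots> = ?I 0 + ?I (pi / 2)" by (intro Henstock_Kurzweil_Integration.integral_add int_ds)
    finally show ?thesis .
  qed
  then have "?I 0 \<ge> \<delta>\<^sup>2 / 32 * measure lebesgue (ball c \<rho>) \<or> ?I (pi / 2) \<ge> \<delta>\<^sup>2 / 32 * measure lebesgue (ball c \<rho>)"
    by linarith
  then obtain p where p: "?I p \<ge> \<delta>\<^sup>2 / 32 * measure lebesgue (ball c \<rho>)" by blast
  show ?thesis
  proof (rule that[of "\<lambda>x. s p x *\<^sub>R a" "\<lambda>x. outer a (ds p x)"])
    show "test_fun_vec w (\<lambda>x. s p x *\<^sub>R a) (\<lambda>x. outer a (ds p x))" if w: "cball c \<rho> \<subseteq> w" for w
      unfolding test_fun_vec_def
    proof
      fix i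
      have eq: "(s p x *\<^sub>R a) $ i = a $ i * s p x" "outer a (ds p x) $ i = a $ i *\<^sub>R ds p x" for x
        by (simp_all add: outer_row)
      have "closure {x. a $ i * s p x \<noteq> 0} \<subseteq> cball c \<rho>"
        using zero(1) ball_subset_cball by (intro closure_minimal) force+
      moreover from this have "compact (closure {x. a $ i * s p x \<noteq> 0})"
        by (metis bounded_cball bounded_subset closed_closure compact_eq_bounded_closed)
      ultimately show "test_fun w (\<lambda>x. (s p x *\<^sub>R a) $ i) (\<lambda>x. outer a (ds p x) $ i)"
        unfolding test_fun_iff eq using C1_grad_cmult[OF C1s] w by blast
    qed
    show "s p x *\<^sub>R a = 0" "outer a (ds p x) = 0" if "x \<notin> ball c \<rho>" for x
      using zero[OF that] by (simp_all add: outer_def vec_eq_iff)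
    show "norm (s p x *\<^sub>R a) \<le> \<epsilon>" for x
    proof -
      have "\<bar>s p x\<bar> = \<delta> / N * (\<bar>sin (th p x)\<bar> * cutoff c \<rho> x)"
        using \<delta> N cutoff_bounds by (simp add: s_def abs_mult)
      also have "\<dots> \<le> \<delta> / N * 1"
        using \<delta>N0 cutoff_bounds by (intro mult_left_mono mult_le_one) auto
      finally show ?thesis using small(1) an by simp
    qed
    show "\<exists>t. \<bar>t\<bar> \<le> \<delta> \<and> norm (outer a (ds p x) - t *\<^sub>R outer a n) \<le> \<epsilon>" for x
    proof (intro exI conjI)
      let ?t = "cutoff c \<rho> x * (\<delta> * cos (th p x))"
      have "\<bar>?t\<bar> = \<delta> * (cutoff c \<rho> x * \<bar>cos (th p x)\<bar>)" using \<delta> cutoff_bounds by (simp add: abs_mult)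
      also have "\<dots> \<le> \<delta> * 1" using \<delta> cutoff_bounds by (intro mult_left_mono mult_le_one) auto
      finally show "\<bar>?t\<bar> \<le> \<delta>" by simp
      have "outer a (ds p x) - ?t *\<^sub>R outer a n = outer a ((\<delta> / N * sin (th p x)) *\<^sub>R g x)"
        unfolding ds_def outer_linear by simp
      then have "norm (outer a (ds p x) - ?t *\<^sub>R outer a n) = \<delta> / N * (\<bar>sin (th p x)\<bar> * norm (g x))"
        using \<delta> N an by (simp add: norm_outer abs_mult)
      also have "\<dots> \<le> \<delta> / N * (1 * L)"
        using \<delta>N0 L by (intro mult_left_mono mult_mono) auto
      finally show "norm (outer a (ds p x) - ?t *\<^sub>R outer a n) \<le> \<epsilon>" using small(2) by simp
    qed
    show "continuous_on UNIV (\<lambda>x. outer a (ds p x))"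
      by (intro continuous_on_outer C1_gradD(2)[OF C1s])
    show "integral (ball c \<rho>) (\<lambda>x. (norm (outer a (ds p x)))\<^sup>2) \<ge> \<delta>\<^sup>2 / 32 * measure lebesgue (ball c \<rho>)"
      using p an by (simp add: norm_outer)
  qed
qed

section \<open>Perturbation on one ball and on an open set\<close>

lemma rank_one_segment_nbhd:
  assumes "open V" "rank_one_segment V \<delta> xi"
  obtains a n r where "norm a = 1" "norm n = 1" "r > 0"
    "\<And>t eta. \<bar>t\<bar> \<le> \<delta> \<Longrightarrow> norm (eta - (xi + t *\<^sub>R outer a n)) < r \<Longrightarrow> eta \<in> V"
proof -
  obtain \<eta> where \<eta>: "det \<eta> = 0" "norm \<eta> = 1" "\<And>t. \<bar>t\<bar> \<le> \<delta> \<Longrightarrow> xi + t *\<^sub>R \<eta> \<in> V"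
    using assms(2) unfolding rank_one_segment_def by blast
  obtain a n where an: "norm a = 1" "norm n = 1" "\<eta> = outer a n" using rank_one_matrix[OF \<eta>(1,2)] .
  let ?A = "(\<lambda>t. xi + t *\<^sub>R \<eta>) ` {-\<delta>..\<delta>}"
  have "compact ?A" by (intro compact_continuous_image continuous_intros compact_Icc)
  moreover have "?A \<subseteq> V" using \<eta>(3) by (auto simp: abs_le_iff)
  ultimately obtain r where r: "r > 0" "(\<Union>x\<in>?A. ball x r) \<subseteq> V"
    using compact_subset_open_imp_ball_epsilon_subset[OF _ assms(1)] by blast
  show ?thesis
  proof (rule that[OF an(1,2) r(1)])
    fix t eta assume t: "\<bar>t\<bar> \<le> \<delta>" and e: "norm (eta - (xi + t *\<^sub>R outer a n)) < r"
    have "eta \<in> ball (xi + t *\<^sub>R \<eta>) r" using e an(3) by (simp add: dist_norm norm_minus_commute)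
    moreover have "t \<in> {-\<delta>..\<delta>}" using t by (auto simp: abs_le_iff)
    ultimately show "eta \<in> V" using r(2) by blast
  qed
qed

text \<open>A compact segment has a tube of radius \<open>r\<close> inside \<open>V\<close>, and the
  tube contains the parallel segments of the same length through all matrices closer than
  \<open>r\<close>. Openness makes the set of usable points measurable and lets each of its points
  be a centre in the covering argument.\<close>

lemma open_rank_one_segment:
  assumes "open V" shows "open {xi. rank_one_segment V \<delta> xi}"
proof (rule openI)
  fix xi assume "xi \<in> {xi. rank_one_segment V \<delta> xi}"
  then have seg: "rank_one_segment V \<delta> xi" by simp
  obtain a n r where r: "norm a = 1" "norm n = 1" "r > 0"
    "\<And>t eta. \<bar>t\<bar> \<le> \<delta> \<Longrightarrow> norm (eta - (xi + t *\<^sub>R outer a n)) < r \<Longrightarrow> eta \<in> V"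
    using rank_one_segment_nbhd[OF assms seg] by blast
  have "rank_one_segment V \<delta> eta" if "eta \<in> ball xi r" for eta
    unfolding rank_one_segment_def
  proof (intro exI conjI allI impI)
    show "det (outer a n) = 0" by (simp add: det_2 outer_def)
    show "norm (outer a n) = 1" using r by (simp add: norm_outer)
    fix t assume "\<bar>t\<bar> \<le> \<delta>"
    then show "eta + t *\<^sub>R outer a n \<in> V"
      using that r(4)[of t "eta + t *\<^sub>R outer a n"] by (simp add: dist_norm norm_minus_commute)
  qed
  then show "\<exists>T>0. ball xi T \<subseteq> {xi. rank_one_segment V \<delta> xi}" using r(3) by blast
qed

lemma integral_eq_on_support:
  fixes h :: "'a::euclidean_space \<Rightarrow> 'b::euclidean_space"
  assumes "T \<subseteq> S" "\<And>x. x \<notin> T \<Longrightarrow> h x = 0"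
  shows "integral S h = integral T h"
proof -
  have "(\<lambda>x. if x \<in> S then h x else 0) = (\<lambda>x. if x \<in> T then h x else 0)"
    using assms by (auto simp: fun_eq_iff)
  then show ?thesis
    using Henstock_Kurzweil_Integration.integral_restrict_UNIV[of S h]
      Henstock_Kurzweil_Integration.integral_restrict_UNIV[of T h] by simp
qed

lemma test_fun_vec_mono: "test_fun_vec w u V \<Longrightarrow> w \<subseteq> \<Omega> \<Longrightarrow> test_fun_vec \<Omega> u V"
  unfolding test_fun_vec_def using test_fun_mono by blast

text \<open>Constants are orthogonal to gradients of compactly supported maps; on a ball where a
  field is nearly constant, only its deviation from the constant is felt by the oscillation.\<close>

lemma test_fun_vec_integral_0:
  assumes "test_fun_vec w u V"
  shows "integral w (\<lambda>x. A \<bullet> V x) = 0"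
proof -
  have tf: "test_fun w (\<lambda>x. u x $ i) (\<lambda>x. V x $ i)" for i using assms by (simp add: test_fun_vec_def)
  have V0: "V x $ i = 0" if "x \<notin> w" for x i using test_fun_zero_outside(2)[OF tf that] .
  have int: "(\<lambda>x. V x $ i \<bullet> A $ i) integrable_on UNIV" for i
  proof -
    let ?C = "closure {x. u x $ i \<noteq> 0}"
    have g: "C1_grad (\<lambda>x. u x $ i) (\<lambda>x. V x $ i)" and C: "compact ?C" using tf[of i] by (auto simp: test_fun_iff)
    show ?thesis
    proof (intro set_lebesgue_integral_eq_integral(1) continuous_compact_support_integrable(2)[OF _ C])
      show "continuous_on UNIV (\<lambda>x. V x $ i \<bullet> A $ i)" by (intro continuous_intros C1_gradD(2)[OF g])
      show "V x $ i \<bullet> A $ i = 0" if "x \<notin> ?C" for x using C1_grad_zero_outside(2)[OF g that] by simp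
    qed
  qed
  have "integral w (\<lambda>x. A \<bullet> V x) = integral UNIV (\<lambda>x. A \<bullet> V x)"
    by (rule integral_eq_on_support[symmetric]) (auto simp: inner_vec_def[of A] V0)
  also have "\<dots> = integral UNIV (\<lambda>x. \<Sum>i\<in>UNIV. V x $ i \<bullet> A $ i)"
    by (simp only: inner_vec_def[of A] inner_commute[of "A $ _"])
  also have "\<dots> = (\<Sum>i\<in>UNIV. integral UNIV (\<lambda>x. V x $ i \<bullet> A $ i))"
    by (rule integral_sum) (auto simp: int)
  also have "\<dots> = 0"
  proof (intro sum.neutral ballI)
    fix i
    show "integral UNIV (\<lambda>x. V x $ i \<bullet> A $ i) = 0"
      using tf[of i] unfolding test_fun_iff by (intro integral_C1_grad_0[of "\<lambda>x. u x $ i" _ "closure {x. u x $ i \<noteq> 0}"]) auto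
  qed
  finally show ?thesis .
qed

lemma test_fun_add:
  assumes "test_fun w f df" "test_fun w g dg"
  shows "test_fun w (\<lambda>x. f x + g x) (\<lambda>x. df x + dg x)"
proof -
  let ?A = "closure {x. f x \<noteq> 0} \<union> closure {x. g x \<noteq> 0}"
  have A: "compact ?A" "?A \<subseteq> w" using assms by (auto simp: test_fun_iff)
  have sub: "closure {x. f x + g x \<noteq> 0} \<subseteq> ?A"
    unfolding closure_Un[symmetric] by (intro closure_mono) auto
  then have "compact (closure {x. f x + g x \<noteq> 0})"
    using A(1) by (meson bounded_subset closed_closure compact_eq_bounded_closed)
  then show ?thesis using assms sub A(2) C1_grad_add unfolding test_fun_iff by blast
qed

lemma test_fun_vec_add:
  assumes "test_fun_vec w f df" "test_fun_vec w g dg"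
  shows "test_fun_vec w (\<lambda>x. f x + g x) (\<lambda>x. df x + dg x)"
  using assms test_fun_add unfolding test_fun_vec_def vector_add_component by blast

lemma test_fun_vec_0: "test_fun_vec w (\<lambda>_. 0) (\<lambda>_. 0)"
  by (simp add: test_fun_vec_def test_fun_iff C1_grad_const)

lemma test_fun_vec_sum:
  assumes "finite I" "\<And>i. i \<in> I \<Longrightarrow> test_fun_vec w (f i) (df i)"
  shows "test_fun_vec w (\<lambda>x. \<Sum>i\<in>I. f i x) (\<lambda>x. \<Sum>i\<in>I. df i x)"
  using assms by (induction I rule: finite_induct) (auto intro: test_fun_vec_0 test_fun_vec_add)

lemma local_perturbation:
  fixes F :: "real^2 \<Rightarrow> real^2^2"
  assumes O: "open O'" and V: "open V" and F: "continuous_on O' F"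
    and Fs: "finite Fs" "\<And>f. f \<in> Fs \<Longrightarrow> continuous_on O' f"
    and \<delta>: "0 < \<delta>" "\<delta> \<le> 1" and \<epsilon>: "0 < \<epsilon>" "\<epsilon> \<le> 1"
    and c: "c \<in> O'" "rank_one_segment V \<delta> (F c)"
  shows "\<exists>d>0. cball c d \<subseteq> O' \<and> (\<forall>\<rho>. 0 < \<rho> \<and> \<rho> \<le> d \<longrightarrow> (\<exists>w W. test_fun_vec O' w W \<and> continuous_on UNIV W \<and>
      (\<forall>x. x \<notin> ball c \<rho> \<longrightarrow> w x = 0 \<and> W x = 0) \<and> (\<forall>x. norm (w x) \<le> \<epsilon>) \<and>
      (\<forall>x\<in>ball c \<rho>. F x + W x \<in> V) \<and>
      (\<forall>f\<in>Fs. \<bar>integral O' (\<lambda>x. f x \<bullet> W x)\<bar> \<le> \<epsilon> * measure lebesgue (ball c \<rho>)) \<and>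
      \<delta>\<^sup>2 / 32 * measure lebesgue (ball c \<rho>) \<le> integral O' (\<lambda>x. (norm (W x))\<^sup>2)))"
proof -
  obtain a n r where an: "norm a = 1" "norm n = 1" and r: "r > 0"
    "\<And>t eta. \<bar>t\<bar> \<le> \<delta> \<Longrightarrow> norm (eta - (F c + t *\<^sub>R outer a n)) < r \<Longrightarrow> eta \<in> V"
    using rank_one_segment_nbhd[OF V c(2)] by blast
  \<comment> \<open>Half of \<open>r\<close> is reserved for the variation of \<open>F\<close>, the
    other half for the distance of \<open>W\<close> from the segment. The bound
    \<open>\<epsilon> / 2\<close> compensates for \<open>norm (W x) \<le> 2\<close>.\<close>
  define e where "e = min (r / 2) (\<epsilon> / 2)"
  have e: "e > 0" "e \<le> r / 2" "e \<le> \<epsilon> / 2" using r \<epsilon> by (auto simp: e_def)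
  have near: "eventually (\<lambda>x. norm (f x - f c) < e) (nhds c)" if "continuous_on O' f" for f :: "real^2 \<Rightarrow> real^2^2"
  proof -
    have "isCont f c" using that O c(1) by (simp add: continuous_on_eq_continuous_at)
    then have "(f \<longlongrightarrow> f c) (nhds c)" by (simp add: isCont_def tendsto_at_iff_tendsto_nhds)
    from tendstoD[OF this e(1)] show ?thesis by (simp add: dist_norm)
  qed
  have "eventually (\<lambda>x. \<forall>f\<in>insert F Fs. norm (f x - f c) < e) (nhds c)"
    using Fs F near by (subst eventually_ball_finite_distrib) auto
  moreover have "eventually (\<lambda>x. x \<in> O') (nhds c)" using O c(1) by (rule eventually_nhds_in_open)
  ultimately have "eventually (\<lambda>x. x \<in> O' \<and> (\<forall>f\<in>insert F Fs. norm (f x - f c) < e)) (nhds c)"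
    by eventually_elim auto
  then obtain d' where d': "d' > 0" "\<And>x. dist x c < d' \<Longrightarrow> x \<in> O' \<and> (\<forall>f\<in>insert F Fs. norm (f x - f c) < e)"
    unfolding eventually_nhds_metric by blast
  define d where "d = d' / 2"
  have d: "d > 0" "\<And>x. x \<in> cball c d \<Longrightarrow> x \<in> O' \<and> (\<forall>f\<in>insert F Fs. norm (f x - f c) < e)"
    using d' by (auto simp: d_def dist_commute)
  show ?thesis
  proof (intro exI[of _ d] conjI d(1) allI impI)
    show "cball c d \<subseteq> O'" using d(2) by blast
    fix \<rho> assume \<rho>: "0 < \<rho> \<and> \<rho> \<le> d"
    then have cb: "cball c \<rho> \<subseteq> cball c d" by auto
    then have cbO: "cball c \<rho> \<subseteq> O'" using d(2) by blast
    have ball: "ball c \<rho> \<subseteq> cball c d" "ball c \<rho> \<subseteq> O'" using cb cbO ball_subset_cball by blast+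
    obtain w W where w: "\<And>w'. cball c \<rho> \<subseteq> w' \<Longrightarrow> test_fun_vec w' w W"
      "\<And>x. x \<notin> ball c \<rho> \<Longrightarrow> w x = 0" "\<And>x. x \<notin> ball c \<rho> \<Longrightarrow> W x = 0"
      "\<And>x. norm (w x) \<le> e"
      "\<And>x. \<exists>t. \<bar>t\<bar> \<le> \<delta> \<and> norm (W x - t *\<^sub>R outer a n) \<le> e"
      and cW: "continuous_on UNIV W"
      and en: "integral (ball c \<rho>) (\<lambda>x. (norm (W x))\<^sup>2) \<ge> \<delta>\<^sup>2 / 32 * measure lebesgue (ball c \<rho>)"
      using oscillation_on_ball[OF _ an \<delta>(1) e(1), of \<rho> c] \<rho> by blast
    have tf: "test_fun_vec O' w W" using w(1) cbO by blast
    have W2: "norm (W x) \<le> 2" for x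
    proof -
      obtain t where t: "\<bar>t\<bar> \<le> \<delta>" "norm (W x - t *\<^sub>R outer a n) \<le> e" using w(5) by blast
      have "norm (W x) \<le> norm (W x - t *\<^sub>R outer a n) + norm (t *\<^sub>R outer a n)"
        using norm_triangle_ineq[of "W x - t *\<^sub>R outer a n" "t *\<^sub>R outer a n"] by simp
      also have "\<dots> \<le> e + 1" using t \<delta> an by (simp add: norm_outer)
      finally show ?thesis using e \<epsilon> by linarith
    qed
    have inV: "F x + W x \<in> V" if x: "x \<in> ball c \<rho>" for x
    proof -
      obtain t where t: "\<bar>t\<bar> \<le> \<delta>" "norm (W x - t *\<^sub>R outer a n) \<le> e" using w(5) by blast
      have "norm (F x - F c) < e" using d(2) x ball by blast
      moreover have "norm (F x + W x - (F c + t *\<^sub>R outer a n)) \<le> norm (F x - F c) + norm (W x - t *\<^sub>R outer a n)"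
        using norm_triangle_ineq[of "F x - F c" "W x - t *\<^sub>R outer a n"] by (simp add: algebra_simps)
      ultimately show ?thesis using t e by (intro r(2)[OF t(1)]) linarith
    qed
    have orth: "\<bar>integral O' (\<lambda>x. f x \<bullet> W x)\<bar> \<le> \<epsilon> * measure lebesgue (ball c \<rho>)" if f: "f \<in> Fs" for f
    proof -
      have i: "(\<lambda>x. h x \<bullet> W x) absolutely_integrable_on O'" if "continuous_on O' h" for h :: "real^2 \<Rightarrow> real^2^2"
      proof (rule absolutely_integrable_on_compact_support[OF O compact_cball cbO])
        show "continuous_on O' (\<lambda>x. h x \<bullet> W x)" by (intro continuous_intros that continuous_on_subset[OF cW] subset_UNIV)
        show "h x \<bullet> W x = 0" if "x \<in> O' - cball c \<rho>" for x
          using w(3)[of x] that ball_subset_cball by auto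
      qed
      have i1: "(\<lambda>x. (f x - f c) \<bullet> W x) absolutely_integrable_on O'"
        by (intro i continuous_intros Fs(2) f)
      have "integral O' (\<lambda>x. f x \<bullet> W x) = integral O' (\<lambda>x. (f x - f c) \<bullet> W x + f c \<bullet> W x)"
        by (simp add: inner_diff_left)
      also have "\<dots> = integral O' (\<lambda>x. (f x - f c) \<bullet> W x) + integral O' (\<lambda>x. f c \<bullet> W x)"
        by (intro Henstock_Kurzweil_Integration.integral_add set_lebesgue_integral_eq_integral(1) i1 i continuous_intros)
      also have "\<dots> = integral O' (\<lambda>x. (f x - f c) \<bullet> W x)"
        using test_fun_vec_integral_0[OF tf] by simp
      also have "\<dots> = integral (ball c \<rho>) (\<lambda>x. (f x - f c) \<bullet> W x)"
        by (rule integral_eq_on_support[OF ball(2)]) (simp add: w(3))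
      finally have eq: "integral O' (\<lambda>x. f x \<bullet> W x) = integral (ball c \<rho>) (\<lambda>x. (f x - f c) \<bullet> W x)" .
      have "norm (integral (ball c \<rho>) (\<lambda>x. (f x - f c) \<bullet> W x)) \<le> integral (ball c \<rho>) (\<lambda>x. \<epsilon> * 1)"
      proof (rule Henstock_Kurzweil_Integration.integral_norm_bound_integral)
        have "(\<lambda>x. (f x - f c) \<bullet> W x) absolutely_integrable_on ball c \<rho>"
          by (rule set_integrable_subset[OF i1]) (use ball in auto)
        then show "(\<lambda>x. (f x - f c) \<bullet> W x) integrable_on ball c \<rho>"
          by (rule set_lebesgue_integral_eq_integral(1))
        show "(\<lambda>x. \<epsilon> * 1) integrable_on ball c \<rho>" by (intro integrable_on_const lmeasurable_ball)
        fix x assume "x \<in> ball c \<rho>"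
        then have "norm (f x - f c) < e" using d(2) ball f by blast
        have "norm ((f x - f c) \<bullet> W x) \<le> norm (f x - f c) * norm (W x)"
          by (simp add: Cauchy_Schwarz_ineq2)
        also have "\<dots> \<le> e * 2" using \<open>norm (f x - f c) < e\<close> W2 by (intro mult_mono) (use e in auto)
        finally show "norm ((f x - f c) \<bullet> W x) \<le> \<epsilon> * 1" using e by linarith
      qed
      also have "\<dots> = \<epsilon> * measure lebesgue (ball c \<rho>)"
        using integral_mult_right[of "ball c \<rho>" \<epsilon> "\<lambda>x. 1"] by (simp only: lmeasure_integral[OF lmeasurable_ball])
      finally show ?thesis unfolding eq by simp
    qed
    have "integral O' (\<lambda>x. (norm (W x))\<^sup>2) = integral (ball c \<rho>) (\<lambda>x. (norm (W x))\<^sup>2)"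
      by (rule integral_eq_on_support[OF ball(2)]) (simp add: w(3))
    then have en': "\<delta>\<^sup>2 / 32 * measure lebesgue (ball c \<rho>) \<le> integral O' (\<lambda>x. (norm (W x))\<^sup>2)" using en by simp
    have "norm (w x) \<le> \<epsilon>" for x using w(4)[of x] e \<epsilon> by linarith
    then show "\<exists>w W. test_fun_vec O' w W \<and> continuous_on UNIV W \<and>
      (\<forall>x. x \<notin> ball c \<rho> \<longrightarrow> w x = 0 \<and> W x = 0) \<and> (\<forall>x. norm (w x) \<le> \<epsilon>) \<and>
      (\<forall>x\<in>ball c \<rho>. F x + W x \<in> V) \<and>
      (\<forall>f\<in>Fs. \<bar>integral O' (\<lambda>x. f x \<bullet> W x)\<bar> \<le> \<epsilon> * measure lebesgue (ball c \<rho>)) \<and>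
      \<delta>\<^sup>2 / 32 * measure lebesgue (ball c \<rho>) \<le> integral O' (\<lambda>x. (norm (W x))\<^sup>2)"
      using tf cW w(2,3) inV orth en' by (intro exI[of _ w] exI[of _ W]) blast
  qed
qed

lemma test_fun_vec_inner_integrable:
  assumes w: "open w" "continuous_on w f" and tf: "test_fun_vec w u V"
  shows "(\<lambda>x. f x \<bullet> V x) absolutely_integrable_on w"
proof -
  let ?C = "\<Union>i. closure {x. u x $ i \<noteq> 0}"
  have C: "compact ?C" "?C \<subseteq> w" using tf by (auto simp: test_fun_vec_def test_fun_iff intro!: compact_UN)
  have "V x $ i = 0" if "x \<notin> ?C" for x i
  proof (rule C1_grad_zero_outside(2)[of "\<lambda>x. u x $ i" "\<lambda>x. V x $ i"])
    show "C1_grad (\<lambda>x. u x $ i) (\<lambda>x. V x $ i)" using tf by (simp add: test_fun_vec_def test_fun_iff)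
    show "x \<notin> closure {x. u x $ i \<noteq> 0}" using that by blast
  qed
  then have "f x \<bullet> V x = 0" if "x \<in> w - ?C" for x using that by (simp add: inner_vec_def[of "f x"])
  then show ?thesis
    by (intro absolutely_integrable_on_compact_support[OF w(1) C] continuous_intros w(2) test_fun_vec_continuous(2)[OF tf])
qed

text \<open>Disjoint balls from a Vitali covering exhaust the set \<open>S\<close> of usable points
  up to a null set. Finitely many of them carry more than half of its measure, which turns 32 into
  64, and finiteness keeps the sum a test map. Disjointness leaves at most one summand at each
  point, so values, membership in \<open>V\<close> and squared norms are read off ball by
  ball.\<close>

lemma perturbation_step:
  fixes F :: "real^2 \<Rightarrow> real^2^2"
  assumes O: "open O'" "bounded O'" and V: "open V" and F: "continuous_on O' F" "F ` O' \<subseteq> V"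
    and Fs: "finite Fs" "\<And>f. f \<in> Fs \<Longrightarrow> continuous_on O' f"
    and \<delta>: "0 < \<delta>" "\<delta> \<le> 1" and \<epsilon>: "0 < \<epsilon>" "\<epsilon> \<le> 1"
  obtains w W where "test_fun_vec O' w W" "\<And>x. norm (w x) \<le> \<epsilon>" "\<And>x. x \<in> O' \<Longrightarrow> F x + W x \<in> V"
    "\<And>f. f \<in> Fs \<Longrightarrow> \<bar>integral O' (\<lambda>x. f x \<bullet> W x)\<bar> \<le> \<epsilon>"
    "\<delta>\<^sup>2 / 64 * measure lebesgue {x \<in> O'. rank_one_segment V \<delta> (F x)} \<le> integral O' (\<lambda>x. (norm (W x))\<^sup>2)"
proof -
  define S where "S = {x \<in> O'. rank_one_segment V \<delta> (F x)}"
  have Om: "O' \<in> lmeasurable" using O by (intro bounded_set_imp_lmeasurable) auto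
  have "open (O' \<inter> F -` {xi. rank_one_segment V \<delta> xi})"
    by (rule continuous_open_preimage[OF F(1) O(1) open_rank_one_segment[OF V]])
  moreover have "O' \<inter> F -` {xi. rank_one_segment V \<delta> xi} = S" by (auto simp: S_def)
  ultimately have oS: "open S" by simp
  have SO: "S \<subseteq> O'" by (auto simp: S_def)
  have Sm: "S \<in> lmeasurable" using oS SO O(2) bounded_subset by (intro bounded_set_imp_lmeasurable) auto
  show ?thesis
  proof (cases "measure lebesgue S = 0")
    case True
    show ?thesis
      by (rule that[of "\<lambda>_. 0" "\<lambda>_. 0"])
         (use True F(2) \<epsilon>(1) in \<open>auto simp: test_fun_vec_0 S_def[symmetric]\<close>)
  next
    case False
    then have Spos: "measure lebesgue S > 0" by (simp add: less_le)
    \<comment> \<open>The orthogonality errors of the disjoint balls add up to at most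
      \<open>\<epsilon>'\<close> times the measure of \<open>O'\<close>; the summand 1 also ensures
      \<open>\<epsilon>' \<le> \<epsilon>\<close>.\<close>
    define \<epsilon>' where "\<epsilon>' = \<epsilon> / (measure lebesgue O' + 1)"
    have mO: "measure lebesgue O' \<ge> 0" by simp
    then have mp: "measure lebesgue O' + 1 > 0" by linarith
    have \<epsilon>'0: "0 < \<epsilon>'" unfolding \<epsilon>'_def using \<epsilon>(1) mp by (rule divide_pos_pos)
    have "\<epsilon>' * (measure lebesgue O' + 1) = \<epsilon>" using mp by (simp add: \<epsilon>'_def)
    then have "\<epsilon>' * measure lebesgue O' + \<epsilon>' = \<epsilon>" by (simp add: distrib_left)
    moreover have "\<epsilon>' * measure lebesgue O' \<ge> 0" using \<epsilon>'0 by simp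
    ultimately have \<epsilon>': "0 < \<epsilon>'" "\<epsilon>' \<le> \<epsilon>" "\<epsilon>' * measure lebesgue O' \<le> \<epsilon>" using \<epsilon>'0 by linarith+
    define good where "good c \<rho> w W \<longleftrightarrow> test_fun_vec O' w W \<and> continuous_on UNIV W \<and>
      (\<forall>x. x \<notin> ball c \<rho> \<longrightarrow> w x = 0 \<and> W x = 0) \<and> (\<forall>x. norm (w x) \<le> \<epsilon>') \<and>
      (\<forall>x\<in>ball c \<rho>. F x + W x \<in> V) \<and>
      (\<forall>f\<in>Fs. \<bar>integral O' (\<lambda>x. f x \<bullet> W x)\<bar> \<le> \<epsilon>' * measure lebesgue (ball c \<rho>)) \<and>
      \<delta>\<^sup>2 / 32 * measure lebesgue (ball c \<rho>) \<le> integral O' (\<lambda>x. (norm (W x))\<^sup>2)" for c \<rho> w W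
    have "\<forall>c\<in>S. \<exists>d. d > 0 \<and> cball c d \<subseteq> O' \<and> (\<forall>\<rho>. 0 < \<rho> \<and> \<rho> \<le> d \<longrightarrow> (\<exists>w W. good c \<rho> w W))"
    proof
      fix c assume "c \<in> S"
      then have c: "c \<in> O'" "rank_one_segment V \<delta> (F c)" by (auto simp: S_def)
      have "\<epsilon>' \<le> 1" using \<epsilon>' \<epsilon> by linarith
      from local_perturbation[OF O(1) V F(1) Fs \<delta> \<epsilon>'(1) this c]
      show "\<exists>d. d > 0 \<and> cball c d \<subseteq> O' \<and> (\<forall>\<rho>. 0 < \<rho> \<and> \<rho> \<le> d \<longrightarrow> (\<exists>w W. good c \<rho> w W))"
        unfolding good_def by blast
    qed
    from bchoice[OF this] obtain d where d: "\<And>c. c \<in> S \<Longrightarrow> d c > 0" "\<And>c. c \<in> S \<Longrightarrow> cball c (d c) \<subseteq> O'"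
      "\<And>c \<rho>. c \<in> S \<Longrightarrow> 0 < \<rho> \<Longrightarrow> \<rho> \<le> d c \<Longrightarrow> \<exists>w W. good c \<rho> w W" by blast
    define K where "K = {(x, \<rho>). x \<in> S \<and> 0 < \<rho> \<and> \<rho> \<le> d x}"
    define B where "B i = ball (fst i) (snd i)" for i :: "(real^2) \<times> real"
    have BO: "B i \<subseteq> O'" if "i \<in> K" for i
    proof -
      have "B i \<subseteq> cball (fst i) (d (fst i))" using that by (auto simp: K_def B_def)
      moreover have "fst i \<in> S" using that by (auto simp: K_def)
      ultimately show ?thesis using d(2) by blast
    qed
    obtain C where C: "countable C" "C \<subseteq> K" "pairwise (\<lambda>i j. disjnt (B i) (B j)) C"
      "negligible (S - (\<Union>i\<in>C. B i))"
    proof (rule Vitali_covering_theorem_balls[of S K fst snd])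
      fix x and e :: real assume xe: "x \<in> S" "0 < e"
      let ?i = "(x, min (d x) (e / 2))"
      have "?i \<in> K" "x \<in> ball (fst ?i) (snd ?i)" "snd ?i < e" using xe d(1) by (auto simp: K_def)
      then show "\<exists>i. i \<in> K \<and> x \<in> ball (fst i) (snd i) \<and> snd i < e" by blast
    qed (use that in \<open>auto simp: B_def\<close>)
    have Cm: "(\<Union>i\<in>C. B i) \<in> lmeasurable"
    proof (intro bounded_set_imp_lmeasurable)
      show "bounded (\<Union>i\<in>C. B i)" using bounded_subset[OF O(2)] BO C(2) by blast
      have "open (\<Union>i\<in>C. B i)" by (auto simp: B_def)
      then show "(\<Union>i\<in>C. B i) \<in> sets lebesgue" by auto
    qed
    have "measure lebesgue S \<le> measure lebesgue ((\<Union>i\<in>C. B i) \<union> (S - (\<Union>i\<in>C. B i)))"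
      using Sm Cm by (intro measure_mono_fmeasurable fmeasurable.Un fmeasurable.Diff) (auto intro: fmeasurableD)
    also have "\<dots> \<le> measure lebesgue (\<Union>i\<in>C. B i) + measure lebesgue (S - (\<Union>i\<in>C. B i))"
      using Sm Cm by (intro measure_Un_le fmeasurableD fmeasurable.Diff)
    also have "measure lebesgue (S - (\<Union>i\<in>C. B i)) = 0" using C(4) by (rule negligible_imp_measure0)
    finally have SC: "measure lebesgue S \<le> measure lebesgue (\<Union>(B ` C))" by simp
    obtain D' where D': "D' \<subseteq> B ` C" "finite D'" "measure lebesgue (\<Union>(B ` C)) - measure lebesgue S / 2 < measure lebesgue (\<Union>D')"
    proof (rule measure_countable_Union_approachable[of "B ` C" "measure lebesgue S / 2" "measure lebesgue O'"])
      show "countable (B ` C)" using C(1) by simp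
      show "measure lebesgue S / 2 > 0" using Spos by simp
      show "X \<in> lmeasurable" if "X \<in> B ` C" for X using that by (auto simp: B_def)
      show "measure lebesgue (\<Union>D') \<le> measure lebesgue O'" if "D' \<subseteq> B ` C" "finite D'" for D'
      proof (rule measure_mono_fmeasurable[OF _ _ Om])
        show "\<Union>D' \<subseteq> O'" using that BO C(2) by blast
        have "open (\<Union>D')" using that by (auto simp: B_def)
        then show "\<Union>D' \<in> sets lebesgue" by auto
      qed
    qed blast
    obtain C' where C': "C' \<subseteq> C" "finite C'" "D' = B ` C'" using finite_subset_image[OF D'(2,1)] by blast
    have "\<forall>i\<in>C'. \<exists>p. good (fst i) (snd i) (fst p) (snd p)"
    proof
      fix i assume "i \<in> C'"
      then have "fst i \<in> S" "0 < snd i" "snd i \<le> d (fst i)" using C' C(2) by (auto simp: K_def)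
      from d(3)[OF this] show "\<exists>p. good (fst i) (snd i) (fst p) (snd p)" by auto
    qed
    from bchoice[OF this] obtain p where p: "\<And>i. i \<in> C' \<Longrightarrow> good (fst i) (snd i) (fst (p i)) (snd (p i))" by blast
    define wi Wi where "wi i = fst (p i)" and "Wi i = snd (p i)" for i
    note p' = p[folded wi_def Wi_def, unfolded good_def, folded B_def]
    have tf: "test_fun_vec O' (wi i) (Wi i)" "continuous_on UNIV (Wi i)" if "i \<in> C'" for i using p'[OF that] by auto
    have outside: "wi i x = 0" "Wi i x = 0" if "i \<in> C'" "x \<notin> B i" for i x using p'[OF that(1)] that(2) by auto
    define w W where "w x = (\<Sum>i\<in>C'. wi i x)" and "W x = (\<Sum>i\<in>C'. Wi i x)" for x
    have tfw: "test_fun_vec O' w W" unfolding w_def W_def by (rule test_fun_vec_sum[OF C'(2) tf(1)])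
    have disj: "pairwise (\<lambda>i j. disjnt (B i) (B j)) C'" using C(3) C'(1) pairwise_subset by blast
    have single: "(\<Sum>j\<in>C'. h j) = h i"
      if "i \<in> C'" "x \<in> B i" "\<And>j. j \<in> C' \<Longrightarrow> x \<notin> B j \<Longrightarrow> h j = 0" for i x and h :: "_ \<Rightarrow> 'z::real_vector"
    proof -
      have "h j = 0" if "j \<in> C' - {i}" for j
        using disj \<open>i \<in> C'\<close> \<open>x \<in> B i\<close> that by (intro \<open>\<And>j. j \<in> C' \<Longrightarrow> x \<notin> B j \<Longrightarrow> h j = 0\<close>) (auto simp: pairwise_def disjnt_def)
      then show ?thesis using sum.remove[OF C'(2) \<open>i \<in> C'\<close>, of h] by simp
    qed
    have in_ball: "w x = wi i x" "W x = Wi i x" "(\<Sum>j\<in>C'. (norm (Wi j x))\<^sup>2) = (norm (Wi i x))\<^sup>2"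
      if "i \<in> C'" "x \<in> B i" for i x
      unfolding w_def W_def using outside that by (auto intro!: single[OF that])
    have off: "w x = 0" "W x = 0" "(\<Sum>j\<in>C'. (norm (Wi j x))\<^sup>2) = 0" if "\<And>i. i \<in> C' \<Longrightarrow> x \<notin> B i" for x
      unfolding w_def W_def using outside that by (auto intro!: sum.neutral)
    have mB: "(\<Sum>i\<in>C'. measure lebesgue (B i)) = measure lebesgue (\<Union>D')"
      unfolding C'(3) using measure_UNION'[OF C'(2) _ disj, of lebesgue] by (simp add: B_def)
    have mBO: "measure lebesgue (\<Union>D') \<le> measure lebesgue O'"
    proof (rule measure_mono_fmeasurable[OF _ _ Om])
      show "\<Union>D' \<subseteq> O'" using D' BO C(2) by blast
      have "open (\<Union>D')" using D' by (auto simp: B_def)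
      then show "\<Union>D' \<in> sets lebesgue" by auto
    qed
    show ?thesis
    proof (rule that[OF tfw])
      show "norm (w x) \<le> \<epsilon>" for x
      proof (cases "\<exists>i\<in>C'. x \<in> B i")
        case True
        then obtain i where i: "i \<in> C'" "x \<in> B i" by blast
        have "norm (wi i x) \<le> \<epsilon>'" using p'[OF i(1)] by blast
        then show ?thesis using in_ball(1)[OF i] \<epsilon>'(2) by simp
      next
        case False
        then show ?thesis using off(1)[of x] \<epsilon>(1) by simp
      qed
      show "F x + W x \<in> V" if "x \<in> O'" for x
      proof (cases "\<exists>i\<in>C'. x \<in> B i")
        case True
        then obtain i where i: "i \<in> C'" "x \<in> B i" by blast
        have "F x + Wi i x \<in> V" using p'[OF i(1)] i(2) by blast
        then show ?thesis using in_ball(2)[OF i] by simp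
      next
        case False
        then show ?thesis using off(2)[of x] F(2) that by auto
      qed
      show "\<bar>integral O' (\<lambda>x. f x \<bullet> W x)\<bar> \<le> \<epsilon>" if f: "f \<in> Fs" for f
      proof -
        have "integral O' (\<lambda>x. f x \<bullet> W x) = integral O' (\<lambda>x. \<Sum>i\<in>C'. f x \<bullet> Wi i x)"
          by (simp add: W_def inner_sum_right)
        also have "\<dots> = (\<Sum>i\<in>C'. integral O' (\<lambda>x. f x \<bullet> Wi i x))"
          by (intro integral_sum C'(2) set_lebesgue_integral_eq_integral(1)
              test_fun_vec_inner_integrable[OF O(1) Fs(2)[OF f] tf(1)])
        finally have "\<bar>integral O' (\<lambda>x. f x \<bullet> W x)\<bar> \<le> (\<Sum>i\<in>C'. \<bar>integral O' (\<lambda>x. f x \<bullet> Wi i x)\<bar>)"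
          by simp
        also have "\<dots> \<le> (\<Sum>i\<in>C'. \<epsilon>' * measure lebesgue (B i))"
          using p' f by (intro sum_mono) blast
        also have "\<dots> = \<epsilon>' * measure lebesgue (\<Union>D')" by (simp add: mB flip: sum_distrib_left)
        also have "\<dots> \<le> \<epsilon>' * measure lebesgue O'" using mBO \<epsilon>'(1) by (intro mult_left_mono) auto
        finally show ?thesis using \<epsilon>'(3) by linarith
      qed
      have sq: "(norm (W x))\<^sup>2 = (\<Sum>i\<in>C'. (norm (Wi i x))\<^sup>2)" for x
      proof (cases "\<exists>i\<in>C'. x \<in> B i")
        case True
        then obtain i where i: "i \<in> C'" "x \<in> B i" by blast
        show ?thesis using in_ball(2,3)[OF i] by simp
      next
        case False
        then show ?thesis using off(2,3)[of x] by simp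
      qed
      have "\<delta>\<^sup>2 / 64 * measure lebesgue S = \<delta>\<^sup>2 / 32 * (measure lebesgue S / 2)" by simp
      also have "\<dots> \<le> \<delta>\<^sup>2 / 32 * measure lebesgue (\<Union>D')"
        using D'(3) SC by (intro mult_left_mono) auto
      also have "\<dots> = (\<Sum>i\<in>C'. \<delta>\<^sup>2 / 32 * measure lebesgue (B i))"
        unfolding mB[symmetric] by (rule sum_distrib_left)
      also have "\<dots> \<le> (\<Sum>i\<in>C'. integral O' (\<lambda>x. (norm (Wi i x))\<^sup>2))"
        using p' by (intro sum_mono) blast
      also have "\<dots> = integral O' (\<lambda>x. (norm (W x))\<^sup>2)"
        unfolding sq using O
        by (intro integral_sum[symmetric] C'(2) set_lebesgue_integral_eq_integral(1)
            continuous_absolutely_integrable_on continuous_intros tf(2)) auto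
      finally show "\<delta>\<^sup>2 / 64 * measure lebesgue {x \<in> O'. rank_one_segment V \<delta> (F x)} \<le> integral O' (\<lambda>x. (norm (W x))\<^sup>2)"
        by (simp add: S_def)
    qed
  qed
qed

section \<open>Iteration\<close>

text \<open>Here \<open>ip i j\<close> stands for the L^2 inner product of the i-th and j-th
  gradients, so that \<open>ip m m - 2 * ip k m + ip k k\<close> is a squared distance. Near
  orthogonality makes the energy almost monotone, hence convergent.\<close>

lemma almost_orthogonal_energy:
  fixes ip :: "nat \<Rightarrow> nat \<Rightarrow> real"
  assumes orth: "\<And>i k. i \<le> k \<Longrightarrow> \<bar>ip i (Suc k) - ip i k\<bar> \<le> (1 / 2) ^ k"
    and gain: "\<And>k. g k \<le> ip (Suc k) (Suc k) - 2 * ip k (Suc k) + ip k k" "\<And>k. 0 \<le> g k"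
    and bound: "\<And>k. ip k k \<le> B"
  shows "summable g" "\<And>e. e > 0 \<Longrightarrow> \<exists>N. \<forall>k\<ge>N. \<forall>m\<ge>k. ip m m - 2 * ip k m + ip k k < e"
proof -
  define T where "T k = ip k k - 4 * (1 / 2) ^ k" for k
  have step: "g k \<le> T (Suc k) - T k" for k
    using gain(1)[of k] orth[of k k] unfolding T_def by (simp add: abs_le_iff)
  have Tinc: "incseq T" using step gain(2) by (intro incseq_SucI) (meson diff_ge_0_iff_ge order.trans)
  have TB: "T k \<le> B" for k using bound[of k] zero_le_power[of "1 / 2 :: real" k] unfolding T_def by linarith
  have "(\<Sum>k<n. g k) \<le> B - T 0" for n
  proof -
    have "(\<Sum>k<n. g k) \<le> (\<Sum>k<n. T (Suc k) - T k)" by (intro sum_mono step)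
    also have "\<dots> = T n - T 0" by (rule sum_lessThan_telescope)
    finally show ?thesis using TB[of n] by linarith
  qed
  then show "summable g"
    by (intro bounded_imp_summable[of g "B - T 0"] gain(2))
       (metis lessThan_Suc_atMost)
  obtain L where L: "T \<longlonglongrightarrow> L" using incseq_convergent[OF Tinc] TB by blast
  have pow: "(\<lambda>k. (1 / 2 :: real) ^ k) \<longlonglongrightarrow> 0" by (intro LIMSEQ_realpow_zero) auto
  have "(\<lambda>k. T k + 4 * (1 / 2) ^ k) \<longlonglongrightarrow> L + 4 * 0" by (intro tendsto_intros L pow)
  then have J: "(\<lambda>k. ip k k) \<longlonglongrightarrow> L" by (simp add: T_def)
  \<comment> \<open>The errors from k to m form a geometric sum. Writing the squared distance as
    \<open>(ip m m - ip k k) - 2 * (ip k m - ip k k)\<close> then bounds it by a difference of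
    energies plus \<open>4 * (1 / 2) ^ k\<close>.\<close>
  have tail: "\<bar>ip k m - ip k k\<bar> \<le> 2 * (1 / 2) ^ k - 2 * (1 / 2) ^ m" if "k \<le> m" for k m
    using that
  proof (induction m rule: dec_induct)
    case (step m)
    then show ?case using orth[of k m] by simp
  qed simp
  fix e :: real assume e: "e > 0"
  have "eventually (\<lambda>k. \<bar>ip k k - L\<bar> < e / 4) sequentially"
    using tendstoD[OF J, of "e / 4"] e by (simp add: dist_real_def)
  moreover have "eventually (\<lambda>k. (1 / 2 :: real) ^ k < e / 8) sequentially"
    using order_tendstoD(2)[OF pow, of "e / 8"] e by simp
  ultimately have "eventually (\<lambda>k. \<bar>ip k k - L\<bar> < e / 4 \<and> (1 / 2 :: real) ^ k < e / 8) sequentially"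
    by eventually_elim auto
  then obtain N where N: "\<And>k. k \<ge> N \<Longrightarrow> \<bar>ip k k - L\<bar> < e / 4 \<and> (1 / 2 :: real) ^ k < e / 8"
    unfolding eventually_sequentially by blast
  show "\<exists>N. \<forall>k\<ge>N. \<forall>m\<ge>k. ip m m - 2 * ip k m + ip k k < e"
  proof (intro exI[of _ N] allI impI)
    fix k m assume km: "N \<le> k" "k \<le> m"
    have "(1 / 2 :: real) ^ m \<ge> 0" by simp
    then show "ip m m - 2 * ip k m + ip k k < e"
      using N[of k] N[of m] tail[OF km(2)] km by linarith
  qed
qed

text \<open>If \<open>a\<close> stayed above some \<open>e > 0\<close> from some index on,
  comparison would make the harmonic series converge.\<close>

lemma small_subsequence:
  fixes a :: "nat \<Rightarrow> real"
  assumes "\<And>k. 0 \<le> a k" "summable (\<lambda>k. a k / Suc k)"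
  obtains s where "strict_mono s" "\<And>j. a (s j) < (1 / 2) ^ j"
proof -
  have ex: "\<exists>k>n. a k < e" if e: "e > 0" for n e
  proof (rule ccontr)
    assume "\<not> (\<exists>k>n. a k < e)"
    then have ge: "\<And>k. k > n \<Longrightarrow> e \<le> a k" by force
    have "summable (\<lambda>k. e * inverse (real (Suc k)))"
    proof (rule summable_comparison_test'[OF assms(2), of "Suc n"])
      fix k assume "Suc n \<le> k"
      then have "e / Suc k \<le> a k / Suc k" using ge by (intro divide_right_mono) auto
      then show "norm (e * inverse (real (Suc k))) \<le> a k / Suc k" using e by (simp add: divide_inverse)
    qed
    then have "summable (\<lambda>k. inverse (real (Suc k)))" using e by (simp add: summable_cmult_iff)
    then show False using not_summable_harmonic[where 'a = real] summable_Suc_iff[of "\<lambda>k. inverse (real k)"] by simp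
  qed
  have "\<exists>s. \<forall>n. a (s n) < (1 / 2) ^ n \<and> s n < s (Suc n)"
  proof (rule dependent_nat_choice)
    show "\<exists>x. a x < (1 / 2) ^ 0" using ex[of 1] by auto
    show "\<exists>y. a y < (1 / 2) ^ Suc n \<and> x < y" for x n using ex[of "(1 / 2) ^ Suc n" x] by auto
  qed
  then obtain s where s: "\<And>n. a (s n) < (1 / 2) ^ n" "\<And>n. s n < s (Suc n)" by blast
  show ?thesis by (rule that[of s]) (auto simp: strict_mono_Suc_iff s)
qed

lemma rank_one_segment_mono: "rank_one_segment V d xi \<Longrightarrow> d' \<le> d \<Longrightarrow> rank_one_segment V d' xi"
  unfolding rank_one_segment_def by (meson order.trans)

lemma bounded_continuous_absolutely_integrable_on:
  fixes f :: "'a::euclidean_space \<Rightarrow> 'b::euclidean_space"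
  assumes "open S" "bounded S" "continuous_on S f" "\<And>x. x \<in> S \<Longrightarrow> norm (f x) \<le> B"
  shows "f absolutely_integrable_on S"
proof (rule measurable_bounded_by_integrable_imp_absolutely_integrable[OF _ _ _ assms(4)])
  show S: "S \<in> sets lebesgue" using assms(1) by auto
  then show "f \<in> borel_measurable (lebesgue_on S)" by (rule continuous_imp_measurable_on_sets_lebesgue[OF assms(3)])
  show "(\<lambda>x. B) integrable_on S" using assms(2) S by (intro integrable_on_const bounded_set_imp_lmeasurable)
qed

lemma perturbation_sequence:
  fixes D :: "real^2 \<Rightarrow> real^2^2"
  assumes O: "open O'" "bounded O'" and V: "open V" and D: "continuous_on O' D" "D ` O' \<subseteq> V"
  obtains u U where "\<And>k::nat. test_fun_vec O' (u k) (U k)" "\<And>k x. x \<in> O' \<Longrightarrow> D x + U k x \<in> V"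
    "\<And>x. u 0 x = 0" "\<And>k x. norm (u (Suc k) x - u k x) \<le> (1 / 2) ^ k"
    "\<And>i k. i \<le> k \<Longrightarrow> \<bar>integral O' (\<lambda>x. (D x + U i x) \<bullet> (U (Suc k) x - U k x))\<bar> \<le> (1 / 2) ^ k"
    "\<And>k. 1 / Suc k / 64 * measure lebesgue {x \<in> O'. rank_one_segment V (1 / sqrt (Suc k)) (D x + U k x)}
        \<le> integral O' (\<lambda>x. (norm (U (Suc k) x - U k x))\<^sup>2)"
proof -
  \<comment> \<open>Dependent choice passes on only the current state, yet each increment must be
    almost orthogonal to all earlier gradients. The third component therefore stores them; it starts
    with \<open>D\<close>, and every step inserts the new gradient.\<close>
  define P where "P k s \<longleftrightarrow> test_fun_vec O' (fst s) (fst (snd s)) \<and> (\<forall>x\<in>O'. D x + fst (snd s) x \<in> V) \<and>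
      finite (snd (snd s)) \<and> (\<forall>f\<in>snd (snd s). continuous_on O' f) \<and> (\<lambda>x. D x + fst (snd s) x) \<in> snd (snd s) \<and>
      (k = 0 \<longrightarrow> fst s = (\<lambda>_. 0))"
    for k :: nat and s :: "(real^2 \<Rightarrow> real^2) \<times> (real^2 \<Rightarrow> real^2^2) \<times> (real^2 \<Rightarrow> real^2^2) set"
  define Q where "Q k s s' \<longleftrightarrow> (\<forall>x. norm (fst s' x - fst s x) \<le> (1 / 2) ^ k) \<and> snd (snd s) \<subseteq> snd (snd s') \<and>
      (\<forall>f\<in>snd (snd s). \<bar>integral O' (\<lambda>x. f x \<bullet> (fst (snd s') x - fst (snd s) x))\<bar> \<le> (1 / 2) ^ k) \<and>
      1 / Suc k / 64 * measure lebesgue {x \<in> O'. rank_one_segment V (1 / sqrt (Suc k)) (D x + fst (snd s) x)}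
        \<le> integral O' (\<lambda>x. (norm (fst (snd s') x - fst (snd s) x))\<^sup>2)"
    for k :: nat and s s' :: "(real^2 \<Rightarrow> real^2) \<times> (real^2 \<Rightarrow> real^2^2) \<times> (real^2 \<Rightarrow> real^2^2) set"
  have "\<exists>s. \<forall>k. P k (s k) \<and> Q k (s k) (s (Suc k))"
  proof (rule dependent_nat_choice)
    have "P 0 ((\<lambda>_. 0), (\<lambda>_. 0), {D})" using D by (auto simp: P_def test_fun_vec_0)
    then show "\<exists>s. P 0 s" by blast
    fix s k assume Ps: "P k s"
    obtain u U Fs where s: "s = (u, U, Fs)" by (cases s)
    have uU: "test_fun_vec O' u U" "\<And>x. x \<in> O' \<Longrightarrow> D x + U x \<in> V" and Fs: "finite Fs" "\<And>f. f \<in> Fs \<Longrightarrow> continuous_on O' f"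
      using Ps by (auto simp: P_def s)
    have cU: "continuous_on O' (\<lambda>x. D x + U x)"
      by (intro continuous_intros D(1) test_fun_vec_continuous[OF uU(1)])
    have im: "(\<lambda>x. D x + U x) ` O' \<subseteq> V" using uU(2) by auto
    have \<delta>: "0 < 1 / sqrt (Suc k)" "1 / sqrt (Suc k) \<le> 1" by auto
    have \<epsilon>: "0 < (1 / 2 :: real) ^ k" "(1 / 2 :: real) ^ k \<le> 1" by (auto intro: power_le_one)
    obtain w W where w: "test_fun_vec O' w W" "\<And>x. norm (w x) \<le> (1 / 2) ^ k" "\<And>x. x \<in> O' \<Longrightarrow> D x + U x + W x \<in> V"
      "\<And>f. f \<in> Fs \<Longrightarrow> \<bar>integral O' (\<lambda>x. f x \<bullet> W x)\<bar> \<le> (1 / 2) ^ k"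
      "(1 / sqrt (Suc k))\<^sup>2 / 64 * measure lebesgue {x \<in> O'. rank_one_segment V (1 / sqrt (Suc k)) (D x + U x)} \<le> integral O' (\<lambda>x. (norm (W x))\<^sup>2)"
      using perturbation_step[OF O V cU im Fs \<delta> \<epsilon>] by blast
    have sq: "(1 / sqrt (Suc k))\<^sup>2 = 1 / Suc k" by (simp add: power_divide)
    let ?s = "(\<lambda>x. u x + w x, \<lambda>x. U x + W x, insert (\<lambda>x. D x + (U x + W x)) Fs)"
    have "continuous_on O' (\<lambda>x. D x + (U x + W x))"
      by (intro continuous_intros D(1) test_fun_vec_continuous[OF uU(1)] test_fun_vec_continuous[OF w(1)])
    then have "P (Suc k) ?s"
      using test_fun_vec_add[OF uU(1) w(1)] w(3) Fs by (auto simp: P_def add.assoc)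
    moreover have "Q k s ?s" using w(2,4,5) unfolding sq by (auto simp: Q_def s)
    ultimately show "\<exists>s'. P (Suc k) s' \<and> Q k s s'" by blast
  qed
  then obtain s where s: "\<And>k. P k (s k)" "\<And>k. Q k (s k) (s (Suc k))" by blast
  define u U Fs where "u k = fst (s k)" and "U k = fst (snd (s k))" and "Fs k = snd (snd (s k))" for k
  have P: "test_fun_vec O' (u k) (U k)" "\<And>x. x \<in> O' \<Longrightarrow> D x + U k x \<in> V" "(\<lambda>x. D x + U k x) \<in> Fs k" for k
    using s(1)[of k] by (auto simp: P_def u_def U_def Fs_def)
  have u0: "u 0 x = 0" for x using s(1)[of 0] by (auto simp: P_def u_def)
  have Q: "\<And>x. norm (u (Suc k) x - u k x) \<le> (1 / 2) ^ k" "Fs k \<subseteq> Fs (Suc k)"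
      "\<And>f. f \<in> Fs k \<Longrightarrow> \<bar>integral O' (\<lambda>x. f x \<bullet> (U (Suc k) x - U k x))\<bar> \<le> (1 / 2) ^ k"
      "1 / Suc k / 64 * measure lebesgue {x \<in> O'. rank_one_segment V (1 / sqrt (Suc k)) (D x + U k x)}
        \<le> integral O' (\<lambda>x. (norm (U (Suc k) x - U k x))\<^sup>2)" for k
    using s(2)[of k] unfolding Q_def u_def U_def Fs_def by blast+
  have "Fs i \<subseteq> Fs k" if "i \<le> k" for i k using that by (rule lift_Suc_mono_le[of Fs, OF Q(2)])
  then have F: "(\<lambda>x. D x + U i x) \<in> Fs k" if "i \<le> k" for i k using P(3) that by blast
  show ?thesis
    by (rule that[of u U]) (rule P u0 Q(1) Q(3)[OF F] Q(4) | assumption)+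
qed

text \<open>Singular values no longer occur: \<open>E\<close> enters only through
  \<open>nonstable\<close>, and \<open>V\<close> is any bounded open set of 2x2 matrices.\<close>

theorem convex_integration:
  fixes D :: "real^2 \<Rightarrow> real^2^2"
  assumes O: "open O'" "bounded O'" and V: "open V" "bounded V" and D: "continuous_on O' D" "D ` O' \<subseteq> V"
    and nonstable: "\<And>xi. xi \<in> closure V \<Longrightarrow> xi \<notin> E \<Longrightarrow>
        \<exists>d>0. \<forall>eta\<in>V. norm (eta - xi) < d \<longrightarrow> rank_one_segment V d eta"
  obtains u U C v G where "\<And>k::nat. test_fun_vec O' (u k) (U k)"
    "\<And>k x. norm (u k x) \<le> C" "\<And>k x. norm (U k x) \<le> C"
    "\<And>x. (\<lambda>k. u k x) \<longlonglongrightarrow> v x" "AE x in lebesgue. (\<lambda>k. U k x) \<longlonglongrightarrow> G x"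
    "G \<in> borel_measurable lebesgue" "AE x in lebesgue. x \<in> O' \<longrightarrow> D x + G x \<in> E" "\<And>x. x \<notin> O' \<Longrightarrow> G x = 0"
proof -
  obtain u U where tf: "\<And>k::nat. test_fun_vec O' (u k) (U k)" and inV: "\<And>k x. x \<in> O' \<Longrightarrow> D x + U k x \<in> V"
    and u0: "\<And>x. u 0 x = 0" and du: "\<And>k x. norm (u (Suc k) x - u k x) \<le> (1 / 2) ^ k"
    and orth: "\<And>i k. i \<le> k \<Longrightarrow> \<bar>integral O' (\<lambda>x. (D x + U i x) \<bullet> (U (Suc k) x - U k x))\<bar> \<le> (1 / 2) ^ k"
    and gain: "\<And>k. 1 / Suc k / 64 * measure lebesgue {x \<in> O'. rank_one_segment V (1 / sqrt (Suc k)) (D x + U k x)}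
        \<le> integral O' (\<lambda>x. (norm (U (Suc k) x - U k x))\<^sup>2)"
    using perturbation_sequence[OF O V(1) D] by blast
  have Om: "O' \<in> lmeasurable" using O by (intro bounded_set_imp_lmeasurable) auto
  then have Os: "O' \<in> sets lebesgue" by (rule fmeasurableD)
  obtain b where b: "b > 0" "\<And>xi. xi \<in> V \<Longrightarrow> norm xi \<le> b" using V(2) unfolding bounded_pos by blast
  define F where "F k x = D x + U k x" for k x
  have FV: "F k x \<in> V" if "x \<in> O'" for k x using inV that by (simp add: F_def)
  have cF: "continuous_on O' (F k)" for k
    unfolding F_def by (intro continuous_intros D(1) test_fun_vec_continuous[OF tf])
  have Fb: "norm (F k x) \<le> b" if "x \<in> O'" for k x using b(2) FV that by blast
  have U0: "U k x = 0" if "x \<notin> O'" for k x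
    using tf[of k] test_fun_zero_outside(2)[OF _ that] unfolding test_fun_vec_def vec_eq_iff[of "U k x"] zero_index by blast
  have Ub: "norm (U k x) \<le> 2 * b" for k x
  proof (cases "x \<in> O'")
    case True
    have "D x \<in> V" using D(2) True by blast
    have "norm (U k x) \<le> norm (F k x) + norm (D x)"
      unfolding F_def using norm_triangle_ineq4[of "D x + U k x" "D x"] by simp
    then show ?thesis using Fb[OF True, of k] b(2)[OF \<open>D x \<in> V\<close>] by linarith
  qed (use U0 b in auto)
  define ip where "ip i j = integral O' (\<lambda>x. F i x \<bullet> F j x)" for i j
  have ii: "(\<lambda>x. F i x \<bullet> F j x) integrable_on O'" for i j
  proof (intro set_lebesgue_integral_eq_integral(1) bounded_continuous_absolutely_integrable_on[OF O, where B = "b * b"])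
    show "continuous_on O' (\<lambda>x. F i x \<bullet> F j x)" by (intro continuous_intros cF)
    show "norm (F i x \<bullet> F j x) \<le> b * b" if "x \<in> O'" for x
      using Cauchy_Schwarz_ineq2[of "F i x" "F j x"] mult_mono[OF Fb[OF that, of i] Fb[OF that, of j]] b by simp
  qed
  have ip_diff: "integral O' (\<lambda>x. F i x \<bullet> (U m x - U k x)) = ip i m - ip i k" for i k m
  proof -
    have "(\<lambda>x. F i x \<bullet> (U m x - U k x)) = (\<lambda>x. F i x \<bullet> F m x - F i x \<bullet> F k x)"
      by (auto simp: F_def inner_diff_right[symmetric])
    then show ?thesis unfolding ip_def by (simp add: Henstock_Kurzweil_Integration.integral_diff[OF ii ii])
  qed
  have sq: "(norm (F m x - F k x))\<^sup>2 = F m x \<bullet> F m x - 2 * (F k x \<bullet> F m x) + F k x \<bullet> F k x" for m k x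
    unfolding power2_norm_eq_inner by (simp add: inner_diff_left inner_diff_right inner_commute)
  have sq_int: "((\<lambda>x. (norm (F m x - F k x))\<^sup>2) has_integral (ip m m - 2 * ip k m + ip k k)) O'" for m k
    unfolding sq ip_def using ii
    by (intro has_integral_add has_integral_diff has_integral_mult_right integrable_integral)
  have UF: "U m x - U k x = F m x - F k x" for m k x by (simp add: F_def)
  define \<delta> where "\<delta> k = 1 / sqrt (Suc k)" for k
  define A where "A k = {x \<in> O'. rank_one_segment V (\<delta> k) (F k x)}" for k
  define a where "a k = measure lebesgue (A k)" for k
  have orth': "\<bar>ip i (Suc k) - ip i k\<bar> \<le> (1 / 2) ^ k" if "i \<le> k" for i k
    using orth[OF that] ip_diff[of i "Suc k" k] by (simp add: F_def)
  have gain': "a k / Suc k / 64 \<le> ip (Suc k) (Suc k) - 2 * ip k (Suc k) + ip k k" for k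
    using gain[of k] integral_unique[OF sq_int[of "Suc k" k]] unfolding UF by (simp add: a_def A_def \<delta>_def F_def)
  have bound': "ip k k \<le> b * b * measure lebesgue O'" for k
  proof -
    have "ip k k \<le> integral O' (\<lambda>x. b * b * 1)"
      unfolding ip_def
    proof (rule integral_le[OF ii])
      show "(\<lambda>x. b * b * 1) integrable_on O'" by (intro integrable_on_const Om)
      show "F k x \<bullet> F k x \<le> b * b * 1" if "x \<in> O'" for x
        using power_mono[OF Fb[OF that, of k], of 2] unfolding power2_norm_eq_inner by (simp add: power2_eq_square)
    qed
    also have "\<dots> = b * b * measure lebesgue O'"
      using integral_mult_right[of O' "b * b" "\<lambda>x. 1"] by (simp only: lmeasure_integral[OF Om])
    finally show ?thesis .
  qed
  have a0: "0 \<le> a k" for k by (simp add: a_def)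
  have g0: "0 \<le> a k / Suc k / 64" for k using a0 by simp
  note energy = almost_orthogonal_energy[of ip "\<lambda>k. a k / Suc k / 64", OF orth' gain' g0 bound']
  have "summable (\<lambda>k. a k / Suc k)"
  proof -
    have "64 * (x / 64) = x" for x :: real by simp
    then show ?thesis using summable_mult[OF energy(1), of 64] by (simp only:)
  qed
  then obtain s where s: "strict_mono s" "\<And>j. a (s j) < (1 / 2) ^ j"
    using small_subsequence[of a] a0 by blast
  let ?M = "lebesgue_on O'"
  have FM: "integrable ?M (F k)" for k
  proof -
    have "F k absolutely_integrable_on O'" by (rule bounded_continuous_absolutely_integrable_on[OF O cF Fb])
    then show ?thesis using Os by (simp add: set_integrable_def integrable_restrict_space)
  qed
  \<comment> \<open>Almost everywhere convergence of a subsequence is drawn from L^1. The inequality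
    r \<le> \<eta> + r^2 / (4 \<eta>) converts small L^2 distances; \<eta> is chosen so that its
    integral is below \<open>e / 2\<close>, the strict inequality coming from the summand 1 in
    \<open>m\<close>.\<close>
  have L1: "\<exists>N. \<forall>i\<ge>N. \<forall>j\<ge>N. (LINT x|?M. norm (F i x - F j x)) < e" if e: "e > 0" for e
  proof -
    define m where "m = measure lebesgue O' + 1"
    have m: "m > 0" "measure lebesgue O' < m" by (auto simp: m_def add_nonneg_pos)
    define \<eta> where "\<eta> = e / (2 * m)"
    have \<eta>: "\<eta> > 0" "\<eta> * m = e / 2" using e m by (auto simp: \<eta>_def)
    obtain N where N: "\<And>k l. k \<ge> N \<Longrightarrow> l \<ge> k \<Longrightarrow> ip l l - 2 * ip k l + ip k k < 2 * \<eta> * e"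
      using energy(2)[of "2 * \<eta> * e"] e \<eta> by auto
    have le: "(LINT x|?M. norm (F l x - F k x)) < e" if "k \<ge> N" "l \<ge> k" for k l
    proof -
      have int: "integrable ?M (\<lambda>x. norm (F l x - F k x))" by (intro integrable_norm Bochner_Integration.integrable_diff FM)
      have hi: "((\<lambda>x. \<eta> * 1 + (1 / (4 * \<eta>)) * (norm (F l x - F k x))\<^sup>2) has_integral
          (\<eta> * measure lebesgue O' + (1 / (4 * \<eta>)) * (ip l l - 2 * ip k l + ip k k))) O'"
      proof (rule has_integral_add)
        show "((\<lambda>x. \<eta> * 1) has_integral \<eta> * measure lebesgue O') O'"
          unfolding lmeasure_integral[OF Om]
          by (intro has_integral_mult_right integrable_integral integrable_on_const Om)
        show "((\<lambda>x. (1 / (4 * \<eta>)) * (norm (F l x - F k x))\<^sup>2) has_integral (1 / (4 * \<eta>)) * (ip l l - 2 * ip k l + ip k k)) O'"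
          by (intro has_integral_mult_right sq_int)
      qed
      have "(LINT x|?M. norm (F l x - F k x)) = integral O' (\<lambda>x. norm (F l x - F k x))"
        by (rule lebesgue_integral_eq_integral[OF int Os])
      also have "\<dots> \<le> integral O' (\<lambda>x. \<eta> * 1 + (1 / (4 * \<eta>)) * (norm (F l x - F k x))\<^sup>2)"
      proof (rule integral_le)
        show "(\<lambda>x. norm (F l x - F k x)) integrable_on O'" using integrable_on_lebesgue_on[OF int Os] .
        show "(\<lambda>x. \<eta> * 1 + (1 / (4 * \<eta>)) * (norm (F l x - F k x))\<^sup>2) integrable_on O'"
          using hi by (rule has_integral_integrable)
        show "norm (F l x - F k x) \<le> \<eta> * 1 + (1 / (4 * \<eta>)) * (norm (F l x - F k x))\<^sup>2" for x
        proof -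
          have "0 \<le> (norm (F l x - F k x) - 2 * \<eta>)\<^sup>2" by simp
          then have "norm (F l x - F k x) * (4 * \<eta>) \<le> 4 * \<eta> * \<eta> + (norm (F l x - F k x))\<^sup>2"
            by (simp add: power2_diff power2_eq_square algebra_simps)
          then show ?thesis using \<eta>(1) by (simp add: field_simps)
        qed
      qed
      also have "\<dots> = \<eta> * measure lebesgue O' + (1 / (4 * \<eta>)) * (ip l l - 2 * ip k l + ip k k)"
        using hi by (rule integral_unique)
      also have "\<dots> < e / 2 + e / 2"
      proof (rule add_less_le_mono)
        show "\<eta> * measure lebesgue O' < e / 2"
          using mult_strict_left_mono[OF m(2) \<eta>(1)] \<eta>(2) by simp
        show "(1 / (4 * \<eta>)) * (ip l l - 2 * ip k l + ip k k) \<le> e / 2"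
          using N[OF that] \<eta>(1) by (simp add: field_simps)
      qed
      finally show ?thesis by simp
    qed
    have "(LINT x|?M. norm (F i x - F j x)) < e" if "i \<ge> N" "j \<ge> N" for i j
      using le[of i j] le[of j i] that by (cases "i \<le> j") (simp_all add: norm_minus_commute)
    then show ?thesis by blast
  qed
  have "\<exists>N. \<forall>i\<ge>N. \<forall>j\<ge>N. (LINT x|?M. norm (F (s i) x - F (s j) x)) < e" if "e > 0" for e
    using L1[OF that] seq_suble[OF s(1)] by (meson order.trans)
  then obtain r where r: "strict_mono r" "AE x in ?M. Cauchy (\<lambda>i. F (s (r i)) x)"
    using cauchy_L1_AE_cauchy_subseq[of ?M "\<lambda>i. F (s i)", OF FM] by blast
  \<comment> \<open>Two extractions: \<open>s\<close> makes the measures \<open>a\<close> summable,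
    and \<open>r\<close> then makes the gradients converge almost everywhere. Since
    \<open>r j \<ge> j\<close>, the second does not spoil the first.\<close>
  define \<kappa> where "\<kappa> j = s (r j)" for j
  have \<kappa>: "strict_mono \<kappa>" using strict_mono_o[OF s(1) r(1)] by (simp add: \<kappa>_def[abs_def] o_def)
  have a\<kappa>: "a (\<kappa> j) \<le> (1 / 2) ^ j" for j
  proof -
    have "(1 / 2 :: real) ^ r j \<le> (1 / 2) ^ j" using seq_suble[OF r(1), of j] by (intro power_decreasing) auto
    then show ?thesis using s(2)[of "r j"] unfolding \<kappa>_def by linarith
  qed
  define G where "G x = lim (\<lambda>j. U (\<kappa> j) x)" for x
  have Gm: "G \<in> borel_measurable lebesgue"
    unfolding G_def using test_fun_vec_continuous[OF tf] by (intro borel_measurable_lim_metric continuous_measurable_lebesgue)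
  have G0: "G x = 0" if "x \<notin> O'" for x unfolding G_def using U0[OF that] by simp
  have AEC: "AE x in lebesgue. x \<in> O' \<longrightarrow> Cauchy (\<lambda>i. F (\<kappa> i) x)"
    using r(2) Os unfolding \<kappa>_def by (simp add: AE_restrict_space_iff)
  have limU: "(\<lambda>j. U (\<kappa> j) x) \<longlonglongrightarrow> G x" if "x \<in> O' \<longrightarrow> Cauchy (\<lambda>i. F (\<kappa> i) x)" for x
  proof (cases "x \<in> O'")
    case True
    then have "convergent (\<lambda>i. F (\<kappa> i) x)" using that Cauchy_convergent by blast
    then have "convergent (\<lambda>i. F (\<kappa> i) x - D x)" by (intro convergent_diff convergent_const)
    then show ?thesis unfolding G_def F_def by (simp add: convergent_LIMSEQ_iff)
  next
    case False
    then show ?thesis using U0 G0 by simp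
  qed
  have Am: "A k \<in> lmeasurable" for k
  proof (rule bounded_set_imp_lmeasurable)
    show "bounded (A k)" using O(2) by (rule bounded_subset) (auto simp: A_def)
    have "open (O' \<inter> F k -` {xi. rank_one_segment V (\<delta> k) xi})"
      by (rule continuous_open_preimage[OF cF O(1) open_rank_one_segment[OF V(1)]])
    moreover have "O' \<inter> F k -` {xi. rank_one_segment V (\<delta> k) xi} = A k" by (auto simp: A_def)
    ultimately show "A k \<in> sets lebesgue" by auto
  qed
  have BC: "AE x in lebesgue. eventually (\<lambda>j. x \<in> space lebesgue - A (\<kappa> j)) sequentially"
  proof (rule borel_cantelli_AE1)
    show "A (\<kappa> n) \<in> sets lebesgue" for n using Am by (rule fmeasurableD)
    show "emeasure lebesgue (A (\<kappa> n)) < \<infinity>" for n using Am[of "\<kappa> n"] by (auto simp: fmeasurable_def)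
    show "summable (\<lambda>n. measure lebesgue (A (\<kappa> n)))"
    proof (rule summable_comparison_test')
      show "summable (\<lambda>n. (1 / 2 :: real) ^ n)" by (intro summable_geometric) simp
      show "norm (measure lebesgue (A (\<kappa> n))) \<le> (1 / 2) ^ n" for n using a\<kappa>[of n] by (simp add: a_def)
    qed
  qed
  have \<delta>0: "(\<lambda>j. \<delta> (\<kappa> j)) \<longlonglongrightarrow> 0"
  proof -
    have "(\<lambda>n. sqrt (1 / Suc n)) \<longlonglongrightarrow> sqrt 0" by (intro tendsto_real_sqrt LIMSEQ_Suc[OF lim_1_over_n])
    then have "\<delta> \<longlonglongrightarrow> 0" by (simp add: \<delta>_def[abs_def] real_sqrt_divide)
    from LIMSEQ_subseq_LIMSEQ[OF this \<kappa>] show ?thesis by (simp add: o_def)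
  qed
  have inE: "AE x in lebesgue. x \<in> O' \<longrightarrow> D x + G x \<in> E"
    using AEC BC
  proof eventually_elim
    case (elim x)
    show ?case
    proof
      assume x: "x \<in> O'"
      let ?xi = "D x + G x"
      have lim: "(\<lambda>j. F (\<kappa> j) x) \<longlonglongrightarrow> ?xi" unfolding F_def by (intro tendsto_intros limU elim)
      have cl: "?xi \<in> closure V"
        unfolding closure_sequential using FV[OF x] lim by (intro exI[of _ "\<lambda>j. F (\<kappa> j) x"]) simp
      \<comment> \<open>Outside \<open>E\<close> the iterates near the limit would have segments of
        one fixed size \<open>d\<close>, hence of size \<open>\<delta> (\<kappa> j)\<close> as soon
        as this is below \<open>d\<close>. That puts \<open>x\<close> into
        \<open>A (\<kappa> j)\<close> for all large j, which \<open>BC\<close> excludes.\<close>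
      show "?xi \<in> E"
      proof (rule ccontr)
        assume "?xi \<notin> E"
        then obtain d where d: "d > 0" "\<And>eta. eta \<in> V \<Longrightarrow> norm (eta - ?xi) < d \<Longrightarrow> rank_one_segment V d eta"
          using nonstable[OF cl] by blast
        have "eventually (\<lambda>j. norm (F (\<kappa> j) x - ?xi) < d) sequentially"
          using tendstoD[OF lim d(1)] by (simp add: dist_norm)
        moreover have "eventually (\<lambda>j. \<delta> (\<kappa> j) < d) sequentially"
          using order_tendstoD(2)[OF \<delta>0 d(1)] .
        moreover have "eventually (\<lambda>j. x \<in> space lebesgue - A (\<kappa> j)) sequentially" by (rule elim)
        ultimately have "eventually (\<lambda>j. False) sequentially"
        proof eventually_elim
          case (elim j)
          have "rank_one_segment V d (F (\<kappa> j) x)" using d(2)[OF FV[OF x]] elim by blast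
          then have "rank_one_segment V (\<delta> (\<kappa> j)) (F (\<kappa> j) x)" using rank_one_segment_mono elim by (meson less_imp_le)
          then show ?case using elim x by (simp add: A_def)
        qed
        then show False by simp
      qed
    qed
  qed
  have ub: "norm (u k x) \<le> 2 - 2 * (1 / 2) ^ k" for k x
  proof (induction k)
    case (Suc k)
    have "norm (u (Suc k) x) \<le> norm (u (Suc k) x - u k x) + norm (u k x)"
      using norm_triangle_ineq[of "u (Suc k) x - u k x" "u k x"] by simp
    then show ?case using Suc du[of k x] by simp
  qed (simp add: u0)
  have "\<exists>l. (\<lambda>k. u k x) \<longlonglongrightarrow> l" for x
  proof -
    have "summable (\<lambda>k. u (Suc k) x - u k x)"
    proof (rule summable_comparison_test')
      show "summable (\<lambda>n. (1 / 2 :: real) ^ n)" by (intro summable_geometric) simp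
      show "norm (u (Suc n) x - u n x) \<le> (1 / 2) ^ n" for n by (rule du)
    qed
    then have "(\<lambda>n. \<Sum>k<n. u (Suc k) x - u k x) \<longlonglongrightarrow> (\<Sum>k. u (Suc k) x - u k x)" by (rule summable_LIMSEQ)
    moreover have "(\<Sum>k<n. u (Suc k) x - u k x) = u n x" for n
      using sum_lessThan_telescope[of "\<lambda>k. u k x" n] by (simp add: u0)
    ultimately show ?thesis by auto
  qed
  then obtain v where v: "\<And>x. (\<lambda>k. u k x) \<longlonglongrightarrow> v x" by metis
  show ?thesis
  proof (rule that[of "\<lambda>j. u (\<kappa> j)" "\<lambda>j. U (\<kappa> j)" "2 + 2 * b" v G])
    show "norm (u (\<kappa> k) x) \<le> 2 + 2 * b" for k x
      using ub[of "\<kappa> k" x] b(1) zero_le_power[of "1 / 2 :: real" "\<kappa> k"] by linarith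
    show "norm (U (\<kappa> k) x) \<le> 2 + 2 * b" for k x using Ub[of "\<kappa> k" x] by linarith
    show "(\<lambda>k. u (\<kappa> k) x) \<longlonglongrightarrow> v x" for x using LIMSEQ_subseq_LIMSEQ[OF v \<kappa>] by (simp add: o_def)
    show "AE x in lebesgue. (\<lambda>k. U (\<kappa> k) x) \<longlonglongrightarrow> G x" using AEC by eventually_elim (rule limU)
  qed (use tf Gm inE G0 in auto)
qed

section \<open>Solution of the differential inclusion\<close>

text \<open>For empty \<open>K\<close> there is no maximal second coordinate to start from. The
  constant 1 shows that the hull is empty, so \<open>V = {}\<close> can be taken in that
  case.\<close>

lemma rc_hull_empty: "rc_hull {} = {}"
proof -
  have "rank_one_convex (\<lambda>_. 1)" by (rule rank_one_convex_const)
  then have "\<exists>f. rank_one_convex f \<and> (\<forall>eta\<in>{}. f eta \<le> 0) \<and> \<not> f xi \<le> 0" for xi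
    by (intro exI[of _ "\<lambda>_. 1"]) auto
  then show ?thesis unfolding rc_hull_def by blast
qed

text \<open>\<open>D\<close> is chosen pointwise, independently of the pieces. Uniqueness of the
  derivative identifies it with the continuous derivative of every piece, so continuity passes to
  the union of the open pieces, even where they overlap.\<close>

lemma C1_piec_derivative:
  assumes "C1_piec \<Omega> phi"
  obtains w D where "open w" "w \<subseteq> \<Omega>" "\<Omega> - w \<in> null_sets lebesgue" "continuous_on w D"
    "\<And>x. x \<in> w \<Longrightarrow> (phi has_derivative (\<lambda>h. D x *v h)) (at x)"
proof -
  obtain W where W: "\<And>w. w \<in> W \<Longrightarrow> open w \<and> w \<subseteq> \<Omega> \<and> C1_closure w phi" "\<Omega> - \<Union>W \<in> null_sets lebesgue"
    using assms unfolding C1_piec_def by blast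
  define D where "D x = (SOME A. (phi has_derivative (\<lambda>h. A *v h)) (at x))" for x
  have piece: "continuous_on w D \<and> (\<forall>x\<in>w. (phi has_derivative (\<lambda>h. D x *v h)) (at x))" if w: "w \<in> W" for w
  proof -
    obtain D' where D': "continuous_on (closure w) D'" "\<And>x. x \<in> w \<Longrightarrow> (phi has_derivative (\<lambda>h. D' x *v h)) (at x)"
      using W(1)[OF w] unfolding C1_closure_def by blast
    have der: "(phi has_derivative (\<lambda>h. D x *v h)) (at x)" if "x \<in> w" for x
      unfolding D_def by (rule someI[of _ "D' x"]) (rule D'(2)[OF that])
    have eq: "D' x = D x" if "x \<in> w" for x
    proof -
      have "(\<lambda>h. D' x *v h) = (\<lambda>h. D x *v h)" using has_derivative_unique[OF D'(2)[OF that] der[OF that]] .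
      then show ?thesis by (metis matrix_eq)
    qed
    have "continuous_on w D" using continuous_on_subset[OF D'(1) closure_subset] by (rule continuous_on_eq) (rule eq)
    then show ?thesis using der by blast
  qed
  show ?thesis
  proof (rule that[of "\<Union>W" D])
    show "continuous_on (\<Union>W) D" using W(1) piece continuous_on_open_Union by blast
  qed (use W piece in blast)+
qed

theorem theorem1p1:
  fixes K :: "(real \<times> real) set" and E :: "(real^2^2) set"
    and \<Omega> :: "(real^2) set" and \<phi> :: "real^2 \<Rightarrow> real^2"
  assumes "compact K" and "K \<subseteq> {(x, y). 0 < x \<and> x \<le> y}"
    and "E = {xi. (lambda1 xi, lambda2 xi) \<in> K}"
    and "bounded \<Omega>" and "open \<Omega>"
    and "C1_piec \<Omega> \<phi>"
    and "\<exists>G. weak_deriv \<Omega> \<phi> G \<and>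
           (AE x in lebesgue. x \<in> \<Omega> \<longrightarrow> G x \<in> E \<union> interior (rc_hull E))"
  shows "\<exists>u. W1inf_0 \<Omega> (\<lambda>x. u x - \<phi> x) \<and>
           (\<exists>G. weak_deriv \<Omega> u G \<and> (AE x in lebesgue. x \<in> \<Omega> \<longrightarrow> G x \<in> E))"
proof -
  have "\<exists>V. open V \<and> bounded V \<and> interior (rc_hull E) \<subseteq> V \<and>
      (\<forall>xi. xi \<in> closure V \<longrightarrow> xi \<notin> E \<longrightarrow> (\<exists>d>0. \<forall>eta\<in>V. norm (eta - xi) < d \<longrightarrow> rank_one_segment V d eta))"
  proof (cases "K = {}")
    case True
    then show ?thesis using assms(3) by (intro exI[of _ "{}"]) (auto simp: rc_hull_empty)
  next
    case False
    have "continuous_on K snd" by (intro continuous_intros)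
    then obtain k where k: "k \<in> K" "\<And>k'. k' \<in> K \<Longrightarrow> snd k' \<le> snd k"
      using continuous_attains_sup[OF assms(1) False] by blast
    interpret iso: isotropic K "snd k"
      using assms(1,2) k by unfold_locales auto
    have E: "E = iso.E" using assms(3) by (simp add: iso.E_def)
    show ?thesis
      unfolding E using iso.open_U iso.bounded_U iso.interior_rc_hull iso.nonstable
      by (intro exI[of _ iso.U]) blast
  qed
  then obtain V where V: "open V" "bounded V" "interior (rc_hull E) \<subseteq> V"
    "\<And>xi. xi \<in> closure V \<Longrightarrow> xi \<notin> E \<Longrightarrow> \<exists>d>0. \<forall>eta\<in>V. norm (eta - xi) < d \<longrightarrow> rank_one_segment V d eta"
    by blast
  obtain G0 where G0: "weak_deriv \<Omega> \<phi> G0" "AE x in lebesgue. x \<in> \<Omega> \<longrightarrow> G0 x \<in> E \<union> interior (rc_hull E)"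
    using assms(7) by blast
  obtain w D where w: "open w" "w \<subseteq> \<Omega>" "\<Omega> - w \<in> null_sets lebesgue" and D: "continuous_on w D"
    "\<And>x. x \<in> w \<Longrightarrow> (\<phi> has_derivative (\<lambda>h. D x *v h)) (at x)"
    using C1_piec_derivative[OF assms(6)] by blast
  have G0D: "AE x in lebesgue. x \<in> w \<longrightarrow> G0 x = D x"
    by (rule weak_deriv_eq_derivative[OF G0(1) w(1,2) D(2,1)])
  \<comment> \<open>At almost every other point of \<open>w\<close> the gradient is outside
    \<open>V\<close>, hence outside the interior of the hull, and so already in \<open>E\<close>;
    there the perturbation is 0 and the gradient is kept.\<close>
  define O' where "O' = w \<inter> D -` V"
  have O': "open O'" unfolding O'_def by (rule continuous_open_preimage[OF D(1) w(1) V(1)])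
  have O'w: "O' \<subseteq> w" "O' \<subseteq> \<Omega>" using w(2) by (auto simp: O'_def)
  have bO': "bounded O'" using assms(4) O'w(2) by (rule bounded_subset)
  have DV: "D ` O' \<subseteq> V" by (auto simp: O'_def)
  obtain u U C v G where u: "\<And>k::nat. test_fun_vec O' (u k) (U k)"
    "\<And>k x. norm (u k x) \<le> C" "\<And>k x. norm (U k x) \<le> C"
    "\<And>x. (\<lambda>k. u k x) \<longlonglongrightarrow> v x" "AE x in lebesgue. (\<lambda>k. U k x) \<longlonglongrightarrow> G x"
    "G \<in> borel_measurable lebesgue" "AE x in lebesgue. x \<in> O' \<longrightarrow> D x + G x \<in> E" "\<And>x. x \<notin> O' \<Longrightarrow> G x = 0"
    using convex_integration[OF O' bO' V(1,2) continuous_on_subset[OF D(1) O'w(1)] DV V(4)] by blast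
  have tf: "test_fun_vec \<Omega> (u k) (U k)" for k using test_fun_vec_mono[OF u(1) O'w(2)] .
  note lim = W1inf_0_limit[OF assms(5,4) tf u(2-6)]
  have "weak_deriv \<Omega> (\<lambda>x. \<phi> x + v x) (\<lambda>x. G0 x + G x)" by (rule weak_deriv_add[OF G0(1) lim(1)])
  moreover have "AE x in lebesgue. x \<in> \<Omega> \<longrightarrow> G0 x + G x \<in> E"
    using G0(2) G0D u(7) AE_not_in[OF w(3)]
  proof eventually_elim
    case (elim x)
    show ?case
    proof
      assume x: "x \<in> \<Omega>"
      then have xw: "x \<in> w" using elim by blast
      show "G0 x + G x \<in> E"
      proof (cases "x \<in> O'")
        case True
        then show ?thesis using elim xw by simp
      next
        case False
        then have "G0 x \<notin> V" using elim xw by (auto simp: O'_def)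
        then show ?thesis using elim x V(3) u(8)[OF False] by auto
      qed
    qed
  qed
  moreover have "W1inf_0 \<Omega> (\<lambda>x. (\<phi> x + v x) - \<phi> x)" using lim(2) by simp
  ultimately show ?thesis
    by (intro exI[of _ "\<lambda>x. \<phi> x + v x"] conjI exI[of _ "\<lambda>x. G0 x + G x"])
qed

end
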